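(* Let $T>0$. Suppose that $\vec P_0\in[H^1_0(\Omega)\cap L^\infty(\Omega)]^d$ with $\|\Delta\vec P_0\|_{L^2(\Omega)}<\infty$, that $\rho\in H^1(0,T;L^2(\Omega))$, and that $H^2(\Omega)$ elliptic regularity holds for $\Phi$, i.e. $\|\Phi h\|_{H^2(\Omega)}\le C\|h\|_{L^2(\Omega)}$ for all $h\in L^2(\Omega)$ with a constant $C$ depending only on $d$ and $\Omega$. Then solutions of the weak gradient flow problem are unique: there is at most one $\vec P\in L^2(0,T;[H^1_0(\Omega)]^d)\cap H^1(0,T;[H^1_0(\Omega)']^d)$ such that $\vec P(0)=\vec P_0$ and $$\rho_v\langle\partial_t\vec P,\vec Q\rangle+g(\nabla\vec P,\nabla\vec Q)+(\mathbf{D}F(\vec P),\vec Q)+(\nabla V_{\vec P},\vec Q)=0\qquad\forall\,\vec Q\in[H^1_0(\Omega)]^d,\ t\in(0,T].$$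
   Context: $\Omega\subset\mathbb R^d$ ($d\le 3$) is a bounded domain with Lipschitz boundary; $\partial\Omega=\Gamma_D\cup\Gamma_N$ with $\Gamma_D,\Gamma_N$ disjoint and $\Gamma_D$ of positive surface measure. $\mathcal V_D=\{w\in H^1(\Omega): w=0\text{ on }\Gamma_D\}$. $(\cdot,\cdot)$ is the $L^2(\Omega)$ inner product (extended to a duality product where needed), $(\nabla\vec P,\nabla\vec Q)=\sum_{i=1}^d(\nabla P_i,\nabla Q_i)$, and $\langle\cdot,\cdot\rangle$ is the duality pairing between $H^1_0(\Omega)'$ and $H^1_0(\Omega)$ (componentwise). For a Banach space $B$, $H^1(0,T;B)=\{u\in L^2(0,T;B):\partial_tu\in L^2(0,T;B)\}$. $\epsilon>0$ is a constant. $\Phi:L^2(\Omega)\to\mathcal V_D$ is the solution operator: for $h\in L^2(\Omega)$, $\Phi h\in\mathcal V_D$ is the unique solution of $(\epsilon\nabla\Phi h,\nabla w)=(h,w)$ for all $w\in\mathcal V_D$. At each time, $V_{\vec P}=\Phi(\rho-\operatorname{div}\vec P)$. All components of the polarization follow the ferroelectric property with common real constants $\alpha,\beta,\gamma,g$, where either $\gamma,g>0$, or $\gamma=0$ and $\beta,g>0$; the viscosity constant is $\rho_v>0$ (common to all components). $\mathbf{D}F(\vec P)=\big((2\alpha+4\beta P_i^2+6\gamma P_i^4)P_i\big)_{i=1}^d$. The equation is understood for almost every $t$. *)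

theory Defs
  imports "HOL-Analysis.Analysis"
begin

text \<open>
  Conventions. Elements of the function spaces over \<open>\<Omega>\<close> are represented by functions on the whole
  space; values outside \<open>\<Omega>\<close> are irrelevant, and functions that agree almost everywhere in \<open>\<Omega>\<close>
  represent the same element. A vector field with components in a space \<open>B\<close> is a tuple
  \<open>'n \<Rightarrow> _\<close>, so that \<open>P i\<close> is the \<open>i\<close>-th component.
\<close>

section \<open>Test functions\<close>

definition partial :: "'a::euclidean_space \<Rightarrow> ('a \<Rightarrow> real) \<Rightarrow> 'a \<Rightarrow> real" where
  "partial e f = (\<lambda>x. frechet_derivative f (at x) e)"

primrec Ck :: "nat \<Rightarrow> ('a::euclidean_space \<Rightarrow> real) \<Rightarrow> bool" where
  "Ck 0 f \<longleftrightarrow> continuous_on UNIV f"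
| "Ck (Suc k) f \<longleftrightarrow> (\<forall>x. f differentiable (at x)) \<and> (\<forall>b\<in>Basis. Ck k (partial b f))"

definition smooth :: "('a::euclidean_space \<Rightarrow> real) \<Rightarrow> bool" where
  "smooth f \<longleftrightarrow> (\<forall>k. Ck k f)"

definition test_functions :: "'a::euclidean_space set \<Rightarrow> ('a \<Rightarrow> real) set" where
  "test_functions U =
     {\<phi>. smooth \<phi> \<and> compact (closure {x. \<phi> x \<noteq> 0}) \<and> closure {x. \<phi> x \<noteq> 0} \<subseteq> U}"

section \<open>Sobolev spaces\<close>

type_synonym 'n scalar_field = "real ^ 'n \<Rightarrow> real"

definition L2 :: "(real ^ 'n) set \<Rightarrow> 'n::finite scalar_field set" where
  "L2 \<Omega> = {u. u \<in> borel_measurable (lebesgue_on \<Omega>) \<and> integrable (lebesgue_on \<Omega>) (\<lambda>x. (u x)\<^sup>2)}"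

definition L2_inner :: "(real ^ 'n) set \<Rightarrow> 'n::finite scalar_field \<Rightarrow> 'n scalar_field \<Rightarrow> real" where
  "L2_inner \<Omega> u v = (LINT x|lebesgue_on \<Omega>. u x * v x)"

definition L2_norm :: "(real ^ 'n) set \<Rightarrow> 'n::finite scalar_field \<Rightarrow> real" where
  "L2_norm \<Omega> u = sqrt (L2_inner \<Omega> u u)"

definition has_weak_partial ::
  "(real ^ 'n) set \<Rightarrow> 'n::finite \<Rightarrow> 'n scalar_field \<Rightarrow> 'n scalar_field \<Rightarrow> bool" where
  "has_weak_partial \<Omega> i u v \<longleftrightarrow>
     v \<in> L2 \<Omega> \<and>
     (\<forall>\<phi>\<in>test_functions \<Omega>. L2_inner \<Omega> u (partial (axis i 1) \<phi>) = - L2_inner \<Omega> v \<phi>)"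

text \<open>A representative of the weak partial derivative; it is determined up to a null set.\<close>

definition weak_partial ::
  "(real ^ 'n) set \<Rightarrow> 'n::finite \<Rightarrow> 'n scalar_field \<Rightarrow> 'n scalar_field" where
  "weak_partial \<Omega> i u = (SOME v. has_weak_partial \<Omega> i u v)"

definition grad_inner :: "(real ^ 'n) set \<Rightarrow> 'n::finite scalar_field \<Rightarrow> 'n scalar_field \<Rightarrow> real" where
  "grad_inner \<Omega> u v = (\<Sum>i\<in>UNIV. L2_inner \<Omega> (weak_partial \<Omega> i u) (weak_partial \<Omega> i v))"

definition H1 :: "(real ^ 'n) set \<Rightarrow> 'n::finite scalar_field set" where
  "H1 \<Omega> = {u \<in> L2 \<Omega>. \<forall>i. \<exists>v. has_weak_partial \<Omega> i u v}"

definition H1_norm :: "(real ^ 'n) set \<Rightarrow> 'n::finite scalar_field \<Rightarrow> real" where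
  "H1_norm \<Omega> u = sqrt ((L2_norm \<Omega> u)\<^sup>2 + (\<Sum>i\<in>UNIV. (L2_norm \<Omega> (weak_partial \<Omega> i u))\<^sup>2))"

definition H2 :: "(real ^ 'n) set \<Rightarrow> 'n::finite scalar_field set" where
  "H2 \<Omega> = {u \<in> H1 \<Omega>. \<forall>i. weak_partial \<Omega> i u \<in> H1 \<Omega>}"

definition H2_norm :: "(real ^ 'n) set \<Rightarrow> 'n::finite scalar_field \<Rightarrow> real" where
  "H2_norm \<Omega> u = sqrt ((H1_norm \<Omega> u)\<^sup>2 +
     (\<Sum>i\<in>UNIV. \<Sum>j\<in>UNIV. (L2_norm \<Omega> (weak_partial \<Omega> j (weak_partial \<Omega> i u)))\<^sup>2))"

definition H10 :: "(real ^ 'n) set \<Rightarrow> 'n::finite scalar_field set" where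
  "H10 \<Omega> = {u \<in> H1 \<Omega>. \<forall>e>0. \<exists>\<phi>\<in>test_functions \<Omega>. H1_norm \<Omega> (u - \<phi>) < e}"

definition essentially_bounded :: "(real ^ 'n) set \<Rightarrow> 'n::finite scalar_field \<Rightarrow> bool" where
  "essentially_bounded \<Omega> u \<longleftrightarrow>
     u \<in> borel_measurable (lebesgue_on \<Omega>) \<and> (\<exists>M. AE x in lebesgue_on \<Omega>. \<bar>u x\<bar> \<le> M)"

text \<open>The distributional Laplacian of \<open>u\<close> is represented by a function in \<open>L\<^sup>2(\<Omega>)\<close>.\<close>

definition laplacian_in_L2 :: "(real ^ 'n) set \<Rightarrow> 'n::finite scalar_field \<Rightarrow> bool" where
  "laplacian_in_L2 \<Omega> u \<longleftrightarrow>
     (\<exists>f\<in>L2 \<Omega>. \<forall>\<phi>\<in>test_functions \<Omega>.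
        L2_inner \<Omega> u (\<lambda>x. \<Sum>i\<in>UNIV. partial (axis i 1) (partial (axis i 1) \<phi>) x) = L2_inner \<Omega> f \<phi>)"

text \<open>The dual of \<open>H\<^sup>1\<^sub>0(\<Omega>)\<close>. Only the values of a functional on \<open>H10 \<Omega>\<close> matter. The bound makes a
  functional respect almost-everywhere equality.\<close>

definition H10_dual :: "(real ^ 'n) set \<Rightarrow> ('n::finite scalar_field \<Rightarrow> real) set" where
  "H10_dual \<Omega> = {F.
     (\<forall>u\<in>H10 \<Omega>. \<forall>w\<in>H10 \<Omega>. F (\<lambda>x. u x + w x) = F u + F w) \<and>
     (\<forall>c. \<forall>u\<in>H10 \<Omega>. F (\<lambda>x. c * u x) = c * F u) \<and>
     (\<exists>C. \<forall>u\<in>H10 \<Omega>. \<bar>F u\<bar> \<le> C * H1_norm \<Omega> u)}"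

definition H10_dual_norm :: "(real ^ 'n) set \<Rightarrow> ('n::finite scalar_field \<Rightarrow> real) \<Rightarrow> real" where
  "H10_dual_norm \<Omega> F = (SUP u\<in>{u \<in> H10 \<Omega>. H1_norm \<Omega> u \<le> 1}. \<bar>F u\<bar>)"

text \<open>The product space \<open>[B]\<^sup>d\<close> with its Euclidean product norm, and the componentwise duality
  pairing.\<close>

definition tuples :: "'b set \<Rightarrow> ('n::finite \<Rightarrow> 'b) set" where
  "tuples B = {u. \<forall>i. u i \<in> B}"

definition tuple_norm :: "('b \<Rightarrow> real) \<Rightarrow> ('n::finite \<Rightarrow> 'b) \<Rightarrow> real" where
  "tuple_norm N u = sqrt (\<Sum>i\<in>UNIV. (N (u i))\<^sup>2)"

definition tuple_pairing :: "('n::finite \<Rightarrow> 'b \<Rightarrow> real) \<Rightarrow> ('n \<Rightarrow> 'b) \<Rightarrow> real" where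
  "tuple_pairing F Q = (\<Sum>i\<in>UNIV. F i (Q i))"

text \<open>The embedding \<open>[H\<^sup>1\<^sub>0(\<Omega>)]\<^sup>d \<subseteq> [L\<^sup>2(\<Omega>)]\<^sup>d \<subseteq> [H\<^sup>1\<^sub>0(\<Omega>)']\<^sup>d\<close> of the Gelfand triple.\<close>

definition embed_dual ::
  "(real ^ 'n) set \<Rightarrow> ('n::finite \<Rightarrow> 'n scalar_field) \<Rightarrow> 'n \<Rightarrow> 'n scalar_field \<Rightarrow> real" where
  "embed_dual \<Omega> u = (\<lambda>i w. L2_inner \<Omega> (u i) w)"

section \<open>Domain, surface measure and traces\<close>

text \<open>Locally, after a rotation, \<open>\<Omega>\<close> is the region above the graph of a Lipschitz function \<open>f\<close>
  defined on the hyperplane orthogonal to the unit vector \<open>\<nu>\<close>.\<close>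

definition lipschitz_boundary :: "(real ^ 'n::finite) set \<Rightarrow> bool" where
  "lipschitz_boundary \<Omega> \<longleftrightarrow>
     (\<forall>x\<in>frontier \<Omega>. \<exists>r>0. \<exists>\<nu> L f. norm \<nu> = 1 \<and> L-lipschitz_on {z. z \<bullet> \<nu> = 0} f \<and>
        \<Omega> \<inter> ball x r = {y \<in> ball x r. f (y - (y \<bullet> \<nu>) *\<^sub>R \<nu>) < y \<bullet> \<nu>})"

definition bounded_lipschitz_domain :: "(real ^ 'n::finite) set \<Rightarrow> bool" where
  "bounded_lipschitz_domain \<Omega> \<longleftrightarrow>
     open \<Omega> \<and> connected \<Omega> \<and> \<Omega> \<noteq> {} \<and> bounded \<Omega> \<and> lipschitz_boundary \<Omega>"

text \<open>The \<open>s\<close>-dimensional Hausdorff measure, normalized to agree with Lebesgue measure. The empty set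
  is treated separately because \<open>0 ^ 0 = 1\<close>; boundedness of the covering sets is required because
  \<open>diameter\<close> is unspecified on unbounded sets.\<close>

definition hausdorff_pre :: "nat \<Rightarrow> real \<Rightarrow> 'a::euclidean_space set \<Rightarrow> ennreal" where
  "hausdorff_pre s \<delta> A =
     (INF C\<in>{C :: nat \<Rightarrow> 'a set. (\<forall>j. bounded (C j) \<and> diameter (C j) \<le> \<delta>) \<and> A \<subseteq> (\<Union>j. C j)}.
        \<Sum>j. if C j = {} then 0 else ennreal (unit_ball_vol (real s) * (diameter (C j) / 2) ^ s))"

definition hausdorff_outer :: "nat \<Rightarrow> 'a::euclidean_space set \<Rightarrow> ennreal" where
  "hausdorff_outer s A = (SUP \<delta>\<in>{0<..}. hausdorff_pre s \<delta> A)"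

definition hausdorff_measure :: "nat \<Rightarrow> 'a::euclidean_space measure" where
  "hausdorff_measure s = measure_of UNIV (sets borel) (hausdorff_outer s)"

definition surface_measure :: "(real ^ 'n::finite) set \<Rightarrow> (real ^ 'n) measure" where
  "surface_measure \<Omega> =
     completion (restrict_space (hausdorff_measure (CARD('n) - 1)) (frontier \<Omega>))"

text \<open>The trace is the continuous extension of the restriction map from smooth functions up to the
  boundary, from the \<open>H\<^sup>1(\<Omega>)\<close> norm to the \<open>L\<^sup>2(\<partial>\<Omega>)\<close> norm.\<close>

definition has_trace ::
  "(real ^ 'n) set \<Rightarrow> 'n::finite scalar_field \<Rightarrow> 'n scalar_field \<Rightarrow> bool" where
  "has_trace \<Omega> u \<tau> \<longleftrightarrow>
     \<tau> \<in> borel_measurable (surface_measure \<Omega>) \<and>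
     integrable (surface_measure \<Omega>) (\<lambda>x. (\<tau> x)\<^sup>2) \<and>
     (\<exists>\<phi> :: nat \<Rightarrow> 'n scalar_field. (\<forall>k. smooth (\<phi> k)) \<and>
        (\<lambda>k. H1_norm \<Omega> (\<phi> k - u)) \<longlonglongrightarrow> 0 \<and>
        (\<lambda>k. \<integral>\<^sup>+x. ennreal ((\<phi> k x - \<tau> x)\<^sup>2) \<partial>surface_measure \<Omega>) \<longlonglongrightarrow> 0)"

definition V_D :: "(real ^ 'n) set \<Rightarrow> (real ^ 'n) set \<Rightarrow> 'n::finite scalar_field set" where
  "V_D \<Omega> \<Gamma> =
     {w \<in> H1 \<Omega>. \<exists>\<tau>. has_trace \<Omega> w \<tau> \<and> (AE x in surface_measure \<Omega>. x \<in> \<Gamma> \<longrightarrow> \<tau> x = 0)}"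

section \<open>The electrostatic potential\<close>

definition solves_poisson ::
  "(real ^ 'n) set \<Rightarrow> (real ^ 'n) set \<Rightarrow> real \<Rightarrow> 'n::finite scalar_field \<Rightarrow> 'n scalar_field \<Rightarrow> bool" where
  "solves_poisson \<Omega> \<Gamma> \<epsilon> h v \<longleftrightarrow>
     v \<in> V_D \<Omega> \<Gamma> \<and> (\<forall>w\<in>V_D \<Omega> \<Gamma>. \<epsilon> * grad_inner \<Omega> v w = L2_inner \<Omega> h w)"

definition solution_operator ::
  "(real ^ 'n) set \<Rightarrow> (real ^ 'n) set \<Rightarrow> real \<Rightarrow> ('n::finite scalar_field \<Rightarrow> 'n scalar_field) \<Rightarrow> bool"
where
  "solution_operator \<Omega> \<Gamma> \<epsilon> \<Phi> \<longleftrightarrow>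
     (\<forall>h\<in>L2 \<Omega>. solves_poisson \<Omega> \<Gamma> \<epsilon> h (\<Phi> h) \<and>
        (\<forall>v. solves_poisson \<Omega> \<Gamma> \<epsilon> h v \<longrightarrow> (AE x in lebesgue_on \<Omega>. v x = \<Phi> h x)))"

definition H2_regular ::
  "(real ^ 'n) set \<Rightarrow> ('n::finite scalar_field \<Rightarrow> 'n scalar_field) \<Rightarrow> bool" where
  "H2_regular \<Omega> \<Phi> \<longleftrightarrow> (\<exists>C. \<forall>h\<in>L2 \<Omega>. \<Phi> h \<in> H2 \<Omega> \<and> H2_norm \<Omega> (\<Phi> h) \<le> C * L2_norm \<Omega> h)"

definition weak_div :: "(real ^ 'n) set \<Rightarrow> ('n::finite \<Rightarrow> 'n scalar_field) \<Rightarrow> 'n scalar_field" where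
  "weak_div \<Omega> P = (\<lambda>x. \<Sum>i\<in>UNIV. weak_partial \<Omega> i (P i) x)"

section \<open>Bochner spaces\<close>

text \<open>A Banach space is given by a carrier \<open>B\<close> of representatives and its norm \<open>N\<close>. Square
  integrability is in the sense of Bochner: almost everywhere limit of simple \<open>B\<close>-valued functions,
  with finite integral of the squared norm.\<close>

definition L2_time :: "real \<Rightarrow> 'b::minus set \<Rightarrow> ('b \<Rightarrow> real) \<Rightarrow> (real \<Rightarrow> 'b) set" where
  "L2_time T B N = {u.
     (\<exists>s :: nat \<Rightarrow> real \<Rightarrow> 'b.
        (\<forall>n. simple_function (lebesgue_on {0<..<T}) (s n) \<and> (\<forall>t\<in>{0<..<T}. s n t \<in> B)) \<and>
        (AE t in lebesgue_on {0<..<T}. u t \<in> B \<and> (\<lambda>n. N (s n t - u t)) \<longlonglongrightarrow> 0)) \<and>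
     (\<integral>\<^sup>+t. ennreal ((N (u t))\<^sup>2) \<partial>lebesgue_on {0<..<T}) < \<infinity>}"

text \<open>\<open>v = \<partial>\<^sub>t u\<close> in the sense of \<open>B\<close>-valued distributions on \<open>(0,T)\<close>. The identity between the Bochner
  integrals of \<open>\<psi>' u\<close> and \<open>- \<psi> v\<close> in \<open>B\<close> is expressed by applying the functionals \<open>\<kappa> \<in> \<Lambda>\<close>, where
  \<open>\<Lambda>\<close> is the dual of \<open>B\<close>; bounded functionals commute with the Bochner integral.\<close>

definition has_time_derivative ::
  "real \<Rightarrow> 'b::minus set \<Rightarrow> ('b \<Rightarrow> real) \<Rightarrow> ('b \<Rightarrow> real) set \<Rightarrow> (real \<Rightarrow> 'b) \<Rightarrow> (real \<Rightarrow> 'b) \<Rightarrow> bool" where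
  "has_time_derivative T B N \<Lambda> u v \<longleftrightarrow>
     u \<in> L2_time T B N \<and> v \<in> L2_time T B N \<and>
     (\<forall>\<psi>\<in>test_functions {0<..<T}. \<forall>\<kappa>\<in>\<Lambda>.
        (LINT t|lebesgue_on {0<..<T}. deriv \<psi> t * \<kappa> (u t)) =
        - (LINT t|lebesgue_on {0<..<T}. \<psi> t * \<kappa> (v t)))"

definition H1_time ::
  "real \<Rightarrow> 'b::minus set \<Rightarrow> ('b \<Rightarrow> real) \<Rightarrow> ('b \<Rightarrow> real) set \<Rightarrow> (real \<Rightarrow> 'b) set" where
  "H1_time T B N \<Lambda> = {u. \<exists>v. has_time_derivative T B N \<Lambda> u v}"

text \<open>The dual of \<open>L\<^sup>2(\<Omega>)\<close> by the Riesz theorem.\<close>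

definition L2_functionals :: "(real ^ 'n) set \<Rightarrow> ('n::finite scalar_field \<Rightarrow> real) set" where
  "L2_functionals \<Omega> = {\<lambda>u. L2_inner \<Omega> u w | w. w \<in> L2 \<Omega>}"

text \<open>The dual of \<open>[H\<^sup>1\<^sub>0(\<Omega>)']\<^sup>d\<close> by reflexivity.\<close>

definition H10_dual_functionals ::
  "(real ^ 'n) set \<Rightarrow> (('n::finite \<Rightarrow> 'n scalar_field \<Rightarrow> real) \<Rightarrow> real) set" where
  "H10_dual_functionals \<Omega> = {\<lambda>F. tuple_pairing F Q | Q. Q \<in> tuples (H10 \<Omega>)}"

text \<open>The value at time 0 is that of the continuous representative \<open>R\<close> of \<open>P\<close> in
  \<open>C([0,T];[L\<^sup>2(\<Omega>)]\<^sup>d)\<close>.\<close>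

definition has_initial_value ::
  "real \<Rightarrow> (real ^ 'n) set \<Rightarrow> (real \<Rightarrow> 'n::finite \<Rightarrow> 'n scalar_field) \<Rightarrow> ('n \<Rightarrow> 'n scalar_field) \<Rightarrow> bool"
where
  "has_initial_value T \<Omega> P P0 \<longleftrightarrow>
     (\<exists>R. (\<forall>t\<in>{0..T}. R t \<in> tuples (L2 \<Omega>)) \<and>
          (\<forall>t\<in>{0..T}. ((\<lambda>s. tuple_norm (L2_norm \<Omega>) (R s - R t)) \<longlongrightarrow> 0) (at t within {0..T})) \<and>
          (AE t in lebesgue_on {0<..<T}. \<forall>i. AE x in lebesgue_on \<Omega>. R t i x = P t i x) \<and>
          (\<forall>i. AE x in lebesgue_on \<Omega>. R 0 i x = P0 i x))"

section \<open>The weak gradient flow\<close>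

definition DF ::
  "real \<Rightarrow> real \<Rightarrow> real \<Rightarrow> ('n::finite \<Rightarrow> 'n scalar_field) \<Rightarrow> 'n \<Rightarrow> 'n scalar_field" where
  "DF \<alpha> \<beta> \<gamma> P = (\<lambda>i x. (2 * \<alpha> + 4 * \<beta> * (P i x)\<^sup>2 + 6 * \<gamma> * (P i x) ^ 4) * P i x)"

text \<open>The pairing of \<open>DF (P t)\<close> with \<open>Q\<close> is a plain integral: for \<open>d \<le> 3\<close> its integrand is integrable
  by the embedding of \<open>H\<^sup>1\<^sub>0(\<Omega>)\<close> into \<open>L\<^sup>6(\<Omega>)\<close>.\<close>

definition weak_gradient_flow ::
  "(real ^ 'n) set \<Rightarrow> ('n::finite scalar_field \<Rightarrow> 'n scalar_field) \<Rightarrow> real \<Rightarrow>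
   real \<Rightarrow> real \<Rightarrow> real \<Rightarrow> real \<Rightarrow> real \<Rightarrow>
   (real \<Rightarrow> 'n scalar_field) \<Rightarrow> ('n \<Rightarrow> 'n scalar_field) \<Rightarrow> (real \<Rightarrow> 'n \<Rightarrow> 'n scalar_field) \<Rightarrow> bool" where
  "weak_gradient_flow \<Omega> \<Phi> T \<rho>\<^sub>v \<alpha> \<beta> \<gamma> g \<rho> P0 P \<longleftrightarrow>
     P \<in> L2_time T (tuples (H10 \<Omega>)) (tuple_norm (H1_norm \<Omega>)) \<and>
     has_initial_value T \<Omega> P P0 \<and>
     (\<exists>P'. has_time_derivative T (tuples (H10_dual \<Omega>)) (tuple_norm (H10_dual_norm \<Omega>))
             (H10_dual_functionals \<Omega>) (\<lambda>t. embed_dual \<Omega> (P t)) P' \<and>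
        (AE t in lebesgue_on {0<..<T}. \<forall>Q\<in>tuples (H10 \<Omega>).
           let V = \<Phi> (\<lambda>x. \<rho> t x - weak_div \<Omega> (P t) x) in
           \<rho>\<^sub>v * tuple_pairing (P' t) Q
           + g * (\<Sum>i\<in>UNIV. grad_inner \<Omega> (P t i) (Q i))
           + (\<Sum>i\<in>UNIV. L2_inner \<Omega> (DF \<alpha> \<beta> \<gamma> (P t) i) (Q i))
           + (\<Sum>i\<in>UNIV. L2_inner \<Omega> (weak_partial \<Omega> i V) (Q i)) = 0))"

end

theory Submission
  imports Defs
begin

text \<open>
  The difference \<open>W = P - Q\<close> of two solutions is tested with itself. Since the quintic nonlinearity is
  one-sided Lipschitz, its contribution is bounded below by \<open>- K |W|\<^sup>2\<close>; for this the pairings with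
  \<open>DF\<close> must be genuinely integrable, which is the Sobolev embedding of \<open>H10\<close> into \<open>L6\<close> in dimension at
  most three. The potential term is at most \<open>C |grad W| |W|\<close> because \<open>\<Phi>\<close> is linear and bounded, and it is
  absorbed by the Dirichlet term. Hence \<open>\<langle>W', W\<rangle> \<le> C |W|\<^sup>2\<close> for almost every time.

  To turn this into \<open>E(t) \<le> 2 C \<integral> E\<close> for \<open>E = |W|\<^sup>2\<close>, so that Gronwall's lemma gives \<open>E = 0\<close>, no
  mollification in time is needed: \<open>E(t) - E(s) \<le> 2 (W(t) - W(s), W(t)) = 2 \<integral> \<langle>W'(\<sigma>), W(t)\<rangle> d\<sigma>\<close>, and
  \<open>W(t)\<close> may be replaced by \<open>W(\<sigma>)\<close> after summation over a fine partition, because \<open>W\<close> is close in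
  \<open>L\<^sup>2(0,T;H10)\<close> to a function that is continuous in time.
\<close>

section \<open>Smooth functions, bump functions and the fundamental lemma\<close>

text \<open>The obstacle is that W is known to be continuous in time only with values in
  \<open>L2\<close>, while its time derivative pairs only with elements of \<open>H10\<close>, to
  which W(t) belongs for almost every t. The increment formula is therefore available only when its
  right end point is a good time, and exchanging W(t) for W(\<sigma>) costs |W'(\<sigma>)| times an
  \<open>H10\<close> distance. That distance is at most r(t) + \<eta> + r(\<sigma>), where r is the
  error of the approximation: small in the mean square over time, but possibly large at a given t.
  Choosing the offset of the partition by averaging makes the values of r at the partition points
  harmless.

  The Sobolev inequality is proved for test functions by the Gagliardo-Nirenberg scheme (line
  integrals of powers, then a Loomis-Whitney product bound) and carried to \<open>H10\<close> by
  Fatou's lemma. Its role is tied to a default value: a Lebesgue integral that does not exist is 0,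
  and then the difference of two such pairings would not be the integral of the difference.\<close>

lemma partialI: "(f has_derivative D) (at x) \<Longrightarrow> partial e f x = D e"
  unfolding partial_def by (metis frechet_derivative_at)

lemma partial_works:
  "f differentiable (at x) \<Longrightarrow> (f has_derivative (\<lambda>e. partial e f x)) (at x)"
  unfolding partial_def by (simp add: frechet_derivative_works)

lemma Ck_Suc_imp: "Ck (Suc k) f \<Longrightarrow> Ck k f"
proof (induction k arbitrary: f)
  case 0
  then show ?case
    by (simp add: continuous_at_imp_continuous_on differentiable_imp_continuous_within)
next
  case (Suc k)
  then show ?case by (metis Ck.simps(2))
qed

lemma Ck_const: "Ck k (\<lambda>x. c)"
proof (induction k arbitrary: c)
  case (Suc k)
  have "partial b (\<lambda>x. c) = (\<lambda>x. 0)" for b :: 'a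
    by (rule ext, rule partialI) simp
  with Suc show ?case by simp
qed simp

lemma partial_add:
  assumes "f differentiable (at x)" "g differentiable (at x)"
  shows "partial b (\<lambda>x. f x + g x) x = partial b f x + partial b g x"
  by (rule partialI, rule has_derivative_add) (use assms in \<open>simp_all add: partial_works\<close>)

lemma partial_mult:
  assumes "f differentiable (at x)" "g differentiable (at x)"
  shows "partial b (\<lambda>x. f x * g x) x = f x * partial b g x + partial b f x * g x"
  by (rule partialI, rule has_derivative_mult) (use assms in \<open>simp_all add: partial_works\<close>)

lemma Ck_add: "Ck k f \<Longrightarrow> Ck k g \<Longrightarrow> Ck k (\<lambda>x. f x + g x)"
proof (induction k arbitrary: f g)
  case 0
  then show ?case by (simp add: continuous_on_add)
next
  case (Suc k)
  then have "partial b (\<lambda>x. f x + g x) = (\<lambda>x. partial b f x + partial b g x)" for b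
    by (simp add: partial_add fun_eq_iff)
  with Suc show ?case by simp
qed

lemma Ck_mult: "Ck k f \<Longrightarrow> Ck k g \<Longrightarrow> Ck k (\<lambda>x. f x * g x)"
proof (induction k arbitrary: f g)
  case 0
  then show ?case by (simp add: continuous_on_mult)
next
  case (Suc k)
  then have "partial b (\<lambda>x. f x * g x) = (\<lambda>x. f x * partial b g x + partial b f x * g x)" for b
    by (simp add: partial_mult fun_eq_iff)
  moreover have "Ck k f" "Ck k g"
    using Suc.prems Ck_Suc_imp by blast+
  ultimately show ?case
    using Suc by (auto intro!: Ck_add differentiable_mult)
qed

lemma Ck_prod: "finite A \<Longrightarrow> (\<And>i. i \<in> A \<Longrightarrow> Ck k (f i)) \<Longrightarrow> Ck k (\<lambda>x. \<Prod>i\<in>A. f i x)"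
  by (induction A rule: finite_induct) (auto intro!: Ck_const Ck_mult)

text \<open>The only compositions that occur are one-variable profiles along a direction
  \<open>b\<close>: reflected and translated for the bump functions, translated for the smooth step
  in time. The induction closes because each directional derivative is a constant times the same
  composition with \<open>partial 1 h\<close>.\<close>

lemma Ck_compose_affine:
  fixes h :: "real \<Rightarrow> real"
  shows "Ck k h \<Longrightarrow> Ck k (\<lambda>x. h (s * (x \<bullet> b) + c))"
proof (induction k arbitrary: h)
  case 0
  then show ?case
    by (auto intro!: continuous_intros elim: continuous_on_compose2)
next
  case (Suc k)
  have D: "((\<lambda>x. h (s * (x \<bullet> b) + c)) has_derivative (\<lambda>e. s * (e \<bullet> b) * partial 1 h (s * (x \<bullet> b) + c))) (at x)"
    for x
  proof -
    let ?y = "s * (x \<bullet> b) + c"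
    have "(h has_derivative (\<lambda>e. partial e h ?y)) (at ?y)"
      using Suc.prems by (simp add: partial_works)
    moreover have "((\<lambda>x. s * (x \<bullet> b) + c) has_derivative (\<lambda>e. s * (e \<bullet> b))) (at x)"
      by (auto intro!: derivative_eq_intros)
    ultimately have "((\<lambda>x. h (s * (x \<bullet> b) + c)) has_derivative (\<lambda>e. partial (s * (e \<bullet> b)) h ?y)) (at x)"
      by (rule has_derivative_compose[rotated])
    \<comment> \<open>In one dimension the derivative in direction
      \<open>s * (e \<bullet> b)\<close> is that multiple of the derivative in direction 1, because
      a Frechet derivative is linear in the direction.\<close>
    moreover have "partial (s * (e \<bullet> b)) h ?y = s * (e \<bullet> b) * partial 1 h ?y" for e
    proof -
      have "linear (\<lambda>e. partial e h ?y)"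
        using \<open>(h has_derivative (\<lambda>e. partial e h ?y)) (at ?y)\<close> has_derivative_linear by blast
      from linear_scale[OF this, of "s * (e \<bullet> b)" 1] show ?thesis by simp
    qed
    ultimately show ?thesis by simp
  qed
  have "partial e (\<lambda>x. h (s * (x \<bullet> b) + c)) = (\<lambda>x. s * (e \<bullet> b) * partial 1 h (s * (x \<bullet> b) + c))" for e
    using partialI[OF D] by blast
  moreover have "Ck k (\<lambda>x. partial 1 h (s * (x \<bullet> b) + c))"
    using Suc.IH[of "partial 1 h"] Suc.prems by simp
  ultimately show ?case
    using D by (auto intro!: Ck_mult Ck_const simp: differentiable_def)
qed

text \<open>Connects the two notations for the derivative of a test function of time: smoothness
  speaks of \<open>partial 1\<close>, the weak time derivative of \<open>deriv\<close>.\<close>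

lemma partial_one_eq_deriv:
  fixes h :: "real \<Rightarrow> real"
  assumes "h differentiable (at x)"
  shows "partial 1 h x = deriv h x"
  using assms by (metis DERIV_deriv_iff_real_differentiable has_field_derivative_def mult.right_neutral partialI)

section \<open>Smooth bump functions supported in boxes\<close>

text \<open>For \<open>c > 0\<close> this family of functions is closed under differentiation.\<close>

definition flat :: "real \<Rightarrow> real poly \<Rightarrow> real \<Rightarrow> real" where
  "flat c p t = (if t > 0 then poly p (1 / t) * exp (- (c / t)) else 0)"

lemma tendsto_poly_mult_exp_neg:
  assumes "c > 0"
  shows "((\<lambda>x::real. poly p x * exp (- (c * x))) \<longlongrightarrow> 0) at_top"
proof -
  have 1: "((\<lambda>x::real. x ^ k * exp (- (c * x))) \<longlongrightarrow> 0) at_top" for k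
  proof -
    have "filterlim (\<lambda>x. c * x) at_top at_top"
      using assms by (simp add: filterlim_tendsto_pos_mult_at_top[OF tendsto_const] filterlim_ident)
    from filterlim_compose[OF tendsto_power_div_exp_0[of k] this]
    have "((\<lambda>x. (1 / c ^ k) * ((c * x) ^ k / exp (c * x))) \<longlongrightarrow> (1 / c ^ k) * 0) at_top"
      by (intro tendsto_intros)
    then show ?thesis
      using assms by (simp add: power_mult_distrib exp_minus field_simps)
  qed
  have "((\<lambda>x. \<Sum>i\<le>degree p. coeff p i * (x ^ i * exp (- (c * x)))) \<longlongrightarrow> (\<Sum>i\<le>degree p. coeff p i * 0)) at_top"
    by (intro tendsto_intros 1)
  then show ?thesis
    by (simp add: poly_altdef sum_distrib_right mult.assoc)
qed

text \<open>On the right of 0 the substitution x = 1/t reduces this to the decay of a polynomial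
  times an exponential at infinity.\<close>

lemma flat_tendsto_0:
  assumes "c > 0"
  shows "(flat c p \<longlongrightarrow> 0) (at 0)"
proof -
  have "((\<lambda>t. poly p (inverse t) * exp (- (c * inverse t))) \<longlongrightarrow> 0) (at_right (0::real))"
    by (rule filterlim_compose[OF tendsto_poly_mult_exp_neg[OF assms] filterlim_inverse_at_top_right])
  then have "(flat c p \<longlongrightarrow> 0) (at_right 0)"
    by (rule Lim_transform_eventually) (auto simp: flat_def eventually_at_filter divide_inverse)
  moreover have "((\<lambda>t. 0) \<longlongrightarrow> 0) (at_left (0::real))" by simp
  then have "(flat c p \<longlongrightarrow> 0) (at_left 0)"
    by (rule Lim_transform_eventually) (auto simp: flat_def eventually_at_filter)
  ultimately show ?thesis by (simp add: filterlim_split_at)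
qed

text \<open>With x = 1/t the derivative of p(x) exp(-c x) with respect to t is x^2 (c p(x) - p'(x))
  exp(-c x), which explains the factor \<open>[:0, 0, 1:]\<close>. The only delicate point is t =
  0.\<close>

lemma flat_has_real_derivative:
  assumes "c > 0"
  shows "(flat c p has_real_derivative flat c ([:0, 0, 1:] * (smult c p - pderiv p)) t) (at t)"
proof (cases t "0::real" rule: linorder_cases)
  case less
  have "((\<lambda>t. 0) has_real_derivative 0) (at t)" by simp
  moreover have "\<forall>\<^sub>F x in nhds t. flat c p x = 0"
    using less by (auto simp: flat_def eventually_nhds intro!: exI[of _ "{..<0}"])
  ultimately show ?thesis
    using less by (simp add: DERIV_cong_ev[OF refl _ refl] flat_def)
next
  case equal
  \<comment> \<open>Dividing by h multiplies the polynomial in 1/h by its variable, so the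
    difference quotient at 0 is again in the family and tends to 0.\<close>
  have "((\<lambda>h. flat c p h / h) \<longlongrightarrow> 0) (at 0)"
    by (rule Lim_transform_eventually[OF flat_tendsto_0[OF assms, of "[:0, 1:] * p"]])
       (auto simp: flat_def eventually_at_filter)
  with equal show ?thesis by (simp add: DERIV_def flat_def)
next
  case greater
  have "((\<lambda>t. poly p (1 / t) * exp (- (c / t))) has_real_derivative
     poly ([:0, 0, 1:] * (smult c p - pderiv p)) (1 / t) * exp (- (c / t))) (at t)"
    using greater
    by (auto intro!: derivative_eq_intros DERIV_chain'[OF _ poly_DERIV] simp: field_simps power2_eq_square)
  moreover have "\<forall>\<^sub>F x in nhds t. flat c p x = poly p (1 / x) * exp (- (c / x))"
    using greater by (auto simp: flat_def eventually_nhds intro!: exI[of _ "{0<..}"])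
  ultimately show ?thesis
    using greater by (simp add: DERIV_cong_ev[OF refl _ refl] flat_def)
qed

lemma Ck_flat: "c > 0 \<Longrightarrow> Ck k (flat c p)"
proof (induction k arbitrary: p)
  case 0
  then show ?case
    using flat_has_real_derivative DERIV_isCont by (force simp: continuous_on_eq_continuous_at)
next
  case (Suc k)
  have "(flat c p has_derivative (\<lambda>e. flat c ([:0, 0, 1:] * (smult c p - pderiv p)) x * e)) (at x)" for x
    using flat_has_real_derivative[OF Suc.prems] by (simp add: has_field_derivative_def)
  then have "partial 1 (flat c p) = flat c ([:0, 0, 1:] * (smult c p - pderiv p))"
    and "flat c p differentiable (at x)" for x
    by (auto simp: differentiable_def intro!: ext partialI[THEN trans])
  with Suc show ?case by simp
qed

text \<open>The parameter \<open>c\<close> stays free: for fixed corners the bumps converge to the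
  indicator of the open box as \<open>c\<close> tends to 0, which turns information on test
  functions into information on integrals over boxes.\<close>

definition box_bump :: "real \<Rightarrow> 'a::euclidean_space \<Rightarrow> 'a \<Rightarrow> 'a \<Rightarrow> real" where
  "box_bump c a b x = (\<Prod>i\<in>Basis. flat c 1 (x \<bullet> i - a \<bullet> i) * flat c 1 (b \<bullet> i - x \<bullet> i))"

lemma smooth_box_bump:
  assumes "c > 0"
  shows "smooth (box_bump c a b)"
proof -
  have "Ck k (\<lambda>x. flat c 1 (1 * (x \<bullet> i) + (- (a \<bullet> i))) * flat c 1 ((-1) * (x \<bullet> i) + b \<bullet> i))" for i k
    by (intro Ck_mult Ck_compose_affine Ck_flat assms)
  then have "Ck k (\<lambda>x. \<Prod>i\<in>Basis. flat c 1 (1 * (x \<bullet> i) + (- (a \<bullet> i))) * flat c 1 ((-1) * (x \<bullet> i) + b \<bullet> i))" for k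
    by (intro Ck_prod) auto
  then show ?thesis
    unfolding smooth_def box_bump_def by (simp add: algebra_simps)
qed

lemma flat_one_bounds: "c > 0 \<Longrightarrow> 0 \<le> flat c 1 t \<and> flat c 1 t \<le> 1 \<and> (flat c 1 t = 0 \<longleftrightarrow> t \<le> 0)"
  by (auto simp: flat_def)

lemma box_bump_nonneg: "c > 0 \<Longrightarrow> 0 \<le> box_bump c a b x"
  unfolding box_bump_def by (intro prod_nonneg mult_nonneg_nonneg) (auto simp: flat_one_bounds)

lemma box_bump_le_one: "c > 0 \<Longrightarrow> box_bump c a b x \<le> 1"
  unfolding box_bump_def by (intro prod_le_1) (auto simp: flat_one_bounds mult_le_one)

lemma box_bump_eq_0_iff: "c > 0 \<Longrightarrow> box_bump c a b x = 0 \<longleftrightarrow> x \<notin> box a b"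
  unfolding box_bump_def by (auto simp: flat_one_bounds mem_box not_less)

lemma box_bump_test_function:
  assumes "c > 0" "cbox a b \<subseteq> U"
  shows "box_bump c a b \<in> test_functions U"
proof -
  have eq: "{x. box_bump c a b x \<noteq> 0} = box a b"
    using box_bump_eq_0_iff[OF assms(1)] by auto
  have "closure (box a b) \<subseteq> cbox a b"
    by (meson box_subset_cbox closed_cbox closure_minimal)
  with assms show ?thesis
    unfolding test_functions_def mem_Collect_eq eq
    by (auto simp: smooth_box_bump intro: compact_closure[THEN iffD2])
qed

lemma box_bump_tendsto:
  "(\<lambda>m. box_bump (1 / real (Suc m)) a b x) \<longlonglongrightarrow> indicator (box a b) x"
proof (cases "x \<in> box a b")
  case True
  have *: "(\<lambda>m. flat (1 / real (Suc m)) 1 t) \<longlonglongrightarrow> 1" if "t > 0" for t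
  proof -
    have "(\<lambda>m. exp (- ((1 / real (Suc m)) / t))) \<longlonglongrightarrow> exp (- (0 / t))"
      using that by (intro tendsto_intros LIMSEQ_Suc[OF lim_1_over_n]) auto
    with that show ?thesis by (simp add: flat_def)
  qed
  have "(\<lambda>m. box_bump (1 / real (Suc m)) a b x) \<longlonglongrightarrow> (\<Prod>i\<in>(Basis::'a set). 1 * 1)"
    unfolding box_bump_def
    by (intro tendsto_prod tendsto_mult *) (use True in \<open>auto simp: mem_box\<close>)
  with True show ?thesis by simp
next
  case False
  then have "box_bump (1 / real (Suc m)) a b x = 0" for m
    by (subst box_bump_eq_0_iff) auto
  with False show ?thesis by simp
qed

lemma smooth_continuous: "smooth f \<Longrightarrow> continuous_on UNIV f"
  unfolding smooth_def by (metis Ck.simps(1))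

lemma smooth_differentiable: "smooth f \<Longrightarrow> f differentiable (at x)"
  unfolding smooth_def by (metis Ck.simps(2))

lemma smooth_partial: "smooth f \<Longrightarrow> b \<in> Basis \<Longrightarrow> smooth (partial b f)"
  unfolding smooth_def by (metis Ck.simps(2))

lemma smooth_add: "smooth f \<Longrightarrow> smooth g \<Longrightarrow> smooth (\<lambda>x. f x + g x)"
  by (simp add: smooth_def Ck_add)

lemma smooth_mult: "smooth f \<Longrightarrow> smooth g \<Longrightarrow> smooth (\<lambda>x. f x * g x)"
  by (simp add: smooth_def Ck_mult)

lemma smooth_const: "smooth (\<lambda>x. c)"
  by (simp add: smooth_def Ck_const)

lemma test_functionI:
  assumes "smooth \<phi>" "compact K" "K \<subseteq> U" "\<And>x. x \<notin> K \<Longrightarrow> \<phi> x = 0"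
  shows "\<phi> \<in> test_functions U"
proof -
  have "closure {x. \<phi> x \<noteq> 0} \<subseteq> K"
    using assms by (intro closure_minimal compact_imp_closed) auto
  with assms show ?thesis
    unfolding test_functions_def
    by (auto simp: compact_closure intro: bounded_subset[OF compact_imp_bounded] closure_subset)
qed

lemma test_functionE:
  assumes "\<phi> \<in> test_functions U"
  obtains K where "smooth \<phi>" "compact K" "K \<subseteq> U" "\<And>x. x \<notin> K \<Longrightarrow> \<phi> x = 0"
proof
  show "smooth \<phi>" "compact (closure {x. \<phi> x \<noteq> 0})" "closure {x. \<phi> x \<noteq> 0} \<subseteq> U"
    using assms by (auto simp: test_functions_def)
  show "\<phi> x = 0" if "x \<notin> closure {x. \<phi> x \<noteq> 0}" for x
    using that closure_subset[of "{x. \<phi> x \<noteq> 0}"] by blast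
qed

lemma test_function_partial:
  assumes "\<phi> \<in> test_functions U" "b \<in> Basis"
  shows "partial b \<phi> \<in> test_functions U"
proof -
  obtain K where K: "smooth \<phi>" "compact K" "K \<subseteq> U" "\<And>x. x \<notin> K \<Longrightarrow> \<phi> x = 0"
    using assms test_functionE by blast
  have "partial b \<phi> x = 0" if "x \<notin> K" for x
  proof -
    have "\<forall>\<^sub>F y in nhds x. y \<in> - K"
      using that K(2) by (metis compact_imp_closed eventually_nhds open_Compl ComplI)
    then have "\<forall>\<^sub>F y in at x. 0 = \<phi> y"
      by (simp add: eventually_at_filter eventually_mono K)
    moreover have "((\<lambda>x. 0) has_derivative (\<lambda>x. 0)) (at x)" by simp
    ultimately have "(\<phi> has_derivative (\<lambda>x. 0)) (at x)"
      using has_derivative_transform_eventually[of "\<lambda>x. 0" "\<lambda>x. 0" x UNIV \<phi>] that K by simp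
    then show ?thesis by (rule partialI)
  qed
  with K assms(2) show ?thesis by (auto intro!: test_functionI smooth_partial)
qed

lemma test_function_lincomb:
  assumes "\<phi> \<in> test_functions U" "\<psi> \<in> test_functions U"
  shows "(\<lambda>x. c * \<phi> x + d * \<psi> x) \<in> test_functions U"
proof -
  obtain K where K: "smooth \<phi>" "compact K" "K \<subseteq> U" "\<And>x. x \<notin> K \<Longrightarrow> \<phi> x = 0"
    using assms test_functionE by blast
  obtain L where L: "smooth \<psi>" "compact L" "L \<subseteq> U" "\<And>x. x \<notin> L \<Longrightarrow> \<psi> x = 0"
    using assms test_functionE by blast
  show ?thesis
    by (rule test_functionI[of _ "K \<union> L"]) (use K L in \<open>auto intro!: smooth_add smooth_mult smooth_const\<close>)
qed

lemma test_function_smooth_mult: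
  assumes "\<phi> \<in> test_functions U" "smooth f"
  shows "(\<lambda>x. f x * \<phi> x) \<in> test_functions U"
proof -
  obtain K where K: "smooth \<phi>" "compact K" "K \<subseteq> U" "\<And>x. x \<notin> K \<Longrightarrow> \<phi> x = 0"
    using assms test_functionE by blast
  show ?thesis
    by (rule test_functionI[of _ "K"]) (use K assms in \<open>auto intro!: smooth_mult\<close>)
qed

section \<open>The fundamental lemma of the calculus of variations\<close>

text \<open>Dominated convergence along bumps with c = 1/(m+1): the limit is the integral over the
  open box, and the boundary of the box is a null set.\<close>

lemma integral_cbox_zero_if_test_integrals_zero:
  fixes v :: "'a::euclidean_space \<Rightarrow> real"
  assumes "open U" and "cbox a b \<subseteq> U" and int: "integrable (lebesgue_on (cbox a b)) v"
    and test: "\<And>\<phi>. \<phi> \<in> test_functions U \<Longrightarrow> (LINT x|lebesgue_on U. v x * \<phi> x) = 0"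
  shows "(LINT x|lebesgue_on (cbox a b). v x) = 0"
proof -
  let ?\<phi> = "\<lambda>m. box_bump (1 / real (Suc m)) a b"
  have U: "U \<in> sets lebesgue" using \<open>open U\<close> by auto
  have out: "?\<phi> m x = 0" if "x \<notin> cbox a b" for m x
    using that box_subset_cbox[of a b] by (subst box_bump_eq_0_iff) auto
  have zero: "(LINT x|lebesgue_on (cbox a b). v x * ?\<phi> m x) = 0" for m
  proof -
    have "(LINT x|lebesgue_on (cbox a b). v x * ?\<phi> m x) = (LINT x|lebesgue_on U. v x * ?\<phi> m x)"
      using U out assms(2)
      by (auto simp: integral_restrict_space indicator_def intro!: Bochner_Integration.integral_cong)
    also have "\<dots> = 0"
      by (rule test, rule box_bump_test_function) (use assms in auto)
    finally show ?thesis .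
  qed
  have bnd: "\<bar>?\<phi> m x\<bar> \<le> 1" for m x
    using box_bump_nonneg[of "1 / real (Suc m)" a b x] box_bump_le_one[of "1 / real (Suc m)" a b x] by auto
  have meas: "?\<phi> m \<in> borel_measurable (lebesgue_on (cbox a b))" for m
    by (intro continuous_imp_measurable_on_sets_lebesgue continuous_on_subset[OF smooth_continuous[OF smooth_box_bump]]) auto
  have "(\<lambda>m. LINT x|lebesgue_on (cbox a b). v x * ?\<phi> m x)
      \<longlonglongrightarrow> (LINT x|lebesgue_on (cbox a b). v x * indicator (box a b) x)"
  proof (rule integral_dominated_convergence[where w="\<lambda>x. \<bar>v x\<bar>"])
    show "(\<lambda>x. v x * indicator (box a b) x) \<in> borel_measurable (lebesgue_on (cbox a b))"
      by (intro borel_measurable_times borel_measurable_indicator borel_measurable_integrable[OF int])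
         (auto simp: sets_restrict_space intro!: image_eqI[of _ _ "box a b"] dest: subsetD[OF box_subset_cbox])
    show "(\<lambda>x. v x * ?\<phi> m x) \<in> borel_measurable (lebesgue_on (cbox a b))" for m
      by (intro borel_measurable_times meas borel_measurable_integrable[OF int])
    show "AE x in lebesgue_on (cbox a b). (\<lambda>m. v x * ?\<phi> m x) \<longlonglongrightarrow> v x * indicator (box a b) x"
      by (intro AE_I2 tendsto_intros box_bump_tendsto)
    show "AE x in lebesgue_on (cbox a b). norm (v x * ?\<phi> m x) \<le> \<bar>v x\<bar>" for m
      using bnd by (intro AE_I2) (simp add: abs_mult mult_left_le)
  qed (use int in simp)
  then have "(LINT x|lebesgue_on (cbox a b). v x * indicator (box a b) x) = 0"
    unfolding zero by (simp add: LIMSEQ_const_iff)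
  moreover have "(LINT x|lebesgue_on (cbox a b). v x * indicator (box a b) x) = (LINT x|lebesgue_on (cbox a b). v x)"
  proof (rule integral_cong_AE)
    have "AE x in lebesgue. x \<notin> cbox a b - box a b"
      using negligible_frontier_interval[of a b]
      by (intro AE_not_in) (simp add: negligible_iff_null_sets)
    then show "AE x in lebesgue_on (cbox a b). v x * indicator (box a b) x = v x"
      by (auto simp: AE_restrict_space_iff elim!: AE_mp)
    show "(\<lambda>x. v x * indicator (box a b) x) \<in> borel_measurable (lebesgue_on (cbox a b))"
      by (intro borel_measurable_times borel_measurable_indicator borel_measurable_integrable[OF int])
         (auto simp: sets_restrict_space intro!: image_eqI[of _ _ "box a b"] dest: subsetD[OF box_subset_cbox])
  qed (use int in auto)
  ultimately show ?thesis by simp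
qed

text \<open>Integrals over all closed boxes in U vanish, and the Lebesgue differentiation theorem
  for cubes with lower corner x recovers v(x) from them almost everywhere. An open set is a
  countable union of closed boxes, so the statement on one box suffices.\<close>

theorem AE_zero_if_test_integrals_zero:
  fixes v :: "'a::euclidean_space \<Rightarrow> real"
  assumes "open U" and int: "\<And>a b. cbox a b \<subseteq> U \<Longrightarrow> integrable (lebesgue_on (cbox a b)) v"
    and test: "\<And>\<phi>. \<phi> \<in> test_functions U \<Longrightarrow> (LINT x|lebesgue_on U. v x * \<phi> x) = 0"
  shows "AE x in lebesgue_on U. v x = 0"
proof -
  have box_case: "AE x in lebesgue. x \<in> cbox a b \<longrightarrow> v x = 0" if K: "cbox a b \<subseteq> U" for a b
  proof -
    \<comment> \<open>The differentiation theorem asks for integrability on every box, so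
      \<open>v\<close> is cut off outside the one under consideration.\<close>
    define f where "f = (\<lambda>x. if x \<in> cbox a b then v x else 0)"
    have intf: "f integrable_on cbox c d" for c d
    proof -
      have "f integrable_on UNIV"
        unfolding f_def using int[OF K]
        by (simp add: integrable_restrict_UNIV integrable_on_lebesgue_on)
      then show ?thesis by (rule integrable_on_subcbox) auto
    qed
    obtain N where N: "negligible N"
      "\<And>x e. \<lbrakk>x \<notin> N; 0 < e\<rbrakk> \<Longrightarrow> \<exists>d>0. \<forall>h. 0 < h \<and> h < d \<longrightarrow>
         norm (integral (cbox x (x + h *\<^sub>R One)) f /\<^sub>R h ^ DIM('a) - f x) < e"
      using integrable_ccontinuous_explicit[OF intf] by metis
    have "v x = 0" if x: "x \<in> box a b" "x \<notin> N" for x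
    proof (rule ccontr)
      assume "v x \<noteq> 0"
      \<comment> \<open>The admissible error is |v x| itself: the averages are all 0, so an error
        below |v x| is already absurd.\<close>
      then obtain d where d: "d > 0" "\<And>h. 0 < h \<Longrightarrow> h < d \<Longrightarrow>
          norm (integral (cbox x (x + h *\<^sub>R One)) f /\<^sub>R h ^ DIM('a) - f x) < \<bar>v x\<bar>"
        using N(2)[OF x(2), of "\<bar>v x\<bar>"] by auto
      \<comment> \<open>\<open>m\<close> is the distance to the nearest upper face; a cube of side h
        < m with lower corner x stays inside the box.\<close>
      define m where "m = Min ((\<lambda>i. b \<bullet> i - x \<bullet> i) ` Basis)"
      have "m > 0" unfolding m_def using x(1) by (subst Min_gr_iff) (auto simp: mem_box)
      define h where "h = min d m / 2"
      have h: "0 < h" "h < d" "h < m" using \<open>m > 0\<close> \<open>d > 0\<close> by (auto simp: h_def)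
      have m_le: "m \<le> b \<bullet> i - x \<bullet> i" if "i \<in> Basis" for i
        unfolding m_def by (rule Min_le) (use that in auto)
      have sub: "cbox x (x + h *\<^sub>R One) \<subseteq> cbox a b"
      proof
        fix y assume y: "y \<in> cbox x (x + h *\<^sub>R One)"
        show "y \<in> cbox a b"
          unfolding mem_box
        proof
          fix i :: 'a assume i: "i \<in> Basis"
          with y have "x \<bullet> i \<le> y \<bullet> i" "y \<bullet> i \<le> x \<bullet> i + h"
            by (auto simp: mem_box inner_add_left)
          with m_le[OF i] h x(1) i show "a \<bullet> i \<le> y \<bullet> i \<and> y \<bullet> i \<le> b \<bullet> i"
            by (fastforce simp: mem_box)
        qed
      qed
      have "integral (cbox x (x + h *\<^sub>R One)) f = integral (cbox x (x + h *\<^sub>R One)) v"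
        using sub by (intro integral_cong) (auto simp: f_def)
      also have "\<dots> = (LINT y|lebesgue_on (cbox x (x + h *\<^sub>R One)). v y)"
        using int[of x "x + h *\<^sub>R One"] sub K by (subst lebesgue_integral_eq_integral) auto
      also have "\<dots> = 0"
        using sub K by (intro integral_cbox_zero_if_test_integrals_zero[OF \<open>open U\<close>] int test) auto
      finally have "integral (cbox x (x + h *\<^sub>R One)) f = 0" .
      with d(2)[OF h(1,2)] x(1) box_subset_cbox[of a b] show False
        by (auto simp: f_def split: if_splits)
    qed
    moreover have "AE x in lebesgue. x \<notin> N \<union> (cbox a b - box a b)"
      using N(1) negligible_frontier_interval[of a b]
      by (intro AE_not_in) (simp add: negligible_iff_null_sets[symmetric] negligible_Un)
    ultimately show ?thesis
      by (auto elim!: AE_mp)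
  qed
  obtain \<D> where D: "countable \<D>" "\<D> \<subseteq> Pow U" "\<And>X. X \<in> \<D> \<Longrightarrow> \<exists>a b. X = cbox a b" "\<Union>\<D> = U"
    using open_countable_Union_open_cbox[OF \<open>open U\<close>] by metis
  have "AE x in lebesgue. \<forall>X\<in>\<D>. x \<in> X \<longrightarrow> v x = 0"
    using D(2,3) box_case by (intro AE_ball_countable[OF D(1), THEN iffD2]) blast
  then have "AE x in lebesgue. x \<in> U \<longrightarrow> v x = 0"
    by (rule AE_mp) (use D(4) in auto)
  then show ?thesis
    using \<open>open U\<close> by (simp add: AE_restrict_space_iff)
qed

section \<open>Integration by parts for smooth functions\<close>

lemma smooth_measurable: "smooth f \<Longrightarrow> f \<in> borel_measurable borel"
  by (simp add: smooth_continuous borel_measurable_continuous_onI)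

lemma smooth_measurable_lebesgue: "smooth f \<Longrightarrow> f \<in> borel_measurable (lebesgue_on S)"
  by (metis smooth_measurable measurable_completion measurable_lborel2 measurable_restrict_space1)

lemma test_function_smooth: "\<phi> \<in> test_functions U \<Longrightarrow> smooth \<phi>"
  by (simp add: test_functions_def)

lemma test_function_outside: "\<phi> \<in> test_functions U \<Longrightarrow> x \<notin> U \<Longrightarrow> \<phi> x = 0"
  using closure_subset[of "{x. \<phi> x \<noteq> 0}"] by (auto simp: test_functions_def)

lemma test_function_bounded:
  assumes "\<phi> \<in> test_functions U"
  obtains M where "\<And>x. \<bar>\<phi> x\<bar> \<le> M" "M > 0"
proof -
  obtain K where K: "smooth \<phi>" "compact K" "\<And>x. x \<notin> K \<Longrightarrow> \<phi> x = 0"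
    using assms test_functionE by metis
  have "bounded (\<phi> ` K)"
    by (meson K compact_continuous_image compact_imp_bounded continuous_on_subset smooth_continuous subset_UNIV)
  then obtain M where "\<And>x. x \<in> K \<Longrightarrow> \<bar>\<phi> x\<bar> \<le> M" "M > 0"
    by (metis bounded_pos imageI real_norm_def)
  with K(3) have "\<bar>\<phi> x\<bar> \<le> M" for x
    by (cases "x \<in> K") auto
  with \<open>M > 0\<close> that show ?thesis by blast
qed

lemma test_function_integrable:
  assumes "\<phi> \<in> test_functions U"
  shows "integrable lborel \<phi>"
proof -
  obtain K where K: "smooth \<phi>" "compact K" "\<And>x. x \<notin> K \<Longrightarrow> \<phi> x = 0"
    using assms test_functionE by metis
  have "integrable lborel (\<lambda>x. indicator K x *\<^sub>R \<phi> x)"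
    by (rule borel_integrable_compact[OF K(2)], rule continuous_on_subset[OF smooth_continuous[OF K(1)]]) simp
  moreover have "(\<lambda>x. indicator K x *\<^sub>R \<phi> x) = \<phi>"
    using K(3) by (auto simp: indicator_def fun_eq_iff)
  ultimately show ?thesis by simp
qed

lemma smooth_line_derivative:
  fixes \<phi> :: "'a::euclidean_space \<Rightarrow> real"
  assumes "smooth \<phi>"
  shows "((\<lambda>t. \<phi> (x + t *\<^sub>R b)) has_real_derivative partial b \<phi> (x + t *\<^sub>R b)) (at t)"
proof -
  let ?y = "x + t *\<^sub>R b"
  have D: "(\<phi> has_derivative (\<lambda>e. partial e \<phi> ?y)) (at ?y)"
    by (rule partial_works, rule smooth_differentiable, rule assms)
  have "((\<lambda>t. x + t *\<^sub>R b) has_derivative (\<lambda>s. s *\<^sub>R b)) (at t)"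
    by (auto intro!: derivative_eq_intros)
  from has_derivative_compose[OF this D]
  have "((\<lambda>t. \<phi> (x + t *\<^sub>R b)) has_derivative (\<lambda>s. partial (s *\<^sub>R b) \<phi> ?y)) (at t)" .
  moreover have "partial (s *\<^sub>R b) \<phi> ?y = partial b \<phi> ?y * s" for s
    using linear_scale[OF has_derivative_linear[OF D], of s b] by simp
  ultimately show ?thesis by (simp add: has_field_derivative_def)
qed

text \<open>Difference quotients of a compactly supported function integrate to 0 by translation
  invariance of Lebesgue measure, and they converge boundedly to the partial derivative. No iterated
  integration is involved.\<close>

lemma integral_partial_test_function:
  fixes \<phi> :: "'a::euclidean_space \<Rightarrow> real"
  assumes "\<phi> \<in> test_functions U" "b \<in> Basis"
  shows "(LINT x|lborel. partial b \<phi> x) = 0"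
proof -
  obtain K where K: "smooth \<phi>" "compact K" "\<And>x. x \<notin> K \<Longrightarrow> \<phi> x = 0"
    using assms test_functionE by metis
  obtain M where M: "\<And>x. \<bar>partial b \<phi> x\<bar> \<le> M" "M > 0"
    using test_function_bounded[OF test_function_partial[OF assms]] by blast
  have norm_b: "norm b = 1" using assms(2) by simp
  define h where "h n = 1 / real (Suc n)" for n
  have h: "0 < h n" "h n \<le> 1" for n by (auto simp: h_def)
  have h0: "h \<longlonglongrightarrow> 0" unfolding h_def by (rule LIMSEQ_Suc[OF lim_1_over_n])
  define q where "q n x = (\<phi> (x + h n *\<^sub>R b) - \<phi> x) / h n" for n x
  note line = smooth_line_derivative[OF K(1)]
  \<comment> \<open>By the mean value theorem each quotient is a value of the partial derivative,
    hence bounded by the same \<open>M\<close>.\<close>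
  have q_bound: "\<bar>q n x\<bar> \<le> M" for n x
  proof -
    obtain z where "\<phi> (x + h n *\<^sub>R b) - \<phi> (x + 0 *\<^sub>R b) = (h n - 0) * partial b \<phi> (x + z *\<^sub>R b)"
      using MVT2[of 0 "h n" "\<lambda>t. \<phi> (x + t *\<^sub>R b)" "\<lambda>t. partial b \<phi> (x + t *\<^sub>R b)"] line h by metis
    with h(1)[of n] have "q n x = partial b \<phi> (x + z *\<^sub>R b)" by (simp add: q_def)
    with M show ?thesis by simp
  qed
  obtain B where B: "\<And>x. x \<in> K \<Longrightarrow> norm x \<le> B"
    using compact_imp_bounded[OF K(2)] by (auto simp: bounded_iff)
  \<comment> \<open>Steps of length at most 1 enlarge a support contained in the ball of radius B to
    one in the ball of radius B + 1, which gives an integrable majorant common to all n.\<close>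
  have q_out: "q n x = 0" if "x \<notin> cball 0 (B + 1)" for n x
  proof -
    have "norm x > B + 1" using that by simp
    moreover have "norm x \<le> norm (x + h n *\<^sub>R b) + norm (h n *\<^sub>R b)"
      by (metis add_diff_cancel_right' norm_triangle_ineq4)
    ultimately have "x \<notin> K" "x + h n *\<^sub>R b \<notin> K"
      using B[of x] B[of "x + h n *\<^sub>R b"] h[of n] norm_b by auto
    then show ?thesis by (simp add: q_def K)
  qed
  have int\<phi>: "integrable lborel \<phi>" by (rule test_function_integrable[OF assms(1)])
  have shift: "integrable lborel (\<lambda>x. \<phi> (x + c))" "(LINT x|lborel. \<phi> (x + c)) = (LINT x|lborel. \<phi> x)" for c
  proof -
    have [measurable]: "\<phi> \<in> borel_measurable borel" by (rule smooth_measurable, rule K)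
    have d: "distr lborel borel ((+) c) = lborel" by (rule lborel_distr_plus)
    have "integrable (distr lborel borel ((+) c)) \<phi>" unfolding d by (rule int\<phi>)
    then show "integrable lborel (\<lambda>x. \<phi> (x + c))"
      by (subst (asm) integrable_distr_eq) (auto simp: add.commute)
    have "(LINT x|lborel. \<phi> x) = (LINT x|distr lborel borel ((+) c). \<phi> x)" unfolding d by simp
    also have "\<dots> = (LINT x|lborel. \<phi> (x + c))"
      by (subst integral_distr) (auto simp: add.commute)
    finally show "(LINT x|lborel. \<phi> (x + c)) = (LINT x|lborel. \<phi> x)" by simp
  qed
  have q0: "(LINT x|lborel. q n x) = 0" for n
    unfolding q_def using shift int\<phi> by simp
  have "(\<lambda>n. LINT x|lborel. q n x) \<longlonglongrightarrow> (LINT x|lborel. partial b \<phi> x)"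
  proof (rule integral_dominated_convergence[where w="\<lambda>x. M * indicator (cball 0 (B + 1)) x"])
    have [measurable]: "\<phi> \<in> borel_measurable borel" by (rule smooth_measurable, rule K)
    show "partial b \<phi> \<in> borel_measurable lborel"
      using K(1) assms(2) by (simp add: smooth_measurable smooth_partial)
    show "q n \<in> borel_measurable lborel" for n
      unfolding q_def by measurable
    show "integrable lborel (\<lambda>x. M * indicator (cball 0 (B + 1)) x)"
      by (intro integrable_mult_right integrable_real_indicator emeasure_lborel_cball_finite) auto
    show "AE x in lborel. norm (q n x) \<le> M * indicator (cball 0 (B + 1)) x" for n
      using q_bound q_out by (intro AE_I2) (auto simp: indicator_def)
    show "AE x in lborel. (\<lambda>n. q n x) \<longlonglongrightarrow> partial b \<phi> x"
    proof (rule AE_I2)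
      fix x
      have "((\<lambda>t. (\<phi> (x + t *\<^sub>R b) - \<phi> x) / t) \<longlongrightarrow> partial b \<phi> x) (at 0)"
        using line[of x b 0] by (simp add: DERIV_def)
      moreover have "filterlim h (at 0) sequentially"
        using h0 h by (auto simp: filterlim_at less_imp_neq[symmetric] eventually_sequentially)
      ultimately show "(\<lambda>n. q n x) \<longlonglongrightarrow> partial b \<phi> x"
        unfolding q_def by (rule filterlim_compose)
    qed
  qed
  then show ?thesis unfolding q0 by (simp add: LIMSEQ_const_iff)
qed

lemma integral_lebesgue_on_eq_lborel:
  fixes f :: "'a::euclidean_space \<Rightarrow> real"
  assumes "open U" "f \<in> borel_measurable borel" "\<And>x. x \<notin> U \<Longrightarrow> f x = 0"
  shows "(LINT x|lebesgue_on U. f x) = (LINT x|lborel. f x)"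
proof -
  have "(LINT x|lebesgue_on U. f x) = (LINT x|lebesgue. indicator U x *\<^sub>R f x)"
    using assms(1) by (subst integral_restrict_space) auto
  also have "(\<lambda>x. indicator U x *\<^sub>R f x) = f"
    using assms(3) by (auto simp: indicator_def fun_eq_iff)
  finally show ?thesis
    using assms(2) by (simp add: integral_completion)
qed

text \<open>The product of \<open>f\<close> and \<phi> is a test function although \<open>f\<close>
  may have any support, so the integral of its partial derivative vanishes.\<close>

lemma smooth_integration_by_parts:
  fixes f \<phi> :: "'a::euclidean_space \<Rightarrow> real"
  assumes "open U" "\<phi> \<in> test_functions U" "smooth f" "b \<in> Basis"
  shows "(LINT x|lebesgue_on U. f x * partial b \<phi> x) = - (LINT x|lebesgue_on U. partial b f x * \<phi> x)"
proof -
  have sm: "smooth \<phi>" by (rule test_function_smooth[OF assms(2)])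
  have out: "\<phi> x = 0" "partial b \<phi> x = 0" if "x \<notin> U" for x
    using that assms(2,4) by (auto intro: test_function_outside test_function_partial)
  have 1: "(\<lambda>x. f x * partial b \<phi> x) \<in> test_functions U" "(\<lambda>x. partial b f x * \<phi> x) \<in> test_functions U"
    using assms test_function_partial by (auto intro!: test_function_smooth_mult smooth_partial)
  have "0 = (LINT x|lborel. partial b (\<lambda>x. f x * \<phi> x) x)"
    using integral_partial_test_function[OF test_function_smooth_mult[OF assms(2,3)] assms(4)] by simp
  also have "\<dots> = (LINT x|lborel. f x * partial b \<phi> x + partial b f x * \<phi> x)"
    using sm assms by (simp add: partial_mult smooth_differentiable)
  also have "\<dots> = (LINT x|lborel. f x * partial b \<phi> x) + (LINT x|lborel. partial b f x * \<phi> x)"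
    using 1 by (intro Bochner_Integration.integral_add test_function_integrable)
  also have "(LINT x|lborel. f x * partial b \<phi> x) = (LINT x|lebesgue_on U. f x * partial b \<phi> x)"
    using sm assms out by (intro integral_lebesgue_on_eq_lborel[symmetric] smooth_measurable smooth_mult smooth_partial) auto
  also have "(LINT x|lborel. partial b f x * \<phi> x) = (LINT x|lebesgue_on U. partial b f x * \<phi> x)"
    using sm assms out by (intro integral_lebesgue_on_eq_lborel[symmetric] smooth_measurable smooth_mult smooth_partial) auto
  finally show ?thesis by simp
qed

section \<open>The spaces L2 and H1\<close>

lemma L2D: "u \<in> L2 \<Omega> \<Longrightarrow> u \<in> borel_measurable (lebesgue_on \<Omega>)"
  "u \<in> L2 \<Omega> \<Longrightarrow> integrable (lebesgue_on \<Omega>) (\<lambda>x. (u x)\<^sup>2)"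
  by (auto simp: L2_def)

lemma L2_mult_integrable:
  assumes "u \<in> L2 \<Omega>" "v \<in> L2 \<Omega>"
  shows "integrable (lebesgue_on \<Omega>) (\<lambda>x. u x * v x)"
proof (rule Bochner_Integration.integrable_bound)
  show "integrable (lebesgue_on \<Omega>) (\<lambda>x. (u x)\<^sup>2 + (v x)\<^sup>2)"
    using assms by (simp add: L2D)
  show "(\<lambda>x. u x * v x) \<in> borel_measurable (lebesgue_on \<Omega>)"
    using assms by (intro borel_measurable_times L2D)
  have "\<bar>a * b\<bar> \<le> a\<^sup>2 + b\<^sup>2" for a b :: real
  proof -
    have "2 * (\<bar>a\<bar> * \<bar>b\<bar>) \<le> a\<^sup>2 + b\<^sup>2"
      using sum_squares_bound[of "\<bar>a\<bar>" "\<bar>b\<bar>"] by (simp add: mult.assoc)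
    moreover have "0 \<le> \<bar>a\<bar> * \<bar>b\<bar>" by simp
    ultimately show ?thesis unfolding abs_mult by linarith
  qed
  then show "AE x in lebesgue_on \<Omega>. norm (u x * v x) \<le> norm ((u x)\<^sup>2 + (v x)\<^sup>2)"
    by (intro AE_I2) simp
qed

lemma L2_lincomb:
  assumes "u \<in> L2 \<Omega>" "v \<in> L2 \<Omega>"
  shows "(\<lambda>x. a * u x + b * v x) \<in> L2 \<Omega>"
proof -
  have "(\<lambda>x. (a * u x + b * v x)\<^sup>2) = (\<lambda>x. a\<^sup>2 * (u x)\<^sup>2 + 2 * a * b * (u x * v x) + b\<^sup>2 * (v x)\<^sup>2)"
    by (auto simp: power2_eq_square algebra_simps)
  then have "integrable (lebesgue_on \<Omega>) (\<lambda>x. (a * u x + b * v x)\<^sup>2)"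
    using assms by (simp add: L2D L2_mult_integrable)
  moreover have "(\<lambda>x. a * u x + b * v x) \<in> borel_measurable (lebesgue_on \<Omega>)"
    using assms by (intro borel_measurable_times borel_measurable_add borel_measurable_const L2D)
  ultimately show ?thesis by (simp add: L2_def)
qed

lemma L2_diff: "u \<in> L2 \<Omega> \<Longrightarrow> v \<in> L2 \<Omega> \<Longrightarrow> (\<lambda>x. u x - v x) \<in> L2 \<Omega>"
  using L2_lincomb[of u \<Omega> v 1 "-1"] by simp

lemma L2_zero: "(\<lambda>x. 0) \<in> L2 \<Omega>"
  by (simp add: L2_def)

lemma L2_sum: "(\<And>i. i \<in> A \<Longrightarrow> u i \<in> L2 \<Omega>) \<Longrightarrow> (\<lambda>x. \<Sum>i\<in>A. u i x) \<in> L2 \<Omega>"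
proof (induction A rule: infinite_finite_induct)
  case (insert i A)
  then show ?case using L2_lincomb[of "u i" \<Omega> "\<lambda>x. \<Sum>i\<in>A. u i x" 1 1] by simp
qed (auto simp: L2_zero)

lemma L2_inner_commute: "L2_inner \<Omega> u v = L2_inner \<Omega> v u"
  by (simp add: L2_inner_def mult.commute)

lemma L2_inner_lincomb_left:
  assumes "u \<in> L2 \<Omega>" "v \<in> L2 \<Omega>" "w \<in> L2 \<Omega>"
  shows "L2_inner \<Omega> (\<lambda>x. a * u x + b * v x) w = a * L2_inner \<Omega> u w + b * L2_inner \<Omega> v w"
proof -
  have "(\<lambda>x. (a * u x + b * v x) * w x) = (\<lambda>x. a * (u x * w x) + b * (v x * w x))"
    by (auto simp: algebra_simps)
  with assms show ?thesis by (simp add: L2_inner_def L2_mult_integrable)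
qed

lemma L2_inner_lincomb_right:
  assumes "u \<in> L2 \<Omega>" "v \<in> L2 \<Omega>" "w \<in> L2 \<Omega>"
  shows "L2_inner \<Omega> w (\<lambda>x. a * u x + b * v x) = a * L2_inner \<Omega> w u + b * L2_inner \<Omega> w v"
  using L2_inner_lincomb_left[OF assms] by (simp add: L2_inner_commute)

lemma L2_inner_diff_left:
  assumes "u \<in> L2 \<Omega>" "v \<in> L2 \<Omega>" "w \<in> L2 \<Omega>"
  shows "L2_inner \<Omega> (\<lambda>x. u x - v x) w = L2_inner \<Omega> u w - L2_inner \<Omega> v w"
  using L2_inner_lincomb_left[OF assms, of 1 "-1"] by simp

lemma L2_inner_diff_right:
  assumes "u \<in> L2 \<Omega>" "v \<in> L2 \<Omega>" "w \<in> L2 \<Omega>"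
  shows "L2_inner \<Omega> w (\<lambda>x. u x - v x) = L2_inner \<Omega> w u - L2_inner \<Omega> w v"
  using L2_inner_lincomb_right[OF assms, of 1 "-1"] by simp

lemma L2_inner_cong_AE:
  assumes "AE x in lebesgue_on \<Omega>. u x = u' x" "AE x in lebesgue_on \<Omega>. v x = v' x"
    and "u \<in> L2 \<Omega>" "u' \<in> L2 \<Omega>" "v \<in> L2 \<Omega>" "v' \<in> L2 \<Omega>"
  shows "L2_inner \<Omega> u v = L2_inner \<Omega> u' v'"
  unfolding L2_inner_def
proof (rule integral_cong_AE)
  show "AE x in lebesgue_on \<Omega>. u x * v x = u' x * v' x"
    using assms(1,2) by eventually_elim simp
qed (intro borel_measurable_times L2D(1); fact)+

lemma L2_norm_cong_AE:
  assumes "AE x in lebesgue_on \<Omega>. u x = u' x" "u \<in> L2 \<Omega>" "u' \<in> L2 \<Omega>"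
  shows "L2_norm \<Omega> u = L2_norm \<Omega> u'"
  using assms L2_inner_cong_AE[OF assms(1) assms(1)] by (simp add: L2_norm_def)

lemma L2_inner_self_nonneg: "0 \<le> L2_inner \<Omega> u u"
  by (simp add: L2_inner_def)

lemma L2_norm_nonneg [simp]: "0 \<le> L2_norm \<Omega> u"
  by (simp add: L2_norm_def L2_inner_self_nonneg)

lemma L2_norm_square: "(L2_norm \<Omega> u)\<^sup>2 = L2_inner \<Omega> u u"
  by (simp add: L2_norm_def L2_inner_self_nonneg)

lemma L2_norm_scale: "L2_norm \<Omega> (\<lambda>x. c * u x) = \<bar>c\<bar> * L2_norm \<Omega> u"
proof -
  have "L2_inner \<Omega> (\<lambda>x. c * u x) (\<lambda>x. c * u x) = c\<^sup>2 * L2_inner \<Omega> u u"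
    unfolding L2_inner_def by (subst integral_mult_right_zero[symmetric]) (simp add: power2_eq_square algebra_simps)
  then show ?thesis by (simp add: L2_norm_def real_sqrt_mult)
qed

lemma L2_norm_zero [simp]: "L2_norm \<Omega> (\<lambda>x. 0) = 0"
  by (simp add: L2_norm_def L2_inner_def)

lemma L2_norm_eq_0:
  assumes "u \<in> L2 \<Omega>" "L2_norm \<Omega> u = 0"
  shows "AE x in lebesgue_on \<Omega>. u x = 0"
proof -
  have "(LINT x|lebesgue_on \<Omega>. (u x)\<^sup>2) = 0"
    using assms(2) by (simp add: L2_norm_def L2_inner_def power2_eq_square)
  then have "AE x in lebesgue_on \<Omega>. (u x)\<^sup>2 = 0"
    using assms(1) by (subst (asm) integral_nonneg_eq_0_iff_AE) (auto simp: L2D)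
  then show ?thesis by simp
qed

text \<open>\<open>L2_norm\<close> is only a seminorm on functions, so the case of norm 0 is settled
  through vanishing almost everywhere. Otherwise the nonnegative quadratic form is evaluated at a
  multiple of the combination of \<open>u\<close> and \<open>v\<close> that minimises it.\<close>

lemma L2_inner_le_norm:
  assumes "u \<in> L2 \<Omega>" "v \<in> L2 \<Omega>"
  shows "\<bar>L2_inner \<Omega> u v\<bar> \<le> L2_norm \<Omega> u * L2_norm \<Omega> v"
proof -
  have exp: "L2_inner \<Omega> (\<lambda>x. a * u x + b * v x) (\<lambda>x. a * u x + b * v x)
      = a\<^sup>2 * (L2_norm \<Omega> u)\<^sup>2 + 2 * a * b * L2_inner \<Omega> u v + b\<^sup>2 * (L2_norm \<Omega> v)\<^sup>2" for a b
    using assms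
    by (simp add: L2_inner_lincomb_left L2_inner_lincomb_right L2_lincomb L2_norm_square
        L2_inner_commute[of \<Omega> v u] power2_eq_square[of a] power2_eq_square[of b] algebra_simps)
  have ge: "0 \<le> a\<^sup>2 * (L2_norm \<Omega> u)\<^sup>2 + 2 * a * b * L2_inner \<Omega> u v + b\<^sup>2 * (L2_norm \<Omega> v)\<^sup>2" for a b
    using L2_inner_self_nonneg[of \<Omega> "\<lambda>x. a * u x + b * v x"] unfolding exp .
  have "(L2_inner \<Omega> u v)\<^sup>2 \<le> (L2_norm \<Omega> u)\<^sup>2 * (L2_norm \<Omega> v)\<^sup>2"
  proof (cases "L2_norm \<Omega> v = 0")
    case True
    then have "AE x in lebesgue_on \<Omega>. v x = 0" using L2_norm_eq_0 assms by blast
    then have "L2_inner \<Omega> u v = L2_inner \<Omega> u (\<lambda>x. 0)"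
      using assms by (intro L2_inner_cong_AE) (auto simp: L2_zero)
    with True show ?thesis by (simp add: L2_inner_def)
  next
    case False
    let ?B = "(L2_norm \<Omega> v)\<^sup>2" and ?I = "L2_inner \<Omega> u v"
    have "0 \<le> ?B * (?B * (L2_norm \<Omega> u)\<^sup>2 - ?I\<^sup>2)"
      using ge[of ?B "- ?I"] by (simp add: power2_eq_square algebra_simps)
    with False show ?thesis by (simp add: zero_le_mult_iff mult.commute)
  qed
  then have "\<bar>L2_inner \<Omega> u v\<bar>\<^sup>2 \<le> (L2_norm \<Omega> u * L2_norm \<Omega> v)\<^sup>2"
    by (simp add: power_mult_distrib)
  then show ?thesis by (rule power2_le_imp_le) simp
qed

lemma L2_norm_add_le:
  assumes "u \<in> L2 \<Omega>" "v \<in> L2 \<Omega>"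
  shows "L2_norm \<Omega> (\<lambda>x. u x + v x) \<le> L2_norm \<Omega> u + L2_norm \<Omega> v"
proof (rule power2_le_imp_le)
  have "(L2_norm \<Omega> (\<lambda>x. u x + v x))\<^sup>2 = L2_inner \<Omega> (\<lambda>x. 1 * u x + 1 * v x) (\<lambda>x. 1 * u x + 1 * v x)"
    by (simp add: L2_norm_square)
  also have "\<dots> = (L2_norm \<Omega> u)\<^sup>2 + 2 * L2_inner \<Omega> u v + (L2_norm \<Omega> v)\<^sup>2"
    using assms unfolding L2_norm_square
    by (subst L2_inner_lincomb_left L2_inner_lincomb_right L2_lincomb; simp add: L2_lincomb[where a=1 and b=1, simplified])
       (simp add: L2_inner_lincomb_right[where a=1 and b=1, simplified] L2_inner_commute[of \<Omega> v u])
  also have "\<dots> \<le> (L2_norm \<Omega> u + L2_norm \<Omega> v)\<^sup>2"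
    using L2_inner_le_norm[OF assms] by (simp add: power2_sum)
  finally show "(L2_norm \<Omega> (\<lambda>x. u x + v x))\<^sup>2 \<le> (L2_norm \<Omega> u + L2_norm \<Omega> v)\<^sup>2" .
qed simp

lemma L2_norm_lincomb_le:
  assumes "u \<in> L2 \<Omega>" "v \<in> L2 \<Omega>"
  shows "L2_norm \<Omega> (\<lambda>x. a * u x + b * v x) \<le> \<bar>a\<bar> * L2_norm \<Omega> u + \<bar>b\<bar> * L2_norm \<Omega> v"
proof -
  have sc: "(\<lambda>x. c * w x) \<in> L2 \<Omega>" if "w \<in> L2 \<Omega>" for c w
    using L2_lincomb[OF that that, of c 0] by simp
  show ?thesis
    using L2_norm_add_le[OF sc[OF assms(1), of a] sc[OF assms(2), of b]] by (simp add: L2_norm_scale)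
qed

lemma tuple_norm_eq_L2_set: "tuple_norm N u = L2_set (\<lambda>i. N (u i)) UNIV"
  by (simp add: tuple_norm_def L2_set_def)

section \<open>Weak derivatives and Sobolev norms\<close>

lemma has_weak_partialD:
  assumes "has_weak_partial \<Omega> i u v"
  shows "v \<in> L2 \<Omega>" "\<phi> \<in> test_functions \<Omega> \<Longrightarrow> L2_inner \<Omega> u (partial (axis i 1) \<phi>) = - L2_inner \<Omega> v \<phi>"
  using assms by (auto simp: has_weak_partial_def)

lemma H1_D:
  assumes "u \<in> H1 \<Omega>"
  shows "u \<in> L2 \<Omega>" "has_weak_partial \<Omega> i u (weak_partial \<Omega> i u)" "weak_partial \<Omega> i u \<in> L2 \<Omega>"
proof -
  show "u \<in> L2 \<Omega>" using assms by (simp add: H1_def)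
  show *: "has_weak_partial \<Omega> i u (weak_partial \<Omega> i u)"
    unfolding weak_partial_def using assms by (intro someI_ex[of "has_weak_partial \<Omega> i u"]) (auto simp: H1_def)
  show "weak_partial \<Omega> i u \<in> L2 \<Omega>" using has_weak_partialD(1)[OF *] .
qed

lemma H10_D: "u \<in> H10 \<Omega> \<Longrightarrow> u \<in> H1 \<Omega>" "u \<in> H10 \<Omega> \<Longrightarrow> u \<in> L2 \<Omega>"
  by (auto simp: H10_def H1_def)

lemma axis_one_Basis: "axis i (1::real) \<in> Basis"
  by (simp add: axis_in_Basis_iff)

text \<open>A function and its first weak partials as one family, \<open>None\<close> being the
  index of the function itself. This makes \<open>H1_norm\<close> a Euclidean norm of
  \<open>L2\<close> norms, so that its triangle inequality comes from
  \<open>L2_set_triangle_ineq\<close>.\<close>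

definition jet :: "(real ^ 'n) set \<Rightarrow> 'n::finite scalar_field \<Rightarrow> 'n option \<Rightarrow> 'n scalar_field" where
  "jet \<Omega> u k = (case k of None \<Rightarrow> u | Some i \<Rightarrow> weak_partial \<Omega> i u)"

lemma H1_norm_eq_L2_set: "H1_norm \<Omega> u = L2_set (\<lambda>k. L2_norm \<Omega> (jet \<Omega> u k)) UNIV"
  unfolding H1_norm_def L2_set_def UNIV_option_conv
  by (subst sum.insert) (auto simp: jet_def sum.reindex)

lemma H1_norm_nonneg [simp]: "0 \<le> H1_norm \<Omega> u"
  by (simp add: H1_norm_eq_L2_set L2_set_nonneg)

lemma L2_norm_le_H1_norm: "L2_norm \<Omega> u \<le> H1_norm \<Omega> u"
  using member_le_L2_set[of UNIV None "\<lambda>k. L2_norm \<Omega> (jet \<Omega> u k)"]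
  by (simp add: H1_norm_eq_L2_set jet_def)

lemma L2_norm_weak_partial_le_H1_norm: "L2_norm \<Omega> (weak_partial \<Omega> i u) \<le> H1_norm \<Omega> u"
  using member_le_L2_set[of UNIV "Some i" "\<lambda>k. L2_norm \<Omega> (jet \<Omega> u k)"]
  by (simp add: H1_norm_eq_L2_set jet_def)

text \<open>Openness lets test functions determine an \<open>L2\<close> function almost everywhere;
  boundedness puts constants and smooth functions into \<open>L2\<close>.\<close>

locale bounded_open_set =
  fixes \<Omega> :: "(real ^ 'n::finite) set"
  assumes open_\<Omega>: "open \<Omega>" and bounded_\<Omega>: "bounded \<Omega>"
begin

lemma \<Omega>_sets [simp]: "\<Omega> \<in> sets lebesgue"
  using open_\<Omega> by auto

lemma integrable_const_\<Omega> [simp]: "integrable (lebesgue_on \<Omega>) (\<lambda>x. c::real)"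
proof -
  have "emeasure lebesgue \<Omega> < \<infinity>"
    using emeasure_bounded_finite[OF bounded_\<Omega>] by (simp add: open_\<Omega> emeasure_completion)
  then show ?thesis
    by (intro finite_measure.integrable_const finite_measureI) (simp add: emeasure_restrict_space)
qed

lemma L2_integrable:
  assumes "u \<in> L2 \<Omega>"
  shows "integrable (lebesgue_on \<Omega>) u"
proof (rule Bochner_Integration.integrable_bound)
  show "integrable (lebesgue_on \<Omega>) (\<lambda>x. 1 + (u x)\<^sup>2)"
    using assms by (simp add: L2D)
  have "\<bar>a\<bar> \<le> 1 + a\<^sup>2" for a :: real
    using sum_squares_bound[of "\<bar>a\<bar>" 1] by simp
  then show "AE x in lebesgue_on \<Omega>. norm (u x) \<le> norm (1 + (u x)\<^sup>2)"
    by (intro AE_I2) simp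
qed (use assms in \<open>simp add: L2D\<close>)

lemma bounded_measurable_L2:
  assumes "u \<in> borel_measurable (lebesgue_on \<Omega>)" "\<And>x. x \<in> \<Omega> \<Longrightarrow> \<bar>u x\<bar> \<le> M"
  shows "u \<in> L2 \<Omega>"
proof -
  have "integrable (lebesgue_on \<Omega>) (\<lambda>x. (u x)\<^sup>2)"
  proof (rule Bochner_Integration.integrable_bound)
    show "integrable (lebesgue_on \<Omega>) (\<lambda>x. M\<^sup>2)" by simp
    show "AE x in lebesgue_on \<Omega>. norm ((u x)\<^sup>2) \<le> norm (M\<^sup>2)"
      by (intro AE_I2) (use assms(2) in \<open>auto simp: power2_le_iff_abs_le abs_le_square_iff[symmetric] intro: order_trans[OF _ abs_ge_self]\<close>)
  qed (use assms in auto)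
  with assms show ?thesis by (simp add: L2_def)
qed

lemma smooth_L2:
  assumes "smooth f"
  shows "f \<in> L2 \<Omega>"
proof -
  have "compact (f ` closure \<Omega>)"
    using bounded_\<Omega> smooth_continuous[OF assms]
    by (intro compact_continuous_image) (auto simp: compact_closure intro: continuous_on_subset)
  then obtain M where "\<And>x. x \<in> closure \<Omega> \<Longrightarrow> \<bar>f x\<bar> \<le> M"
    using compact_imp_bounded by (metis bounded_iff imageI real_norm_def)
  then show ?thesis
    using closure_subset[of \<Omega>] assms by (intro bounded_measurable_L2[where M=M]) (auto simp: smooth_measurable_lebesgue)
qed

lemma test_function_L2: "\<phi> \<in> test_functions \<Omega> \<Longrightarrow> \<phi> \<in> L2 \<Omega>"
  by (simp add: smooth_L2 test_function_smooth)

lemma AE_eq_if_test_integrals_eq: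
  assumes "u \<in> L2 \<Omega>" "v \<in> L2 \<Omega>" and "\<And>\<phi>. \<phi> \<in> test_functions \<Omega> \<Longrightarrow> L2_inner \<Omega> u \<phi> = L2_inner \<Omega> v \<phi>"
  shows "AE x in lebesgue_on \<Omega>. u x = v x"
proof -
  have d: "(\<lambda>x. u x - v x) \<in> L2 \<Omega>" using assms by (simp add: L2_diff)
  have "AE x in lebesgue_on \<Omega>. u x - v x = 0"
  proof (rule AE_zero_if_test_integrals_zero[OF open_\<Omega>])
    show "integrable (lebesgue_on (cbox a b)) (\<lambda>x. u x - v x)" if "cbox a b \<subseteq> \<Omega>" for a b
    proof -
      have "set_integrable lebesgue \<Omega> (\<lambda>x. u x - v x)"
        using L2_integrable[OF d] by (simp add: set_integrable_def integrable_restrict_space)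
      then have "set_integrable lebesgue (cbox a b) (\<lambda>x. u x - v x)"
        by (rule set_integrable_subset) (use that in auto)
      then show ?thesis by (simp add: set_integrable_def integrable_restrict_space)
    qed
    show "(LINT x|lebesgue_on \<Omega>. (u x - v x) * \<phi> x) = 0" if "\<phi> \<in> test_functions \<Omega>" for \<phi>
      using L2_inner_diff_left[OF assms(1,2) test_function_L2[OF that]] assms(3)[OF that]
      by (simp add: L2_inner_def)
  qed
  then show ?thesis by simp
qed

lemma has_weak_partial_unique:
  assumes "has_weak_partial \<Omega> i u v" "has_weak_partial \<Omega> i u w"
  shows "AE x in lebesgue_on \<Omega>. v x = w x"
  using assms by (intro AE_eq_if_test_integrals_eq) (auto simp: has_weak_partial_def)

lemma test_function_partial_L2: "\<phi> \<in> test_functions \<Omega> \<Longrightarrow> partial (axis i 1) \<phi> \<in> L2 \<Omega>"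
  by (simp add: test_function_L2 test_function_partial axis_one_Basis)

lemma has_weak_partial_lincomb:
  assumes "has_weak_partial \<Omega> i u v" "has_weak_partial \<Omega> i u' v'" "u \<in> L2 \<Omega>" "u' \<in> L2 \<Omega>"
  shows "has_weak_partial \<Omega> i (\<lambda>x. a * u x + b * u' x) (\<lambda>x. a * v x + b * v' x)"
  using assms unfolding has_weak_partial_def
  by (auto simp: L2_lincomb L2_inner_lincomb_left test_function_L2 test_function_partial_L2)

lemma has_weak_partial_cong_AE:
  assumes "has_weak_partial \<Omega> i u v" "AE x in lebesgue_on \<Omega>. u x = u' x" "u \<in> L2 \<Omega>" "u' \<in> L2 \<Omega>"
  shows "has_weak_partial \<Omega> i u' v"
proof -
  have "L2_inner \<Omega> u (partial (axis i 1) \<phi>) = L2_inner \<Omega> u' (partial (axis i 1) \<phi>)" if "\<phi> \<in> test_functions \<Omega>" for \<phi>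
    using assms(2-4) that by (intro L2_inner_cong_AE) (auto simp: test_function_partial_L2)
  with assms(1) show ?thesis by (simp add: has_weak_partial_def)
qed

text \<open>\<open>weak_partial\<close> is an arbitrary choice among functions that agree almost
  everywhere. This is the device that computes it from any explicit weak derivative, and the reason
  why the linearity rules below hold almost everywhere only.\<close>

lemma weak_partial_AE_eq:
  assumes "has_weak_partial \<Omega> i u v"
  shows "AE x in lebesgue_on \<Omega>. weak_partial \<Omega> i u x = v x"
proof -
  have "has_weak_partial \<Omega> i u (weak_partial \<Omega> i u)"
    unfolding weak_partial_def using assms by (rule someI[where P="has_weak_partial \<Omega> i u"])
  from has_weak_partial_unique[OF this assms] show ?thesis .
qed

lemma smooth_has_weak_partial:
  assumes "smooth f"
  shows "has_weak_partial \<Omega> i f (partial (axis i 1) f)"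
  using smooth_integration_by_parts[OF open_\<Omega> _ assms axis_one_Basis] assms
  by (auto simp: has_weak_partial_def L2_inner_def smooth_L2 smooth_partial axis_one_Basis)

lemma smooth_H1: "smooth f \<Longrightarrow> f \<in> H1 \<Omega>"
  using smooth_has_weak_partial by (auto simp: H1_def smooth_L2)

lemma H1_lincomb:
  assumes "u \<in> H1 \<Omega>" "v \<in> H1 \<Omega>"
  shows "(\<lambda>x. a * u x + b * v x) \<in> H1 \<Omega>"
proof -
  have "\<exists>w. has_weak_partial \<Omega> i (\<lambda>x. a * u x + b * v x) w" for i
    using has_weak_partial_lincomb[OF H1_D(2)[OF assms(1)] H1_D(2)[OF assms(2)] H1_D(1)[OF assms(1)] H1_D(1)[OF assms(2)]]
    by blast
  with assms show ?thesis by (auto simp: H1_def intro!: L2_lincomb)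
qed

lemma weak_partial_lincomb:
  assumes "u \<in> H1 \<Omega>" "v \<in> H1 \<Omega>"
  shows "AE x in lebesgue_on \<Omega>. weak_partial \<Omega> i (\<lambda>x. a * u x + b * v x) x
      = a * weak_partial \<Omega> i u x + b * weak_partial \<Omega> i v x"
  using assms by (intro weak_partial_AE_eq has_weak_partial_lincomb) (auto intro: H1_D)

lemma weak_partial_diff:
  assumes "u \<in> H1 \<Omega>" "v \<in> H1 \<Omega>"
  shows "AE x in lebesgue_on \<Omega>. weak_partial \<Omega> i (\<lambda>x. u x - v x) x
      = weak_partial \<Omega> i u x - weak_partial \<Omega> i v x"
  using weak_partial_lincomb[OF assms, of i 1 "-1"] by simp

lemma H1_diff: "u \<in> H1 \<Omega> \<Longrightarrow> v \<in> H1 \<Omega> \<Longrightarrow> (\<lambda>x. u x - v x) \<in> H1 \<Omega>"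
  using H1_lincomb[of u v 1 "-1"] by simp

lemma jet_lincomb:
  assumes "u \<in> H1 \<Omega>" "v \<in> H1 \<Omega>"
  shows "AE x in lebesgue_on \<Omega>. jet \<Omega> (\<lambda>x. a * u x + b * v x) k x = a * jet \<Omega> u k x + b * jet \<Omega> v k x"
  using weak_partial_lincomb[OF assms] by (cases k) (auto simp: jet_def)

lemma jet_L2: "u \<in> H1 \<Omega> \<Longrightarrow> jet \<Omega> u k \<in> L2 \<Omega>"
  by (cases k) (auto simp: jet_def H1_D)

text \<open>The triangle inequality is applied twice, in \<open>L2\<close> to each component of the
  jet and then in the Euclidean norm over the components; for the first, linearity of the jet almost
  everywhere is enough.\<close>

lemma H1_norm_lincomb_le:
  assumes "u \<in> H1 \<Omega>" "v \<in> H1 \<Omega>"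
  shows "H1_norm \<Omega> (\<lambda>x. a * u x + b * v x) \<le> \<bar>a\<bar> * H1_norm \<Omega> u + \<bar>b\<bar> * H1_norm \<Omega> v"
proof -
  have "L2_norm \<Omega> (jet \<Omega> (\<lambda>x. a * u x + b * v x) k) \<le> \<bar>a\<bar> * L2_norm \<Omega> (jet \<Omega> u k) + \<bar>b\<bar> * L2_norm \<Omega> (jet \<Omega> v k)"
    for k
  proof -
    have "L2_norm \<Omega> (jet \<Omega> (\<lambda>x. a * u x + b * v x) k) = L2_norm \<Omega> (\<lambda>x. a * jet \<Omega> u k x + b * jet \<Omega> v k x)"
      by (intro L2_norm_cong_AE jet_lincomb jet_L2 L2_lincomb H1_lincomb assms)
    with L2_norm_lincomb_le[OF jet_L2[OF assms(1)] jet_L2[OF assms(2)]] show ?thesis by simp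
  qed
  then have "H1_norm \<Omega> (\<lambda>x. a * u x + b * v x)
      \<le> L2_set (\<lambda>k. \<bar>a\<bar> * L2_norm \<Omega> (jet \<Omega> u k) + \<bar>b\<bar> * L2_norm \<Omega> (jet \<Omega> v k)) UNIV"
    unfolding H1_norm_eq_L2_set by (intro L2_set_mono) auto
  also have "\<dots> \<le> L2_set (\<lambda>k. \<bar>a\<bar> * L2_norm \<Omega> (jet \<Omega> u k)) UNIV + L2_set (\<lambda>k. \<bar>b\<bar> * L2_norm \<Omega> (jet \<Omega> v k)) UNIV"
    by (rule L2_set_triangle_ineq)
  also have "\<dots> = \<bar>a\<bar> * H1_norm \<Omega> u + \<bar>b\<bar> * H1_norm \<Omega> v"
    by (simp add: H1_norm_eq_L2_set L2_set_right_distrib)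
  finally show ?thesis .
qed

lemma H10_lincomb:
  assumes "u \<in> H10 \<Omega>" "v \<in> H10 \<Omega>"
  shows "(\<lambda>x. a * u x + b * v x) \<in> H10 \<Omega>"
proof -
  have uv: "u \<in> H1 \<Omega>" "v \<in> H1 \<Omega>" using assms by (auto dest: H10_D)
  have "\<exists>\<phi>\<in>test_functions \<Omega>. H1_norm \<Omega> ((\<lambda>x. a * u x + b * v x) - \<phi>) < e" if "e > 0" for e
  proof -
    \<comment> \<open>The summand 1 excludes division by zero and also yields strictness: the total
      error is at most \<open>e - d\<close>.\<close>
    define d where "d = e / (\<bar>a\<bar> + \<bar>b\<bar> + 1)"
    have "d > 0" using that by (simp add: d_def)
    obtain \<phi> where \<phi>: "\<phi> \<in> test_functions \<Omega>" "H1_norm \<Omega> (u - \<phi>) < d"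
      using assms(1) \<open>d > 0\<close> unfolding H10_def by blast
    obtain \<psi> where \<psi>: "\<psi> \<in> test_functions \<Omega>" "H1_norm \<Omega> (v - \<psi>) < d"
      using assms(2) \<open>d > 0\<close> unfolding H10_def by blast
    have "(u - \<phi>) \<in> H1 \<Omega>" "(v - \<psi>) \<in> H1 \<Omega>"
      unfolding fun_diff_def using uv \<phi>(1) \<psi>(1)
      by (auto intro!: H1_diff intro: test_function_smooth smooth_H1)
    from H1_norm_lincomb_le[OF this, of a b]
    have "H1_norm \<Omega> ((\<lambda>x. a * u x + b * v x) - (\<lambda>x. a * \<phi> x + b * \<psi> x))
        \<le> \<bar>a\<bar> * H1_norm \<Omega> (u - \<phi>) + \<bar>b\<bar> * H1_norm \<Omega> (v - \<psi>)"
      by (simp add: fun_diff_def algebra_simps)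
    also have "\<dots> \<le> \<bar>a\<bar> * d + \<bar>b\<bar> * d"
      using \<phi> \<psi> by (intro add_mono mult_left_mono) auto
    also have "\<dots> = e - d"
    proof -
      have "\<bar>a\<bar> + \<bar>b\<bar> + 1 \<noteq> 0" by linarith
      then have "d * (\<bar>a\<bar> + \<bar>b\<bar> + 1) = e" by (simp add: d_def)
      then show ?thesis by (simp add: algebra_simps)
    qed
    also have "\<dots> < e" using \<open>d > 0\<close> by simp
    finally show ?thesis using test_function_lincomb[OF \<phi>(1) \<psi>(1)] by blast
  qed
  with H1_lincomb[OF uv] show ?thesis by (auto simp: H10_def)
qed

lemma H10_diff: "u \<in> H10 \<Omega> \<Longrightarrow> v \<in> H10 \<Omega> \<Longrightarrow> (\<lambda>x. u x - v x) \<in> H10 \<Omega>"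
  using H10_lincomb[of u v 1 "-1"] by simp

lemma H10_scale: "u \<in> H10 \<Omega> \<Longrightarrow> (\<lambda>x. c * u x) \<in> H10 \<Omega>"
  using H10_lincomb[of u u c 0] by simp

lemma H1_norm_scale:
  assumes "u \<in> H1 \<Omega>"
  shows "H1_norm \<Omega> (\<lambda>x. c * u x) \<le> \<bar>c\<bar> * H1_norm \<Omega> u"
  using H1_norm_lincomb_le[OF assms assms, of c 0] by simp

lemma test_function_H10: "\<phi> \<in> test_functions \<Omega> \<Longrightarrow> \<phi> \<in> H10 \<Omega>"
proof -
  assume \<phi>: "\<phi> \<in> test_functions \<Omega>"
  then have "\<phi> \<in> H1 \<Omega>" by (simp add: smooth_H1 test_function_smooth)
  \<comment> \<open>The zero function, too, has chosen weak partials, so its norm is obtained by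
    scaling \<phi> with 0.\<close>
  moreover from H1_norm_scale[OF this, of 0] have "H1_norm \<Omega> (\<phi> - \<phi>) = 0"
    using order_antisym[OF _ H1_norm_nonneg] by (simp add: fun_diff_def)
  ultimately show ?thesis using \<phi> by (auto simp: H10_def intro!: bexI[of _ \<phi>])
qed

end

section \<open>The Sobolev embedding of H10 into L6\<close>

text \<open>The fundamental theorem of calculus along a line, started at a point beyond the support.
  This inequality drives the Sobolev estimates in all three dimensions.\<close>

lemma test_function_le_line_integral:
  fixes \<phi> :: "'a::euclidean_space \<Rightarrow> real"
  assumes "\<phi> \<in> test_functions U" "b \<in> Basis"
  shows "ennreal \<bar>\<phi> (x + t *\<^sub>R b)\<bar> \<le> (\<integral>\<^sup>+s. ennreal \<bar>partial b \<phi> (x + s *\<^sub>R b)\<bar> \<partial>lborel)"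
proof -
  obtain K where K: "smooth \<phi>" "compact K" "\<And>x. x \<notin> K \<Longrightarrow> \<phi> x = 0"
    using assms test_functionE by metis
  obtain B where B: "\<And>x. x \<in> K \<Longrightarrow> norm x \<le> B"
    using compact_imp_bounded[OF K(2)] by (auto simp: bounded_iff)
  \<comment> \<open>Far enough in direction \<open>- b\<close> to leave the ball of radius B
    containing the support, and never to the right of t, so that {a..t} is a genuine
    interval.\<close>
  define a where "a = min t (- (\<bar>B\<bar> + norm x + 1))"
  have nb: "norm b = 1" using assms(2) by simp
  have "norm (a *\<^sub>R b) \<le> norm (x + a *\<^sub>R b) + norm x"
    by (metis add_diff_cancel_left' norm_triangle_ineq4)
  then have "\<bar>a\<bar> - norm x \<le> norm (x + a *\<^sub>R b)" using nb by simp
  moreover have "\<bar>a\<bar> \<ge> \<bar>B\<bar> + norm x + 1" unfolding a_def by (auto simp: min_def abs_if)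
  ultimately have "x + a *\<^sub>R b \<notin> K" using B[of "x + a *\<^sub>R b"] by auto
  then have a0: "\<phi> (x + a *\<^sub>R b) = 0" by (rule K)
  have sp: "smooth (partial b \<phi>)" using K assms by (simp add: smooth_partial)
  have "has_bochner_integral lborel (\<lambda>s. partial b \<phi> (x + s *\<^sub>R b) * indicator {a..t} s)
      (\<phi> (x + t *\<^sub>R b) - \<phi> (x + a *\<^sub>R b))"
  proof (rule has_bochner_integral_FTC_Icc_real)
    show "a \<le> t" by (simp add: a_def)
    show "DERIV (\<lambda>t. \<phi> (x + t *\<^sub>R b)) s :> partial b \<phi> (x + s *\<^sub>R b)" for s
      by (rule smooth_line_derivative[OF K(1)])
    show "isCont (\<lambda>s. partial b \<phi> (x + s *\<^sub>R b)) s" for s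
      using smooth_line_derivative[OF sp] DERIV_isCont by blast
  qed
  then have I: "integrable lborel (\<lambda>s. partial b \<phi> (x + s *\<^sub>R b) * indicator {a..t} s)"
    "(LINT s|lborel. partial b \<phi> (x + s *\<^sub>R b) * indicator {a..t} s) = \<phi> (x + t *\<^sub>R b)"
    using a0 by (auto simp: has_bochner_integral_iff)
  have "ennreal \<bar>\<phi> (x + t *\<^sub>R b)\<bar> \<le> (\<integral>\<^sup>+s. ennreal (norm (partial b \<phi> (x + s *\<^sub>R b) * indicator {a..t} s)) \<partial>lborel)"
    using integral_norm_bound_ennreal[OF I(1)] by (simp add: I(2))
  also have "\<dots> \<le> (\<integral>\<^sup>+s. ennreal \<bar>partial b \<phi> (x + s *\<^sub>R b)\<bar> \<partial>lborel)"
    by (intro nn_integral_mono ennreal_leI) (auto simp: indicator_def)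
  finally show ?thesis .
qed

text \<open>The integral over the affine slice through \<open>c\<close> spanned by \<open>A\<close>.
  The base point makes the recursion over basis vectors go through, since integrating in one more
  direction moves \<open>c\<close>. The purpose is to write \<open>lborel\<close> as iterated
  integrals in dimensions 1 to 3.\<close>

definition coord_nn_integral :: "'a::euclidean_space set \<Rightarrow> ('a \<Rightarrow> ennreal) \<Rightarrow> 'a \<Rightarrow> ennreal" where
  "coord_nn_integral A f c = (\<integral>\<^sup>+g. f (c + (\<Sum>b\<in>A. g b *\<^sub>R b)) \<partial>(\<Pi>\<^sub>M b\<in>A. lborel))"

lemma coord_nn_integral_empty: "coord_nn_integral {} f c = f c"
proof -
  interpret product_sigma_finite "\<lambda>_::'a. lborel :: real measure" by standard
  show ?thesis by (simp add: coord_nn_integral_def PiM_empty nn_integral_count_space_finite)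
qed

lemma coord_nn_integral_insert:
  assumes "finite A" "a \<notin> A" and [measurable]: "f \<in> borel_measurable borel"
  shows "coord_nn_integral (insert a A) f c = (\<integral>\<^sup>+t. coord_nn_integral A f (c + t *\<^sub>R a) \<partial>lborel)"
proof -
  interpret product_sigma_finite "\<lambda>_::'a. lborel :: real measure" by standard
  have [measurable]: "(\<lambda>g. c + (\<Sum>b\<in>insert a A. g b *\<^sub>R b)) \<in> borel_measurable (\<Pi>\<^sub>M b\<in>insert a A. (lborel :: real measure))" for c :: 'a
    by measurable
  have sum: "(\<Sum>b\<in>insert a A. (x(a := t)) b *\<^sub>R b) = t *\<^sub>R a + (\<Sum>b\<in>A. x b *\<^sub>R b)" for x :: "'a \<Rightarrow> real" and t
  proof -
    have "(\<Sum>b\<in>A. (x(a := t)) b *\<^sub>R b) = (\<Sum>b\<in>A. x b *\<^sub>R b)"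
      using assms(2) by (intro sum.cong) auto
    then show ?thesis using assms by (simp add: sum.insert)
  qed
  show ?thesis
    unfolding coord_nn_integral_def
    by (subst product_nn_integral_insert_rev[OF assms(1,2)]) (measurable, simp only: sum add.assoc)
qed

lemma nn_integral_lborel_coord:
  fixes f :: "'a::euclidean_space \<Rightarrow> ennreal"
  assumes [measurable]: "f \<in> borel_measurable borel"
  shows "(\<integral>\<^sup>+x. f x \<partial>lborel) = coord_nn_integral Basis f 0"
  unfolding coord_nn_integral_def
  by (subst lborel_eq, subst nn_integral_distr) simp_all

lemma nn_integral_lborel_1:
  fixes f :: "'a::euclidean_space \<Rightarrow> ennreal"
  assumes "f \<in> borel_measurable borel" "Basis = {a}"
  shows "(\<integral>\<^sup>+x. f x \<partial>lborel) = (\<integral>\<^sup>+s. f (s *\<^sub>R a) \<partial>lborel)"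
  unfolding nn_integral_lborel_coord[OF assms(1)] assms(2)
  using assms(1) by (simp add: coord_nn_integral_insert coord_nn_integral_empty)

lemma nn_integral_lborel_2:
  fixes f :: "'a::euclidean_space \<Rightarrow> ennreal"
  assumes "f \<in> borel_measurable borel" "Basis = {a, b}" "a \<noteq> b"
  shows "(\<integral>\<^sup>+x. f x \<partial>lborel) = (\<integral>\<^sup>+s. \<integral>\<^sup>+t. f (s *\<^sub>R a + t *\<^sub>R b) \<partial>lborel \<partial>lborel)"
  unfolding nn_integral_lborel_coord[OF assms(1)] assms(2)
  using assms(1,3-) by (simp add: coord_nn_integral_insert coord_nn_integral_empty)

lemma nn_integral_lborel_3:
  fixes f :: "'a::euclidean_space \<Rightarrow> ennreal"
  assumes "f \<in> borel_measurable borel" "Basis = {a, b, c}" "a \<noteq> b" "a \<noteq> c" "b \<noteq> c"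
  shows "(\<integral>\<^sup>+x. f x \<partial>lborel) = (\<integral>\<^sup>+r. \<integral>\<^sup>+s. \<integral>\<^sup>+t. f (r *\<^sub>R a + s *\<^sub>R b + t *\<^sub>R c) \<partial>lborel \<partial>lborel \<partial>lborel)"
  unfolding nn_integral_lborel_coord[OF assms(1)] assms(2)
  using assms(1,3-) by (simp add: coord_nn_integral_insert coord_nn_integral_empty)

lemma ennreal_power2_le_imp_le:
  fixes a b :: ennreal
  assumes "a\<^sup>2 \<le> b\<^sup>2"
  shows "a \<le> b"
proof (cases "b = top")
  case False
  then obtain y where y: "b = ennreal y" "0 \<le> y" by (cases b) auto
  have "a \<noteq> top"
  proof
    assume "a = top"
    with assms y show False by (simp add: ennreal_power power2_eq_square[of "top :: ennreal"] top_unique)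
  qed
  then obtain x where x: "a = ennreal x" "0 \<le> x" by (cases a) auto
  have "x\<^sup>2 \<le> y\<^sup>2" using assms x y by (simp add: ennreal_power)
  then have "x \<le> y" using y(2) by (rule power2_le_imp_le)
  with x y show ?thesis by (simp add: ennreal_leI)
qed simp

text \<open>Cauchy-Schwarz with the geometric mean of \<open>u\<close> and \<open>v\<close>
  expressed through squares, the form that can be iterated over several variables.\<close>

lemma nn_integral_square_le:
  assumes [measurable]: "u \<in> borel_measurable M" "v \<in> borel_measurable M"
    and le: "\<And>x. (h x)\<^sup>2 \<le> u x * v x"
  shows "(\<integral>\<^sup>+x. h x \<partial>M)\<^sup>2 \<le> (\<integral>\<^sup>+x. u x \<partial>M) * (\<integral>\<^sup>+x. v x \<partial>M)"
proof -
  \<comment> \<open>A square root on \<open>ennreal\<close> that sends infinity to infinity, so that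
    squaring undoes it everywhere.\<close>
  define r where "r a = (if a = \<infinity> then \<infinity> else ennreal (sqrt (enn2real a)))" for a :: ennreal
  have r2: "(r a)\<^sup>2 = a" for a
  proof (cases a)
    case (real x)
    then show ?thesis by (simp add: r_def ennreal_power)
  next
    case top
    then show ?thesis by (simp add: r_def power2_eq_square)
  qed
  have [measurable]: "r \<in> borel_measurable borel"
    unfolding r_def by (intro measurable_If) auto
  have "h x \<le> r (u x) * r (v x)" for x
    by (rule ennreal_power2_le_imp_le) (simp add: power_mult_distrib r2 le)
  then have "(\<integral>\<^sup>+x. h x \<partial>M)\<^sup>2 \<le> (\<integral>\<^sup>+x. r (u x) * r (v x) \<partial>M)\<^sup>2"
    by (intro power_mono nn_integral_mono) auto
  also have "\<dots> \<le> (\<integral>\<^sup>+x. (r (u x))\<^sup>2 \<partial>M) * (\<integral>\<^sup>+x. (r (v x))\<^sup>2 \<partial>M)"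
    by (intro Cauchy_Schwarz_nn_integral) measurable
  finally show ?thesis by (simp add: r2)
qed

text \<open>The Loomis-Whitney inequality: each factor misses one of the three variables.
  Cauchy-Schwarz is applied in x, where \<open>F\<close> is constant, then in y, where the integral
  of \<open>G\<close> over x is constant, then in z, where only a constant is left of
  \<open>H\<close>.\<close>

lemma nn_integral_Loomis_Whitney_3:
  fixes h :: "real \<Rightarrow> real \<Rightarrow> real \<Rightarrow> ennreal" and F G H :: "real \<Rightarrow> real \<Rightarrow> ennreal"
  assumes [measurable]: "case_prod F \<in> borel_measurable (borel \<Otimes>\<^sub>M borel)"
    "case_prod G \<in> borel_measurable (borel \<Otimes>\<^sub>M borel)" "case_prod H \<in> borel_measurable (borel \<Otimes>\<^sub>M borel)"
    and le: "\<And>x y z. (h z y x)\<^sup>2 \<le> F z y * G z x * H y x"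
  shows "(\<integral>\<^sup>+z. \<integral>\<^sup>+y. \<integral>\<^sup>+x. h z y x \<partial>lborel \<partial>lborel \<partial>lborel)\<^sup>2
      \<le> (\<integral>\<^sup>+z. \<integral>\<^sup>+y. F z y \<partial>lborel \<partial>lborel) * (\<integral>\<^sup>+z. \<integral>\<^sup>+x. G z x \<partial>lborel \<partial>lborel) * (\<integral>\<^sup>+y. \<integral>\<^sup>+x. H y x \<partial>lborel \<partial>lborel)"
proof -
  define h1 where "h1 z y = (\<integral>\<^sup>+x. h z y x \<partial>lborel)" for z y
  define h2 where "h2 z = (\<integral>\<^sup>+y. h1 z y \<partial>lborel)" for z
  define A where "A z = (\<integral>\<^sup>+x. G z x \<partial>lborel)" for z
  define B where "B y = (\<integral>\<^sup>+x. H y x \<partial>lborel)" for y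
  define C where "C z = (\<integral>\<^sup>+y. F z y \<partial>lborel)" for z
  have [measurable]: "A \<in> borel_measurable borel" "B \<in> borel_measurable borel" "C \<in> borel_measurable borel"
    unfolding A_def B_def C_def by measurable
  have 1: "(h1 z y)\<^sup>2 \<le> F z y * (A z * B y)" for z y
  proof -
    have "(h1 z y)\<^sup>2 \<le> (\<integral>\<^sup>+x. F z y * G z x \<partial>lborel) * (\<integral>\<^sup>+x. H y x \<partial>lborel)"
      unfolding h1_def by (rule nn_integral_square_le) (use le in auto)
    then show ?thesis by (simp add: nn_integral_cmult A_def B_def mult.assoc)
  qed
  have 2: "(h2 z)\<^sup>2 \<le> C z * (A z * (\<integral>\<^sup>+y. B y \<partial>lborel))" for z
  proof -
    have "(h2 z)\<^sup>2 \<le> (\<integral>\<^sup>+y. F z y \<partial>lborel) * (\<integral>\<^sup>+y. A z * B y \<partial>lborel)"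
      unfolding h2_def by (rule nn_integral_square_le) (use 1 in auto)
    then show ?thesis by (simp add: nn_integral_cmult C_def)
  qed
  have "(\<integral>\<^sup>+z. h2 z \<partial>lborel)\<^sup>2 \<le> (\<integral>\<^sup>+z. C z \<partial>lborel) * (\<integral>\<^sup>+z. A z * (\<integral>\<^sup>+y. B y \<partial>lborel) \<partial>lborel)"
    by (rule nn_integral_square_le) (use 2 in auto)
  then show ?thesis by (simp add: nn_integral_multc A_def B_def C_def h2_def h1_def mult.assoc)
qed

lemma smooth_power: "smooth f \<Longrightarrow> smooth (\<lambda>x. f x ^ k)"
  by (induction k) (simp_all add: smooth_const smooth_mult)

lemma test_function_power:
  assumes "\<phi> \<in> test_functions U"
  shows "(\<lambda>x. \<phi> x ^ Suc k) \<in> test_functions U"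
  using test_function_smooth_mult[OF assms smooth_power[OF test_function_smooth[OF assms], of k]]
  by (simp add: mult.commute)

lemma partial_power:
  assumes "smooth f"
  shows "partial b (\<lambda>x. f x ^ Suc k) x = real (Suc k) * f x ^ k * partial b f x"
proof -
  have "(f has_derivative (\<lambda>e. partial e f x)) (at x)"
    by (intro partial_works smooth_differentiable assms)
  from partialI[OF has_derivative_power[OF this, of "Suc k"], of b] show ?thesis
    by (simp add: ac_simps)
qed

text \<open>The derivative of the power is (k + 1) \<phi>^k times the derivative of \<phi>, and
  Cauchy-Schwarz separates the factors. The integral of \<phi>^(2 k) on the right is what the
  Sobolev argument iterates on or cancels.\<close>

lemma nn_integral_partial_power_sq_le:
  fixes \<phi> :: "'a::euclidean_space \<Rightarrow> real"
  assumes "smooth \<phi>" "b \<in> Basis"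
  shows "(\<integral>\<^sup>+x. ennreal \<bar>partial b (\<lambda>x. \<phi> x ^ Suc k) x\<bar> \<partial>lborel)\<^sup>2
    \<le> ennreal ((real (Suc k))\<^sup>2) * (\<integral>\<^sup>+x. ennreal (\<phi> x ^ (2 * k)) \<partial>lborel) * (\<integral>\<^sup>+x. ennreal ((partial b \<phi> x)\<^sup>2) \<partial>lborel)"
proof -
  have [measurable]: "\<phi> \<in> borel_measurable borel" "partial b \<phi> \<in> borel_measurable borel"
    using assms by (auto intro: smooth_measurable smooth_partial)
  have sq: "(ennreal \<bar>partial b (\<lambda>x. \<phi> x ^ Suc k) x\<bar>)\<^sup>2
      = (ennreal ((real (Suc k))\<^sup>2) * ennreal (\<phi> x ^ (2 * k))) * ennreal ((partial b \<phi> x)\<^sup>2)" for x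
  proof -
    have "\<bar>partial b (\<lambda>x. \<phi> x ^ Suc k) x\<bar>\<^sup>2 = (real (Suc k))\<^sup>2 * \<phi> x ^ (2 * k) * (partial b \<phi> x)\<^sup>2"
      by (simp only: partial_power[OF assms(1)] power2_abs power_mult_distrib power_mult[symmetric] mult.commute[of k 2])
    then show ?thesis
      by (simp add: ennreal_power ennreal_mult[symmetric])
  qed
  have "(\<integral>\<^sup>+x. ennreal \<bar>partial b (\<lambda>x. \<phi> x ^ Suc k) x\<bar> \<partial>lborel)\<^sup>2
    \<le> (\<integral>\<^sup>+x. ennreal ((real (Suc k))\<^sup>2) * ennreal (\<phi> x ^ (2 * k)) \<partial>lborel) * (\<integral>\<^sup>+x. ennreal ((partial b \<phi> x)\<^sup>2) \<partial>lborel)"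
    by (rule nn_integral_square_le) (measurable, simp only: sq order_refl)
  then show ?thesis by (simp add: nn_integral_cmult)
qed

lemma ennreal_power_twice: "ennreal (x ^ (2 * m)) = ennreal \<bar>x ^ m\<bar> * ennreal \<bar>x ^ m\<bar>"
proof -
  have "x ^ (2 * m) = \<bar>x ^ m\<bar> * \<bar>x ^ m\<bar>"
    by (simp only: abs_mult_self_eq power_add[symmetric] mult_2)
  then show ?thesis by (simp add: ennreal_mult[symmetric])
qed

lemma test_function_partial_measurable:
  "\<psi> \<in> test_functions U \<Longrightarrow> e \<in> Basis \<Longrightarrow> (\<lambda>x. ennreal \<bar>partial e \<psi> x\<bar>) \<in> borel_measurable borel"
  by (intro measurable_compose[OF _ measurable_ennreal] borel_measurable_abs smooth_measurable smooth_partial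
      test_function_smooth)

lemma test_function_measurable: "\<psi> \<in> test_functions U \<Longrightarrow> \<psi> \<in> borel_measurable borel"
  by (intro smooth_measurable test_function_smooth)

text \<open>In dimension 1 the line integral bounds \<phi>^2 uniformly by \<open>Q\<close>, so two
  of the three factors \<phi>^2 of \<phi>^6 are estimated by a constant.\<close>

lemma sobolev_1:
  fixes \<phi> :: "'a::euclidean_space \<Rightarrow> real"
  assumes "\<phi> \<in> test_functions U" and B: "Basis = {a :: 'a}"
  defines "Q \<equiv> \<integral>\<^sup>+x. ennreal \<bar>partial a (\<lambda>x. \<phi> x ^ 2) x\<bar> \<partial>lborel"
  shows "(\<integral>\<^sup>+x. ennreal (\<phi> x ^ 6) \<partial>lborel) \<le> Q\<^sup>2 * (\<integral>\<^sup>+x. ennreal (\<phi> x ^ 2) \<partial>lborel)"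
proof -
  have t: "(\<lambda>x. \<phi> x ^ 2) \<in> test_functions U" using test_function_power[OF assms(1), of 1] by (simp add: numeral_2_eq_2)
  have a: "a \<in> Basis" unfolding B by simp
  note m = test_function_partial_measurable[OF t a]
  have [measurable]: "\<phi> \<in> borel_measurable borel" by (rule test_function_measurable[OF assms(1)])
  have le: "ennreal (\<phi> x ^ 2) \<le> Q" for x
  proof -
    have x: "x = 0 + (x \<bullet> a) *\<^sub>R a" using euclidean_representation[of x] by (simp add: B)
    have "ennreal \<bar>\<phi> (0 + (x \<bullet> a) *\<^sub>R a) ^ 2\<bar> \<le> (\<integral>\<^sup>+s. ennreal \<bar>partial a (\<lambda>x. \<phi> x ^ 2) (0 + s *\<^sub>R a)\<bar> \<partial>lborel)"
      by (rule test_function_le_line_integral[OF t a])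
    also have "\<dots> = Q" unfolding Q_def nn_integral_lborel_1[OF m B] by simp
    finally show ?thesis using x by simp
  qed
  have "ennreal (\<phi> x ^ 6) \<le> Q\<^sup>2 * ennreal (\<phi> x ^ 2)" for x
  proof -
    have "ennreal (\<phi> x ^ 6) = ennreal (\<phi> x ^ 2) * ennreal (\<phi> x ^ 2) * ennreal (\<phi> x ^ 2)"
      by (simp add: ennreal_mult[symmetric] power_add[symmetric])
    also have "\<dots> \<le> Q * Q * ennreal (\<phi> x ^ 2)" by (intro mult_mono le) auto
    finally show ?thesis by (simp add: power2_eq_square)
  qed
  then have "(\<integral>\<^sup>+x. ennreal (\<phi> x ^ 6) \<partial>lborel) \<le> (\<integral>\<^sup>+x. Q\<^sup>2 * ennreal (\<phi> x ^ 2) \<partial>lborel)"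
    by (intro nn_integral_mono) auto
  then show ?thesis by (simp add: nn_integral_cmult)
qed

text \<open>Ladyzhenskaya's argument: the two factors \<phi>^(k + 1) are bounded by line integrals
  in the two coordinate directions, each depending on the other coordinate alone, so that the double
  integral splits.\<close>

lemma sobolev_2:
  fixes \<phi> :: "'a::euclidean_space \<Rightarrow> real"
  assumes "\<phi> \<in> test_functions U" and B: "Basis = {a, b :: 'a}" "a \<noteq> b"
  shows "(\<integral>\<^sup>+x. ennreal (\<phi> x ^ (2 * Suc k)) \<partial>lborel)
    \<le> (\<integral>\<^sup>+x. ennreal \<bar>partial a (\<lambda>x. \<phi> x ^ Suc k) x\<bar> \<partial>lborel) * (\<integral>\<^sup>+x. ennreal \<bar>partial b (\<lambda>x. \<phi> x ^ Suc k) x\<bar> \<partial>lborel)"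
proof -
  let ?\<psi> = "\<lambda>x. \<phi> x ^ Suc k"
  have t: "?\<psi> \<in> test_functions U" by (rule test_function_power[OF assms(1)])
  have ab: "a \<in> Basis" "b \<in> Basis" unfolding B by simp_all
  define ga where "ga x = ennreal \<bar>partial a ?\<psi> x\<bar>" for x
  define gb where "gb x = ennreal \<bar>partial b ?\<psi> x\<bar>" for x
  have [measurable]: "ga \<in> borel_measurable borel" "gb \<in> borel_measurable borel" "\<phi> \<in> borel_measurable borel"
    unfolding ga_def gb_def
    by (rule test_function_partial_measurable[OF t ab(1)] test_function_partial_measurable[OF t ab(2)]
        test_function_measurable[OF assms(1)])+
  define Fa where "Fa t = (\<integral>\<^sup>+s. ga (s *\<^sub>R a + t *\<^sub>R b) \<partial>lborel)" for t
  define Fb where "Fb s = (\<integral>\<^sup>+t. gb (s *\<^sub>R a + t *\<^sub>R b) \<partial>lborel)" for s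
  have [measurable]: "Fa \<in> borel_measurable borel" "Fb \<in> borel_measurable borel"
    unfolding Fa_def Fb_def by measurable
  have le: "ennreal (\<phi> (s *\<^sub>R a + t *\<^sub>R b) ^ (2 * Suc k)) \<le> Fb s * Fa t" for s t
    unfolding ennreal_power_twice Fa_def Fb_def ga_def gb_def
    using test_function_le_line_integral[OF t ab(1), of "t *\<^sub>R b" s] test_function_le_line_integral[OF t ab(2), of "s *\<^sub>R a" t]
    by (intro mult_mono) (simp_all add: add.commute)
  have "(\<integral>\<^sup>+x. ennreal (\<phi> x ^ (2 * Suc k)) \<partial>lborel)
      = (\<integral>\<^sup>+s. \<integral>\<^sup>+t. ennreal (\<phi> (s *\<^sub>R a + t *\<^sub>R b) ^ (2 * Suc k)) \<partial>lborel \<partial>lborel)"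
    by (rule nn_integral_lborel_2[OF _ B]) measurable
  also have "\<dots> \<le> (\<integral>\<^sup>+s. \<integral>\<^sup>+t. Fb s * Fa t \<partial>lborel \<partial>lborel)"
    by (intro nn_integral_mono le)
  also have "\<dots> = (\<integral>\<^sup>+s. Fb s \<partial>lborel) * (\<integral>\<^sup>+t. Fa t \<partial>lborel)"
    by (simp add: nn_integral_cmult nn_integral_multc)
  also have "(\<integral>\<^sup>+s. Fb s \<partial>lborel) = (\<integral>\<^sup>+x. gb x \<partial>lborel)"
    unfolding Fb_def by (rule nn_integral_lborel_2[OF _ B, symmetric]) measurable
  also have "(\<integral>\<^sup>+t. Fa t \<partial>lborel) = (\<integral>\<^sup>+x. ga x \<partial>lborel)"
  proof -
    have "(\<integral>\<^sup>+x. ga x \<partial>lborel) = (\<integral>\<^sup>+t. \<integral>\<^sup>+s. ga (t *\<^sub>R b + s *\<^sub>R a) \<partial>lborel \<partial>lborel)"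
      by (rule nn_integral_lborel_2) (use B in \<open>auto simp: insert_commute\<close>)
    then show ?thesis by (simp add: Fa_def add.commute)
  qed
  finally show ?thesis by (simp add: ga_def gb_def mult.commute)
qed

text \<open>The exponent 4 is dictated by the three directions: the product of three line bounds for
  \<phi>^4 controls \<phi>^12, the square of the integrand \<phi>^6, which is the hypothesis of the
  Loomis-Whitney inequality.\<close>

lemma sobolev_3:
  fixes \<phi> :: "'a::euclidean_space \<Rightarrow> real"
  assumes "\<phi> \<in> test_functions U" and B: "Basis = {c, b, a :: 'a}" and ne: "c \<noteq> b" "c \<noteq> a" "b \<noteq> a"
  defines "P \<equiv> \<lambda>e. (\<integral>\<^sup>+x. ennreal \<bar>partial e (\<lambda>x. \<phi> x ^ 4) x\<bar> \<partial>lborel)"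
  shows "(\<integral>\<^sup>+x. ennreal (\<phi> x ^ 6) \<partial>lborel)\<^sup>2 \<le> P a * P b * P c"
proof -
  let ?\<psi> = "\<lambda>x. \<phi> x ^ 4"
  have t: "?\<psi> \<in> test_functions U" using test_function_power[OF assms(1), of 3] by (simp add: numeral_eq_Suc)
  have abc: "a \<in> Basis" "b \<in> Basis" "c \<in> Basis" unfolding B by simp_all
  define g where "g e x = ennreal \<bar>partial e ?\<psi> x\<bar>" for e x
  have gm: "g e \<in> borel_measurable borel" if "e \<in> Basis" for e
    unfolding g_def by (rule test_function_partial_measurable[OF t that])
  note [measurable] = gm[OF abc(1)] gm[OF abc(2)] gm[OF abc(3)]
  have [measurable]: "\<phi> \<in> borel_measurable borel" by (rule test_function_measurable[OF assms(1)])
  define F where "F z y = (\<integral>\<^sup>+x. g a (z *\<^sub>R c + y *\<^sub>R b + x *\<^sub>R a) \<partial>lborel)" for z y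
  define G where "G z x = (\<integral>\<^sup>+y. g b (z *\<^sub>R c + x *\<^sub>R a + y *\<^sub>R b) \<partial>lborel)" for z x
  define H where "H y x = (\<integral>\<^sup>+z. g c (y *\<^sub>R b + x *\<^sub>R a + z *\<^sub>R c) \<partial>lborel)" for y x
  have m: "case_prod F \<in> borel_measurable (borel \<Otimes>\<^sub>M borel)" "case_prod G \<in> borel_measurable (borel \<Otimes>\<^sub>M borel)"
    "case_prod H \<in> borel_measurable (borel \<Otimes>\<^sub>M borel)"
    unfolding F_def G_def H_def by measurable
  have le: "(ennreal (\<phi> (z *\<^sub>R c + y *\<^sub>R b + x *\<^sub>R a) ^ 6))\<^sup>2 \<le> F z y * G z x * H y x" for x y z
  proof -
    let ?p = "z *\<^sub>R c + y *\<^sub>R b + x *\<^sub>R a"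
    have p: "?p = z *\<^sub>R c + x *\<^sub>R a + y *\<^sub>R b" "?p = y *\<^sub>R b + x *\<^sub>R a + z *\<^sub>R c" by (simp_all add: ac_simps)
    have 1: "ennreal \<bar>?\<psi> ?p\<bar> \<le> F z y"
      unfolding F_def g_def by (rule test_function_le_line_integral[OF t abc(1)])
    have 2: "ennreal \<bar>?\<psi> ?p\<bar> \<le> G z x"
      unfolding G_def g_def p(1) by (rule test_function_le_line_integral[OF t abc(2)])
    have 3: "ennreal \<bar>?\<psi> ?p\<bar> \<le> H y x"
      unfolding H_def g_def p(2) by (rule test_function_le_line_integral[OF t abc(3)])
    have "(ennreal (\<phi> ?p ^ 6))\<^sup>2 = ennreal \<bar>?\<psi> ?p\<bar> * ennreal \<bar>?\<psi> ?p\<bar> * ennreal \<bar>?\<psi> ?p\<bar>"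
      by (simp add: ennreal_mult[symmetric] ennreal_power power_add[symmetric] power_mult[symmetric])
    also have "\<dots> \<le> F z y * G z x * H y x" by (intro mult_mono 1 2 3) auto
    finally show ?thesis .
  qed
  have "(\<integral>\<^sup>+x. ennreal (\<phi> x ^ 6) \<partial>lborel)
      = (\<integral>\<^sup>+z. \<integral>\<^sup>+y. \<integral>\<^sup>+x. ennreal (\<phi> (z *\<^sub>R c + y *\<^sub>R b + x *\<^sub>R a) ^ 6) \<partial>lborel \<partial>lborel \<partial>lborel)"
    by (rule nn_integral_lborel_3[OF _ B]) (measurable, use ne in auto)
  then have "(\<integral>\<^sup>+x. ennreal (\<phi> x ^ 6) \<partial>lborel)\<^sup>2
      \<le> (\<integral>\<^sup>+z. \<integral>\<^sup>+y. F z y \<partial>lborel \<partial>lborel) * (\<integral>\<^sup>+z. \<integral>\<^sup>+x. G z x \<partial>lborel \<partial>lborel) * (\<integral>\<^sup>+y. \<integral>\<^sup>+x. H y x \<partial>lborel \<partial>lborel)"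
    using nn_integral_Loomis_Whitney_3[OF m, of "\<lambda>z y x. ennreal (\<phi> (z *\<^sub>R c + y *\<^sub>R b + x *\<^sub>R a) ^ 6)"] le by simp
  moreover have "(\<integral>\<^sup>+z. \<integral>\<^sup>+y. F z y \<partial>lborel \<partial>lborel) = P a"
    unfolding F_def P_def g_def[symmetric] using B ne abc gm by (intro nn_integral_lborel_3[symmetric]) auto
  moreover have "(\<integral>\<^sup>+z. \<integral>\<^sup>+x. G z x \<partial>lborel \<partial>lborel) = P b"
    unfolding G_def P_def g_def[symmetric] using B ne abc gm by (intro nn_integral_lborel_3[symmetric]) auto
  moreover have "(\<integral>\<^sup>+y. \<integral>\<^sup>+x. H y x \<partial>lborel \<partial>lborel) = P c"
    unfolding H_def P_def g_def[symmetric] using B ne abc gm by (intro nn_integral_lborel_3[symmetric]) auto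
  ultimately show ?thesis by simp
qed

text \<open>Dimensions 1, 2 and 3 give the constants 4, 36 = 4 * 9 and 4096 = 16^3; the largest
  serves for all.\<close>

lemma sobolev_L6_test_function:
  fixes \<phi> :: "'a::euclidean_space \<Rightarrow> real"
  assumes "\<phi> \<in> test_functions U" and dim: "DIM('a) \<le> 3"
  defines "N \<equiv> (\<integral>\<^sup>+x. ennreal (\<phi> x ^ 2) \<partial>lborel) + (\<Sum>b\<in>Basis. \<integral>\<^sup>+x. ennreal ((partial b \<phi> x)\<^sup>2) \<partial>lborel)"
  shows "(\<integral>\<^sup>+x. ennreal (\<phi> x ^ 6) \<partial>lborel) \<le> 4096 * N ^ 3"
proof -
  define S where "S k = (\<integral>\<^sup>+x. ennreal (\<phi> x ^ (2 * k)) \<partial>lborel)" for k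
  define P where "P k b = (\<integral>\<^sup>+x. ennreal \<bar>partial b (\<lambda>x. \<phi> x ^ Suc k) x\<bar> \<partial>lborel)" for k b
  have sm: "smooth \<phi>" using assms(1) by (rule test_function_smooth)
  have S1: "S 1 \<le> N" by (simp add: S_def N_def)
  have P_le: "(P k b)\<^sup>2 \<le> ennreal ((real (Suc k))\<^sup>2) * S k * N" if "b \<in> Basis" for k b
  proof -
    have "(\<integral>\<^sup>+x. ennreal ((partial b \<phi> x)\<^sup>2) \<partial>lborel) \<le> (\<Sum>b\<in>Basis. \<integral>\<^sup>+x. ennreal ((partial b \<phi> x)\<^sup>2) \<partial>lborel)"
      using that by (intro member_le_sum) auto
    also have "\<dots> \<le> N" by (simp add: N_def)
    finally have "ennreal ((real (Suc k))\<^sup>2) * S k * (\<integral>\<^sup>+x. ennreal ((partial b \<phi> x)\<^sup>2) \<partial>lborel)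
        \<le> ennreal ((real (Suc k))\<^sup>2) * S k * N"
      by (intro mult_left_mono) auto
    with nn_integral_partial_power_sq_le[OF sm that, of k] show ?thesis unfolding P_def S_def
      by (rule order_trans)
  qed
  have "S 3 \<le> 4096 * N ^ 3"
  proof -
    have "DIM('a) > 0" by simp
    with dim consider "card (Basis :: 'a set) = 1" | "card (Basis :: 'a set) = 2" | "card (Basis :: 'a set) = 3"
      by linarith
    then show ?thesis
    proof cases
      case 1
      then obtain a :: 'a where B: "Basis = {a}" by (auto simp: card_1_singleton_iff)
      have "S 3 \<le> (P 1 a)\<^sup>2 * S 1"
        using sobolev_1[OF assms(1) B] by (simp add: S_def P_def numeral_2_eq_2)
      also have "\<dots> \<le> (4 * N * N) * N"
      proof (intro mult_mono S1)
        have "(P 1 a)\<^sup>2 \<le> 4 * S 1 * N" using P_le[of a 1] unfolding B by simp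
        also have "\<dots> \<le> 4 * N * N" by (intro mult_mono S1) auto
        finally show "(P 1 a)\<^sup>2 \<le> 4 * N * N" .
      qed auto
      also have "\<dots> = 4 * N ^ 3" by (simp add: power3_eq_cube mult.assoc)
      also have "\<dots> \<le> 4096 * N ^ 3" by (intro mult_right_mono) auto
      finally show ?thesis .
    next
      case 2
      then obtain a b :: 'a where B: "Basis = {a, b}" "a \<noteq> b" by (auto simp: card_2_iff)
      have prod: "(S (Suc k))\<^sup>2 \<le> (ennreal ((real (Suc k))\<^sup>2) * S k * N)\<^sup>2" for k
      proof -
        have "(S (Suc k))\<^sup>2 \<le> (P k a * P k b)\<^sup>2"
          using sobolev_2[OF assms(1) B, of k] unfolding S_def P_def by (rule power_mono) simp
        also have "\<dots> = (P k a)\<^sup>2 * (P k b)\<^sup>2" by (simp add: power_mult_distrib)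
        also have "\<dots> \<le> (ennreal ((real (Suc k))\<^sup>2) * S k * N) * (ennreal ((real (Suc k))\<^sup>2) * S k * N)"
          by (intro mult_mono P_le) (unfold B, simp_all)
        finally show ?thesis by (simp add: power2_eq_square)
      qed
      \<comment> \<open>Two rounds of the planar estimate: from \<phi>^2 to \<phi>^4 with factor 4,
        from \<phi>^4 to \<phi>^6 with factor 9.\<close>
      have "S (Suc 1) \<le> ennreal ((real (Suc 1))\<^sup>2) * S 1 * N"
        by (rule ennreal_power2_le_imp_le[OF prod])
      also have "\<dots> \<le> ennreal ((real (Suc 1))\<^sup>2) * N * N" by (intro mult_mono S1) auto
      finally have S2: "S 2 \<le> 4 * N * N" by (simp add: numeral_2_eq_2[symmetric])
      have "S (Suc 2) \<le> ennreal ((real (Suc 2))\<^sup>2) * S 2 * N"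
        by (rule ennreal_power2_le_imp_le[OF prod])
      also have "\<dots> = 9 * S 2 * N" by simp
      also have "\<dots> \<le> 9 * (4 * N * N) * N" by (intro mult_mono S2) auto
      also have "\<dots> = 9 * 4 * N ^ 3" by (simp only: power3_eq_cube mult.assoc)
      also have "\<dots> \<le> 4096 * N ^ 3" by (intro mult_right_mono) auto
      finally show ?thesis by simp
    next
      case 3
      then obtain a b c :: 'a where B: "Basis = {c, b, a}" "c \<noteq> b" "c \<noteq> a" "b \<noteq> a" by (auto simp: card_3_iff)
      have "(S 3)\<^sup>2 \<le> P 3 a * P 3 b * P 3 c"
        using sobolev_3[OF assms(1) B] by (simp add: S_def P_def)
      then have "((S 3)\<^sup>2)\<^sup>2 \<le> (P 3 a * P 3 b * P 3 c)\<^sup>2" by (rule power_mono) simp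
      also have "\<dots> = (P 3 a)\<^sup>2 * (P 3 b)\<^sup>2 * (P 3 c)\<^sup>2" by (simp add: power_mult_distrib)
      also have "\<dots> \<le> (16 * S 3 * N) * (16 * S 3 * N) * (16 * S 3 * N)"
        using P_le[of a 3] P_le[of b 3] P_le[of c 3] unfolding B by (intro mult_mono) simp_all
      finally have le: "((S 3)\<^sup>2)\<^sup>2 \<le> (16 * S 3 * N) * (16 * S 3 * N) * (16 * S 3 * N)" .
      \<comment> \<open>The estimate reads S^4 \<le> 4096 S^3 N^3 for S = \<open>S 3\<close>.
        Cancelling S^3 requires S to be finite, which holds for a test function.\<close>
      have "integrable lborel (\<lambda>x. \<phi> x ^ Suc 5)"
        by (rule test_function_integrable[OF test_function_power[OF assms(1)]])
      then have "S 3 < \<infinity>"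
        unfolding S_def integrable_iff_bounded by (simp add: power_abs[symmetric])
      then obtain s where s: "S 3 = ennreal s" "0 \<le> s" by (cases "S 3") auto
      show ?thesis
      proof (cases "N = top")
        case False
        then obtain n where n: "N = ennreal n" "0 \<le> n" by (cases N) auto
        have e: "16 * S 3 * N = ennreal (16 * s * n)"
          using s n by (simp add: ennreal_mult)
        have "ennreal ((s\<^sup>2)\<^sup>2) \<le> ennreal ((16 * s * n) * (16 * s * n) * (16 * s * n))"
        proof -
          have "ennreal ((s\<^sup>2)\<^sup>2) = ((S 3)\<^sup>2)\<^sup>2" using s by (simp add: ennreal_power)
          moreover have "ennreal ((16 * s * n) * (16 * s * n) * (16 * s * n)) = (16 * S 3 * N) * (16 * S 3 * N) * (16 * S 3 * N)"
            unfolding e using s n by (subst ennreal_mult; (subst ennreal_mult)?; simp)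
          ultimately show ?thesis using le by simp
        qed
        then have "(s\<^sup>2)\<^sup>2 \<le> (16 * s * n) * (16 * s * n) * (16 * s * n)"
          using s n by (subst (asm) ennreal_le_iff) auto
        then have "s ^ 3 * s \<le> s ^ 3 * (4096 * n ^ 3)"
          by (simp add: power2_eq_square power3_eq_cube mult_ac)
        then have "s \<le> 4096 * n ^ 3"
          using s(2) n(2) by (cases "s = 0") (auto simp: mult_le_cancel_left_pos)
        then have "ennreal s \<le> ennreal (4096 * n ^ 3)" by (rule ennreal_leI)
        then show ?thesis
          using n s by (simp add: ennreal_mult ennreal_power)
      next
        case True
        then show ?thesis by (simp add: power3_eq_cube ennreal_mult_top)
      qed
    qed
  qed
  then show ?thesis by (simp add: S_def)
qed

section \<open>The embedding for H10 and the quintic nonlinearity\<close>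

lemma sum_Basis_axis: "(\<Sum>b\<in>(Basis :: (real ^ 'n::finite) set). f b) = (\<Sum>i\<in>UNIV. f (axis i 1))"
proof -
  have B: "(Basis :: (real ^ 'n) set) = (\<lambda>i. axis i 1) ` UNIV" by (auto simp: Basis_vec_def)
  have I: "inj (\<lambda>i :: 'n. axis i (1 :: real))" by (auto simp: inj_on_def axis_eq_axis)
  show ?thesis unfolding B by (subst sum.reindex[OF I]) (simp add: comp_def)
qed

lemma H1_norm_square: "(H1_norm \<Omega> u)\<^sup>2 = (L2_norm \<Omega> u)\<^sup>2 + (\<Sum>i\<in>UNIV. (L2_norm \<Omega> (weak_partial \<Omega> i u))\<^sup>2)"
  by (simp add: H1_norm_def sum_nonneg)

context bounded_open_set
begin

lemma test_function_nn_integral_square: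
  assumes "\<phi> \<in> test_functions \<Omega>"
  shows "(\<integral>\<^sup>+x. ennreal ((\<phi> x)\<^sup>2) \<partial>lborel) = ennreal ((L2_norm \<Omega> \<phi>)\<^sup>2)"
proof -
  have t: "(\<lambda>x. (\<phi> x)\<^sup>2) \<in> test_functions \<Omega>"
    using test_function_power[OF assms, of 1] by (simp add: numeral_2_eq_2)
  have "(\<integral>\<^sup>+x. ennreal ((\<phi> x)\<^sup>2) \<partial>lborel) = ennreal (LINT x|lborel. (\<phi> x)\<^sup>2)"
    by (intro nn_integral_eq_integral test_function_integrable[OF t]) auto
  also have "(LINT x|lborel. (\<phi> x)\<^sup>2) = (LINT x|lebesgue_on \<Omega>. (\<phi> x)\<^sup>2)"
    using test_function_outside[OF t]
    by (intro integral_lebesgue_on_eq_lborel[OF open_\<Omega>, symmetric] test_function_measurable[OF t]) auto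
  also have "\<dots> = (L2_norm \<Omega> \<phi>)\<^sup>2"
    unfolding L2_norm_square L2_inner_def by (simp add: power2_eq_square)
  finally show ?thesis .
qed

lemma sobolev_L6_H1_norm:
  assumes "\<phi> \<in> test_functions \<Omega>" "CARD('n) \<le> 3"
  shows "(\<integral>\<^sup>+x. ennreal (\<phi> x ^ 6) \<partial>lborel) \<le> ennreal (4096 * (H1_norm \<Omega> \<phi>) ^ 6)"
proof -
  have "(L2_norm \<Omega> (partial (axis i 1) \<phi>))\<^sup>2 = (L2_norm \<Omega> (weak_partial \<Omega> i \<phi>))\<^sup>2" for i
    using weak_partial_AE_eq[OF smooth_has_weak_partial[OF test_function_smooth[OF assms(1)]]]
      H1_D(3)[OF smooth_H1[OF test_function_smooth[OF assms(1)]]] test_function_partial_L2[OF assms(1)]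
    by (subst L2_norm_cong_AE) auto
  then have "(\<integral>\<^sup>+x. ennreal ((partial (axis i 1) \<phi> x)\<^sup>2) \<partial>lborel) = ennreal ((L2_norm \<Omega> (weak_partial \<Omega> i \<phi>))\<^sup>2)" for i
    using test_function_nn_integral_square[OF test_function_partial[OF assms(1) axis_one_Basis]] by simp
  then have N: "(\<integral>\<^sup>+x. ennreal (\<phi> x ^ 2) \<partial>lborel) + (\<Sum>b\<in>Basis. \<integral>\<^sup>+x. ennreal ((partial b \<phi> x)\<^sup>2) \<partial>lborel)
      = ennreal ((H1_norm \<Omega> \<phi>)\<^sup>2)"
    by (simp add: sum_Basis_axis test_function_nn_integral_square[OF assms(1)] H1_norm_square sum_nonneg sum_ennreal)
  have "(\<integral>\<^sup>+x. ennreal (\<phi> x ^ 6) \<partial>lborel) \<le> 4096 * (ennreal ((H1_norm \<Omega> \<phi>)\<^sup>2)) ^ 3"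
    using sobolev_L6_test_function[OF assms(1)] assms(2) unfolding N by simp
  also have "\<dots> = ennreal (4096 * (H1_norm \<Omega> \<phi>) ^ 6)"
    by (simp add: ennreal_power ennreal_mult power_mult[symmetric])
  finally show ?thesis .
qed

text \<open>Approximating test functions have bounded \<open>H1_norm\<close>, hence uniformly
  bounded integrals of the sixth power; a subsequence converges almost everywhere and Fatou's lemma
  passes the bound to the limit.\<close>

lemma H10_L6:
  assumes "u \<in> H10 \<Omega>" "CARD('n) \<le> 3"
  shows "integrable (lebesgue_on \<Omega>) (\<lambda>x. u x ^ 6)"
proof -
  have "\<exists>\<phi>\<in>test_functions \<Omega>. H1_norm \<Omega> (u - \<phi>) < 1 / real (Suc k)" for k
    using assms(1) by (simp add: H10_def)
  then obtain \<phi> where \<phi>: "\<And>k. \<phi> k \<in> test_functions \<Omega>" "\<And>k. H1_norm \<Omega> (u - \<phi> k) < 1 / real (Suc k)"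
    by metis
  have u: "u \<in> H1 \<Omega>" "u \<in> L2 \<Omega>" using assms(1) by (auto dest: H10_D)
  have \<phi>1: "\<phi> k \<in> H1 \<Omega>" "\<phi> k \<in> L2 \<Omega>" for k
    using \<phi>(1) by (auto intro: smooth_H1 test_function_smooth test_function_L2)
  have bound: "H1_norm \<Omega> (\<phi> k) \<le> H1_norm \<Omega> u + 1" for k
  proof -
    have "H1_norm \<Omega> (\<lambda>x. 1 * u x + (-1) * (u - \<phi> k) x) \<le> \<bar>1\<bar> * H1_norm \<Omega> u + \<bar>-1\<bar> * H1_norm \<Omega> (u - \<phi> k)"
      by (intro H1_norm_lincomb_le u) (simp add: fun_diff_def H1_diff u \<phi>1)
    moreover have "1 / real (Suc k) \<le> 1" by simp
    then have "H1_norm \<Omega> (u - \<phi> k) \<le> 1" using \<phi>(2)[of k] by linarith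
    ultimately show ?thesis by simp
  qed
  have sq: "(\<lambda>x. (u x - \<phi> k x)\<^sup>2) \<in> borel_measurable (lebesgue_on \<Omega>)" "integrable (lebesgue_on \<Omega>) (\<lambda>x. (u x - \<phi> k x)\<^sup>2)" for k
    using L2D(2)[OF L2_diff[OF u(2) \<phi>1(2)]] by auto
  have "(\<lambda>k. LINT x|lebesgue_on \<Omega>. norm ((u x - \<phi> k x)\<^sup>2)) \<longlonglongrightarrow> 0"
  proof (rule tendsto_sandwich[of "\<lambda>k. 0" _ _ "\<lambda>k. (1 / real (Suc k))\<^sup>2"])
    have "(LINT x|lebesgue_on \<Omega>. norm ((u x - \<phi> k x)\<^sup>2)) \<le> (1 / real (Suc k))\<^sup>2" for k
    proof -
      have "(LINT x|lebesgue_on \<Omega>. norm ((u x - \<phi> k x)\<^sup>2)) = (L2_norm \<Omega> (u - \<phi> k))\<^sup>2"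
        unfolding L2_norm_square L2_inner_def by (simp add: power2_eq_square)
      also have "\<dots> \<le> (1 / real (Suc k))\<^sup>2"
        using L2_norm_le_H1_norm[of \<Omega> "u - \<phi> k"] \<phi>(2)[of k] by (intro power_mono) auto
      finally show ?thesis .
    qed
    then show "\<forall>\<^sub>F k in sequentially. (LINT x|lebesgue_on \<Omega>. norm ((u x - \<phi> k x)\<^sup>2)) \<le> (1 / real (Suc k))\<^sup>2" by simp
    have "(\<lambda>k. (1 / real (Suc k))\<^sup>2) \<longlonglongrightarrow> 0\<^sup>2" by (intro tendsto_power LIMSEQ_Suc[OF lim_1_over_n])
    then show "(\<lambda>k. (1 / real (Suc k))\<^sup>2) \<longlonglongrightarrow> 0" by simp
  qed auto
  from tendsto_L1_AE_subseq[OF sq(2) this] obtain r :: "nat \<Rightarrow> nat" where r: "strict_mono r"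
    "AE x in lebesgue_on \<Omega>. (\<lambda>k. (u x - \<phi> (r k) x)\<^sup>2) \<longlonglongrightarrow> 0"
    by blast
  have lim: "AE x in lebesgue_on \<Omega>. (\<lambda>k. ennreal (\<phi> (r k) x ^ 6)) \<longlonglongrightarrow> ennreal (u x ^ 6)"
    using r(2)
  proof eventually_elim
    case (elim x)
    then have "(\<lambda>k. u x - \<phi> (r k) x) \<longlonglongrightarrow> 0" by simp
    then have "(\<lambda>k. u x - (u x - \<phi> (r k) x)) \<longlonglongrightarrow> u x - 0" by (intro tendsto_diff tendsto_const)
    then show ?case by (intro tendsto_ennrealI tendsto_power) simp
  qed
  have [measurable]: "\<phi> k \<in> borel_measurable (lebesgue_on \<Omega>)" "u \<in> borel_measurable (lebesgue_on \<Omega>)" for k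
    using u \<phi>1 by (auto dest: L2D)
  let ?B = "ennreal (4096 * (H1_norm \<Omega> u + 1) ^ 6)"
  have "(\<integral>\<^sup>+x. ennreal (\<phi> k x ^ 6) \<partial>lebesgue_on \<Omega>) \<le> ?B" for k
  proof -
    have "(\<integral>\<^sup>+x. ennreal (\<phi> k x ^ 6) \<partial>lebesgue_on \<Omega>) \<le> (\<integral>\<^sup>+x. ennreal (\<phi> k x ^ 6) \<partial>lebesgue)"
      by (subst nn_integral_restrict_space) (auto intro!: nn_integral_mono simp: indicator_def)
    also have "\<dots> = (\<integral>\<^sup>+x. ennreal (\<phi> k x ^ 6) \<partial>lborel)"
      by (rule nn_integral_completion)
    also have "\<dots> \<le> ennreal (4096 * (H1_norm \<Omega> (\<phi> k)) ^ 6)"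
      by (rule sobolev_L6_H1_norm[OF \<phi>(1) assms(2)])
    also have "\<dots> \<le> ?B"
      using bound by (intro ennreal_leI mult_left_mono power_mono) auto
    finally show ?thesis .
  qed
  then have "liminf (\<lambda>k. \<integral>\<^sup>+x. ennreal (\<phi> (r k) x ^ 6) \<partial>lebesgue_on \<Omega>) \<le> ?B"
    by (intro Liminf_le) auto
  moreover have "(\<integral>\<^sup>+x. ennreal (u x ^ 6) \<partial>lebesgue_on \<Omega>) = (\<integral>\<^sup>+x. liminf (\<lambda>k. ennreal (\<phi> (r k) x ^ 6)) \<partial>lebesgue_on \<Omega>)"
  proof (rule nn_integral_cong_AE)
    show "AE x in lebesgue_on \<Omega>. ennreal (u x ^ 6) = liminf (\<lambda>k. ennreal (\<phi> (r k) x ^ 6))"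
      using lim by eventually_elim (simp only: lim_imp_Liminf[OF sequentially_bot])
  qed
  moreover have "\<dots> \<le> liminf (\<lambda>k. \<integral>\<^sup>+x. ennreal (\<phi> (r k) x ^ 6) \<partial>lebesgue_on \<Omega>)"
    by (intro nn_integral_liminf) measurable
  ultimately have "(\<integral>\<^sup>+x. ennreal (u x ^ 6) \<partial>lebesgue_on \<Omega>) \<le> ?B" by simp
  then have "(\<integral>\<^sup>+x. ennreal (u x ^ 6) \<partial>lebesgue_on \<Omega>) < \<infinity>"
    using le_less_trans by fastforce
  then show ?thesis
    by (intro integrableI_nonneg) auto
qed

text \<open>The integrand has total degree at most 6 in \<open>p\<close> and \<open>q\<close>, so it
  is dominated by sixth powers and a constant, and constants are integrable over a bounded
  set.\<close>

lemma H10_quintic_integrable: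
  assumes "p \<in> H10 \<Omega>" "q \<in> H10 \<Omega>" "CARD('n) \<le> 3"
  shows "integrable (lebesgue_on \<Omega>) (\<lambda>x. (2 * \<alpha> + 4 * \<beta> * (p x)\<^sup>2 + 6 * \<gamma> * (p x) ^ 4) * p x * q x)"
proof (rule Bochner_Integration.integrable_bound)
  let ?C = "2 * \<bar>\<alpha>\<bar> + 4 * \<bar>\<beta>\<bar> + 6 * \<bar>\<gamma>\<bar>"
  show "integrable (lebesgue_on \<Omega>) (\<lambda>x. ?C * (1 + p x ^ 6 + q x ^ 6))"
    using assms by (intro integrable_mult_right Bochner_Integration.integrable_add H10_L6 integrable_const_\<Omega>)
  have [measurable]: "p \<in> borel_measurable (lebesgue_on \<Omega>)" "q \<in> borel_measurable (lebesgue_on \<Omega>)"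
    using assms by (auto dest: H10_D L2D)
  show "(\<lambda>x. (2 * \<alpha> + 4 * \<beta> * (p x)\<^sup>2 + 6 * \<gamma> * (p x) ^ 4) * p x * q x) \<in> borel_measurable (lebesgue_on \<Omega>)"
    by measurable
  have "\<bar>(2 * \<alpha> + 4 * \<beta> * a\<^sup>2 + 6 * \<gamma> * a ^ 4) * a * b\<bar> \<le> ?C * (1 + a ^ 6 + b ^ 6)" for a b :: real
  proof -
    \<comment> \<open>Every monomial is at most \<open>m ^ 6\<close> because m is at least 1, and
      \<open>m ^ 6\<close> equals one of the summands 1, \<open>a ^ 6\<close>,
      \<open>b ^ 6\<close>.\<close>
    define m where "m = max 1 (max \<bar>a\<bar> \<bar>b\<bar>)"
    have m: "1 \<le> m" "\<bar>a\<bar> \<le> m" "\<bar>b\<bar> \<le> m" by (auto simp: m_def)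
    have pw: "\<bar>a\<bar> ^ k \<le> m ^ 4" if "k \<le> 4" for k
    proof -
      have "\<bar>a\<bar> ^ k \<le> m ^ k" using m by (intro power_mono) auto
      also have "\<dots> \<le> m ^ 4" using m that by (intro power_increasing) auto
      finally show ?thesis .
    qed
    have "\<bar>2 * \<alpha> + 4 * \<beta> * a\<^sup>2 + 6 * \<gamma> * a ^ 4\<bar> \<le> 2 * \<bar>\<alpha>\<bar> * \<bar>a\<bar> ^ 0 + 4 * \<bar>\<beta>\<bar> * \<bar>a\<bar> ^ 2 + 6 * \<bar>\<gamma>\<bar> * \<bar>a\<bar> ^ 4"
      by (rule order_trans[OF abs_triangle_ineq] add_mono order_trans[OF abs_triangle_ineq])+ (auto simp: abs_mult)
    also have "\<dots> \<le> 2 * \<bar>\<alpha>\<bar> * m ^ 4 + 4 * \<bar>\<beta>\<bar> * m ^ 4 + 6 * \<bar>\<gamma>\<bar> * m ^ 4"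
      by (intro add_mono mult_left_mono pw) auto
    also have "\<dots> = ?C * m ^ 4" by (simp add: algebra_simps)
    finally have "\<bar>2 * \<alpha> + 4 * \<beta> * a\<^sup>2 + 6 * \<gamma> * a ^ 4\<bar> * \<bar>a\<bar> * \<bar>b\<bar> \<le> ?C * m ^ 4 * m * m"
      using m by (intro mult_mono) auto
    also have "\<dots> = ?C * m ^ 6" by (simp add: power_add[symmetric] mult.assoc flip: power_Suc2)
    also have "\<dots> \<le> ?C * (1 + a ^ 6 + b ^ 6)"
    proof (intro mult_left_mono)
      have "m = 1 \<or> m = \<bar>a\<bar> \<or> m = \<bar>b\<bar>" by (auto simp: m_def max_def)
      moreover have "0 \<le> a ^ 6" "0 \<le> b ^ 6" by auto
      ultimately show "m ^ 6 \<le> 1 + a ^ 6 + b ^ 6" by (auto simp: power_even_abs)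
    qed auto
    finally show ?thesis by (simp add: abs_mult)
  qed
  then show "AE x in lebesgue_on \<Omega>. norm ((2 * \<alpha> + 4 * \<beta> * (p x)\<^sup>2 + 6 * \<gamma> * (p x) ^ 4) * p x * q x)
      \<le> norm (?C * (1 + p x ^ 6 + q x ^ 6))"
    by (intro AE_I2) (simp add: order_trans[OF _ abs_ge_self])
qed

end

text \<open>After the factor (p - q)^2 is split off, what remains is a polynomial in A = p^2 + q^2
  and t = p q, where |t| \<le> A / 2. For \<gamma> > 0 the part A^2 - t^2 + t A is at least A^2 / 4
  and absorbs a negative \<beta>.\<close>

lemma quintic_one_sided_Lipschitz:
  fixes \<alpha> \<beta> \<gamma> :: real
  assumes "\<gamma> > 0 \<or> (\<gamma> = 0 \<and> \<beta> > 0)"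
  obtains K where "K \<ge> 0" "\<And>p q. ((2 * \<alpha> + 4 * \<beta> * p\<^sup>2 + 6 * \<gamma> * p ^ 4) * p - (2 * \<alpha> + 4 * \<beta> * q\<^sup>2 + 6 * \<gamma> * q ^ 4) * q) * (p - q)
      \<ge> - K * (p - q)\<^sup>2"
proof
  \<comment> \<open>6 \<beta>^2 / \<gamma> is what completing the square leaves. For \<gamma> = 0
    the quotient is 0 by convention, and 2 |\<alpha>| suffices since then \<beta> > 0.\<close>
  define K where "K = 2 * \<bar>\<alpha>\<bar> + 6 * \<beta>\<^sup>2 / \<gamma>"
  show "K \<ge> 0" using assms by (auto simp: K_def)
  fix p q :: real
  define A where "A = p\<^sup>2 + q\<^sup>2"
  define t where "t = p * q"
  have tA: "\<bar>t\<bar> \<le> A / 2"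
    using sum_squares_bound[of "\<bar>p\<bar>" "\<bar>q\<bar>"] by (simp add: t_def A_def abs_mult)
  have "A \<ge> 0" by (simp add: A_def)
  have fact: "((2 * \<alpha> + 4 * \<beta> * p\<^sup>2 + 6 * \<gamma> * p ^ 4) * p - (2 * \<alpha> + 4 * \<beta> * q\<^sup>2 + 6 * \<gamma> * q ^ 4) * q) * (p - q)
      = (2 * \<alpha> + 4 * \<beta> * (A + t) + 6 * \<gamma> * (A\<^sup>2 - t\<^sup>2 + t * A)) * (p - q)\<^sup>2"
    unfolding A_def t_def by algebra
  have "- K \<le> 2 * \<alpha> + 4 * \<beta> * (A + t) + 6 * \<gamma> * (A\<^sup>2 - t\<^sup>2 + t * A)"
  proof (cases "\<gamma> = 0")
    case True
    with assms have "0 \<le> \<beta> * (A + t)" using tA \<open>A \<ge> 0\<close> by (intro mult_nonneg_nonneg) auto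
    with True show ?thesis by (simp add: K_def)
  next
    case False
    with assms have g: "\<gamma> > 0" by auto
    have "A\<^sup>2 - t\<^sup>2 + t * A - A\<^sup>2 / 4 = (A / 2 + t) * (3 * A / 2 - t)"
      by (simp add: power2_eq_square algebra_simps)
    also have "\<dots> \<ge> 0" using tA \<open>A \<ge> 0\<close> by (intro mult_nonneg_nonneg) auto
    finally have 1: "6 * \<gamma> * (A\<^sup>2 / 4) \<le> 6 * \<gamma> * (A\<^sup>2 - t\<^sup>2 + t * A)"
      using g by (intro mult_left_mono) auto
    have "\<bar>\<beta> * (A + t)\<bar> \<le> \<bar>\<beta>\<bar> * (3 * A / 2)"
      unfolding abs_mult using tA by (intro mult_left_mono) auto
    then have 2: "- (6 * \<bar>\<beta>\<bar> * A) \<le> 4 * \<beta> * (A + t)" by linarith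
    \<comment> \<open>Completing the square in A: the minimum of (3 / 2) \<gamma> A^2 - 6 |\<beta>|
      A is - 6 \<beta>^2 / \<gamma>.\<close>
    have "0 \<le> (3 / 2) * \<gamma> * (A - 2 * \<bar>\<beta>\<bar> / \<gamma>)\<^sup>2" using g by simp
    also have "\<dots> = 6 * \<gamma> * (A\<^sup>2 / 4) - 6 * \<bar>\<beta>\<bar> * A + 6 * \<beta>\<^sup>2 / \<gamma>"
      using g by (simp add: power2_eq_square field_simps)
    finally have 3: "- (6 * \<beta>\<^sup>2 / \<gamma>) \<le> 6 * \<gamma> * (A\<^sup>2 / 4) - 6 * \<bar>\<beta>\<bar> * A" by simp
    have "- (2 * \<bar>\<alpha>\<bar>) \<le> 2 * \<alpha>" by linarith
    with 1 2 3 show ?thesis unfolding K_def by linarith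
  qed
  then show "((2 * \<alpha> + 4 * \<beta> * p\<^sup>2 + 6 * \<gamma> * p ^ 4) * p - (2 * \<alpha> + 4 * \<beta> * q\<^sup>2 + 6 * \<gamma> * q ^ 4) * q) * (p - q)
      \<ge> - K * (p - q)\<^sup>2"
    unfolding fact by (intro mult_right_mono) auto
qed

section \<open>The electrostatic potential\<close>

text \<open>The terms of the weak equation other than the time derivative, at one frozen time;
  \<open>r\<close> stands for the charge density at that time. Freezing time makes the dissipation
  estimate purely spatial.\<close>

definition flow_form ::
  "(real ^ 'n) set \<Rightarrow> ('n::finite scalar_field \<Rightarrow> 'n scalar_field) \<Rightarrow> real \<Rightarrow> real \<Rightarrow> real \<Rightarrow> real \<Rightarrow>
   'n scalar_field \<Rightarrow> ('n \<Rightarrow> 'n scalar_field) \<Rightarrow> ('n \<Rightarrow> 'n scalar_field) \<Rightarrow> real" where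
  "flow_form \<Omega> \<Phi> \<alpha> \<beta> \<gamma> g r P q =
     g * (\<Sum>i\<in>UNIV. grad_inner \<Omega> (P i) (q i))
     + (\<Sum>i\<in>UNIV. L2_inner \<Omega> (DF \<alpha> \<beta> \<gamma> P i) (q i))
     + (\<Sum>i\<in>UNIV. L2_inner \<Omega> (weak_partial \<Omega> i (\<Phi> (\<lambda>x. r x - weak_div \<Omega> P x))) (q i))"

text \<open>Only the sigma-algebra matters: \<open>measure_of\<close> makes it the Borel one
  whatever set function is supplied, and restriction and completion preserve measurability.\<close>

lemma smooth_surface_measurable:
  assumes "smooth \<phi>"
  shows "\<phi> \<in> borel_measurable (surface_measure \<Omega>)"
proof -
  have "sets (hausdorff_measure s :: (real ^ 'a) measure) = sets borel" for s
    unfolding hausdorff_measure_def using sets.sigma_sets_eq[of "borel :: (real ^ 'a) measure"]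
    by (subst sets_measure_of) auto
  then have "\<phi> \<in> borel_measurable (hausdorff_measure s)" for s
    using smooth_measurable[OF assms] by (simp cong: measurable_cong_sets)
  then show ?thesis
    unfolding surface_measure_def by (intro measurable_completion measurable_restrict_space1)
qed

lemma solves_poissonD:
  assumes "solves_poisson \<Omega> \<Gamma> \<epsilon> h v"
  shows "v \<in> V_D \<Omega> \<Gamma>" "v \<in> H1 \<Omega>" "w \<in> V_D \<Omega> \<Gamma> \<Longrightarrow> \<epsilon> * grad_inner \<Omega> v w = L2_inner \<Omega> h w"
  using assms by (auto simp: solves_poisson_def V_D_def)

lemma weak_div_L2: "(\<And>i. P i \<in> H1 \<Omega>) \<Longrightarrow> weak_div \<Omega> P \<in> L2 \<Omega>"
  unfolding weak_div_def by (intro L2_sum H1_D)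

context bounded_open_set
begin

text \<open>The approximating smooth sequences are subtracted. The purpose is closure of
  \<open>V_D\<close> under differences, on which linearity of the solution operator rests.\<close>

lemma has_trace_diff:
  assumes "has_trace \<Omega> u \<tau>" "has_trace \<Omega> v \<sigma>" "u \<in> H1 \<Omega>" "v \<in> H1 \<Omega>"
  shows "has_trace \<Omega> (\<lambda>x. u x - v x) (\<lambda>x. \<tau> x - \<sigma> x)"
proof -
  let ?S = "surface_measure \<Omega>"
  obtain \<phi> where \<phi>: "\<And>k. smooth (\<phi> k)" "(\<lambda>k. H1_norm \<Omega> (\<phi> k - u)) \<longlonglongrightarrow> 0"
    "(\<lambda>k. \<integral>\<^sup>+x. ennreal ((\<phi> k x - \<tau> x)\<^sup>2) \<partial>?S) \<longlonglongrightarrow> 0"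
    using assms(1) by (auto simp: has_trace_def)
  obtain \<psi> where \<psi>: "\<And>k. smooth (\<psi> k)" "(\<lambda>k. H1_norm \<Omega> (\<psi> k - v)) \<longlonglongrightarrow> 0"
    "(\<lambda>k. \<integral>\<^sup>+x. ennreal ((\<psi> k x - \<sigma> x)\<^sup>2) \<partial>?S) \<longlonglongrightarrow> 0"
    using assms(2) by (auto simp: has_trace_def)
  have [measurable]: "\<tau> \<in> borel_measurable ?S" "\<sigma> \<in> borel_measurable ?S"
    using assms by (auto simp: has_trace_def)
  have [measurable]: "\<phi> k \<in> borel_measurable ?S" "\<psi> k \<in> borel_measurable ?S" for k
    using \<phi>(1) \<psi>(1) by (simp_all add: smooth_surface_measurable)
  have sq: "(a - b)\<^sup>2 \<le> 2 * a\<^sup>2 + 2 * b\<^sup>2" for a b :: real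
    using zero_le_power2[of "a + b"] by (simp add: power2_sum power2_diff)
  show ?thesis
    unfolding has_trace_def
  proof (intro conjI exI[of _ "\<lambda>k x. \<phi> k x - \<psi> k x"] allI)
    show "integrable ?S (\<lambda>x. (\<tau> x - \<sigma> x)\<^sup>2)"
    proof (rule Bochner_Integration.integrable_bound)
      show "integrable ?S (\<lambda>x. 2 * (\<tau> x)\<^sup>2 + 2 * (\<sigma> x)\<^sup>2)"
        using assms(1,2) by (simp add: has_trace_def)
    qed (use sq in auto)
    show "smooth (\<lambda>x. \<phi> k x - \<psi> k x)" for k
      using smooth_add[OF \<phi>(1)[of k] smooth_mult[OF smooth_const[of "-1"] \<psi>(1)[of k]]] by simp
    show "(\<lambda>k. H1_norm \<Omega> ((\<lambda>x. \<phi> k x - \<psi> k x) - (\<lambda>x. u x - v x))) \<longlonglongrightarrow> 0"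
    proof (rule tendsto_sandwich[of "\<lambda>k. 0" _ _ "\<lambda>k. H1_norm \<Omega> (\<phi> k - u) + H1_norm \<Omega> (\<psi> k - v)"])
      have "H1_norm \<Omega> ((\<lambda>x. \<phi> k x - \<psi> k x) - (\<lambda>x. u x - v x)) \<le> H1_norm \<Omega> (\<phi> k - u) + H1_norm \<Omega> (\<psi> k - v)" for k
      proof -
        have "\<phi> k - u \<in> H1 \<Omega>" "\<psi> k - v \<in> H1 \<Omega>"
          unfolding fun_diff_def using assms(3,4) \<phi>(1) \<psi>(1) by (auto intro!: H1_diff intro: smooth_H1)
        from H1_norm_lincomb_le[OF this, of 1 "-1"] show ?thesis
          by (simp add: fun_diff_def algebra_simps)
      qed
      then show "\<forall>\<^sub>F k in sequentially. H1_norm \<Omega> ((\<lambda>x. \<phi> k x - \<psi> k x) - (\<lambda>x. u x - v x))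
          \<le> H1_norm \<Omega> (\<phi> k - u) + H1_norm \<Omega> (\<psi> k - v)" by simp
      show "(\<lambda>k. H1_norm \<Omega> (\<phi> k - u) + H1_norm \<Omega> (\<psi> k - v)) \<longlonglongrightarrow> 0"
        using tendsto_add[OF \<phi>(2) \<psi>(2)] by simp
    qed auto
    show "(\<lambda>k. \<integral>\<^sup>+x. ennreal ((\<phi> k x - \<psi> k x - (\<tau> x - \<sigma> x))\<^sup>2) \<partial>?S) \<longlonglongrightarrow> 0"
    proof (rule tendsto_sandwich[of "\<lambda>k. 0" _ _
          "\<lambda>k. 2 * (\<integral>\<^sup>+x. ennreal ((\<phi> k x - \<tau> x)\<^sup>2) \<partial>?S) + 2 * (\<integral>\<^sup>+x. ennreal ((\<psi> k x - \<sigma> x)\<^sup>2) \<partial>?S)"])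
      have "(\<integral>\<^sup>+x. ennreal ((\<phi> k x - \<psi> k x - (\<tau> x - \<sigma> x))\<^sup>2) \<partial>?S)
        \<le> 2 * (\<integral>\<^sup>+x. ennreal ((\<phi> k x - \<tau> x)\<^sup>2) \<partial>?S) + 2 * (\<integral>\<^sup>+x. ennreal ((\<psi> k x - \<sigma> x)\<^sup>2) \<partial>?S)" for k
      proof -
        have "(\<integral>\<^sup>+x. ennreal ((\<phi> k x - \<psi> k x - (\<tau> x - \<sigma> x))\<^sup>2) \<partial>?S)
          \<le> (\<integral>\<^sup>+x. 2 * ennreal ((\<phi> k x - \<tau> x)\<^sup>2) + 2 * ennreal ((\<psi> k x - \<sigma> x)\<^sup>2) \<partial>?S)"
        proof (rule nn_integral_mono)
          fix x
          have "(\<phi> k x - \<psi> k x - (\<tau> x - \<sigma> x))\<^sup>2 \<le> 2 * (\<phi> k x - \<tau> x)\<^sup>2 + 2 * (\<psi> k x - \<sigma> x)\<^sup>2"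
            using sq[of "\<phi> k x - \<tau> x" "\<psi> k x - \<sigma> x"] by (simp add: algebra_simps)
          then have "ennreal ((\<phi> k x - \<psi> k x - (\<tau> x - \<sigma> x))\<^sup>2) \<le> ennreal (2 * (\<phi> k x - \<tau> x)\<^sup>2 + 2 * (\<psi> k x - \<sigma> x)\<^sup>2)"
            by (rule ennreal_leI)
          then show "ennreal ((\<phi> k x - \<psi> k x - (\<tau> x - \<sigma> x))\<^sup>2) \<le> 2 * ennreal ((\<phi> k x - \<tau> x)\<^sup>2) + 2 * ennreal ((\<psi> k x - \<sigma> x)\<^sup>2)"
            by (simp add: ennreal_mult)
        qed
        also have "\<dots> = 2 * (\<integral>\<^sup>+x. ennreal ((\<phi> k x - \<tau> x)\<^sup>2) \<partial>?S) + 2 * (\<integral>\<^sup>+x. ennreal ((\<psi> k x - \<sigma> x)\<^sup>2) \<partial>?S)"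
          by (simp add: nn_integral_add nn_integral_cmult)
        finally show ?thesis .
      qed
      then show "\<forall>\<^sub>F k in sequentially. (\<integral>\<^sup>+x. ennreal ((\<phi> k x - \<psi> k x - (\<tau> x - \<sigma> x))\<^sup>2) \<partial>?S)
        \<le> 2 * (\<integral>\<^sup>+x. ennreal ((\<phi> k x - \<tau> x)\<^sup>2) \<partial>?S) + 2 * (\<integral>\<^sup>+x. ennreal ((\<psi> k x - \<sigma> x)\<^sup>2) \<partial>?S)" by simp
      have "(\<lambda>k. 2 * (\<integral>\<^sup>+x. ennreal ((\<phi> k x - \<tau> x)\<^sup>2) \<partial>?S) + 2 * (\<integral>\<^sup>+x. ennreal ((\<psi> k x - \<sigma> x)\<^sup>2) \<partial>?S)) \<longlonglongrightarrow> 2 * 0 + 2 * 0"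
        by (intro tendsto_add ennreal_tendsto_cmult \<phi>(3) \<psi>(3)) auto
      then show "(\<lambda>k. 2 * (\<integral>\<^sup>+x. ennreal ((\<phi> k x - \<tau> x)\<^sup>2) \<partial>?S) + 2 * (\<integral>\<^sup>+x. ennreal ((\<psi> k x - \<sigma> x)\<^sup>2) \<partial>?S)) \<longlonglongrightarrow> 0"
        by simp
    qed auto
  qed measurable
qed

lemma V_D_diff:
  assumes "u \<in> V_D \<Omega> \<Gamma>" "v \<in> V_D \<Omega> \<Gamma>"
  shows "(\<lambda>x. u x - v x) \<in> V_D \<Omega> \<Gamma>"
proof -
  obtain \<tau> where \<tau>: "has_trace \<Omega> u \<tau>" "AE x in surface_measure \<Omega>. x \<in> \<Gamma> \<longrightarrow> \<tau> x = 0"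
    using assms(1) by (auto simp: V_D_def)
  obtain \<sigma> where \<sigma>: "has_trace \<Omega> v \<sigma>" "AE x in surface_measure \<Omega>. x \<in> \<Gamma> \<longrightarrow> \<sigma> x = 0"
    using assms(2) by (auto simp: V_D_def)
  have uv: "u \<in> H1 \<Omega>" "v \<in> H1 \<Omega>" using assms by (auto simp: V_D_def)
  have "AE x in surface_measure \<Omega>. x \<in> \<Gamma> \<longrightarrow> \<tau> x - \<sigma> x = 0"
    using \<tau>(2) \<sigma>(2) by eventually_elim simp
  with has_trace_diff[OF \<tau>(1) \<sigma>(1) uv] H1_diff[OF uv] show ?thesis
    by (auto simp: V_D_def)
qed

lemma grad_inner_diff_left:
  assumes "u \<in> H1 \<Omega>" "v \<in> H1 \<Omega>" "w \<in> H1 \<Omega>"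
  shows "grad_inner \<Omega> (\<lambda>x. u x - v x) w = grad_inner \<Omega> u w - grad_inner \<Omega> v w"
proof -
  have "L2_inner \<Omega> (weak_partial \<Omega> i (\<lambda>x. u x - v x)) (weak_partial \<Omega> i w)
      = L2_inner \<Omega> (weak_partial \<Omega> i u) (weak_partial \<Omega> i w) - L2_inner \<Omega> (weak_partial \<Omega> i v) (weak_partial \<Omega> i w)" for i
  proof -
    have "L2_inner \<Omega> (weak_partial \<Omega> i (\<lambda>x. u x - v x)) (weak_partial \<Omega> i w)
      = L2_inner \<Omega> (\<lambda>x. weak_partial \<Omega> i u x - weak_partial \<Omega> i v x) (weak_partial \<Omega> i w)"
      using assms by (intro L2_inner_cong_AE weak_partial_diff L2_diff H1_D H1_diff) auto
    with assms show ?thesis by (simp add: L2_inner_diff_left H1_D)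
  qed
  then show ?thesis by (simp add: grad_inner_def sum_subtractf)
qed

lemma solves_poisson_diff:
  assumes "solves_poisson \<Omega> \<Gamma> \<epsilon> h v" "solves_poisson \<Omega> \<Gamma> \<epsilon> h' v'" "h \<in> L2 \<Omega>" "h' \<in> L2 \<Omega>"
  shows "solves_poisson \<Omega> \<Gamma> \<epsilon> (\<lambda>x. h x - h' x) (\<lambda>x. v x - v' x)"
  unfolding solves_poisson_def
proof (intro conjI ballI)
  show "(\<lambda>x. v x - v' x) \<in> V_D \<Omega> \<Gamma>"
    using assms by (intro V_D_diff solves_poissonD)
  fix w assume w: "w \<in> V_D \<Omega> \<Gamma>"
  then have wH: "w \<in> H1 \<Omega>" by (simp add: V_D_def)
  have "\<epsilon> * grad_inner \<Omega> (\<lambda>x. v x - v' x) w = \<epsilon> * grad_inner \<Omega> v w - \<epsilon> * grad_inner \<Omega> v' w"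
    using grad_inner_diff_left[OF solves_poissonD(2)[OF assms(1)] solves_poissonD(2)[OF assms(2)] wH]
    by (simp add: right_diff_distrib)
  also have "\<dots> = L2_inner \<Omega> h w - L2_inner \<Omega> h' w"
    using solves_poissonD(3)[OF assms(1) w] solves_poissonD(3)[OF assms(2) w] by simp
  also have "\<dots> = L2_inner \<Omega> (\<lambda>x. h x - h' x) w"
    using L2_inner_diff_left[OF assms(3,4) H1_D(1)[OF wH]] by simp
  finally show "\<epsilon> * grad_inner \<Omega> (\<lambda>x. v x - v' x) w = L2_inner \<Omega> (\<lambda>x. h x - h' x) w" .
qed

text \<open>The difference of \<Phi> h and \<Phi> h' solves the problem with right-hand side h - h',
  so the uniqueness contained in \<open>solution_operator\<close> identifies it almost everywhere
  with the value of \<Phi> at h - h', to which the regularity bound applies. Pairings with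
  \<open>q\<close> are estimated because that is how the gradient enters the flow.\<close>

lemma solution_operator_gradient_Lipschitz:
  assumes "solution_operator \<Omega> \<Gamma> \<epsilon> \<Phi>" "H2_regular \<Omega> \<Phi>"
  obtains C where "C \<ge> 0"
    "\<And>h h' q i. h \<in> L2 \<Omega> \<Longrightarrow> h' \<in> L2 \<Omega> \<Longrightarrow> q \<in> L2 \<Omega> \<Longrightarrow>
      \<bar>L2_inner \<Omega> (weak_partial \<Omega> i (\<Phi> h)) q - L2_inner \<Omega> (weak_partial \<Omega> i (\<Phi> h')) q\<bar>
        \<le> C * L2_norm \<Omega> (\<lambda>x. h x - h' x) * L2_norm \<Omega> q"
proof -
  obtain C where C: "\<And>h. h \<in> L2 \<Omega> \<Longrightarrow> H2_norm \<Omega> (\<Phi> h) \<le> C * L2_norm \<Omega> h"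
    using assms(2) by (auto simp: H2_regular_def)
  show ?thesis
  \<comment> \<open>\<open>H2_regular\<close> leaves the sign of its constant open; the absolute
    value makes it nonnegative.\<close>
  proof (rule that[of "\<bar>C\<bar>"])
    fix h h' q i assume h: "h \<in> L2 \<Omega>" "h' \<in> L2 \<Omega>" and q: "q \<in> L2 \<Omega>"
    let ?h = "\<lambda>x. h x - h' x" and ?v = "\<lambda>x. \<Phi> h x - \<Phi> h' x"
    have hd: "?h \<in> L2 \<Omega>" using h by (rule L2_diff)
    have sol: "solves_poisson \<Omega> \<Gamma> \<epsilon> h (\<Phi> h)" "solves_poisson \<Omega> \<Gamma> \<epsilon> h' (\<Phi> h')" "solves_poisson \<Omega> \<Gamma> \<epsilon> ?h (\<Phi> ?h)"
      using assms(1) h hd by (auto simp: solution_operator_def)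
    note H = solves_poissonD(2)[OF sol(1)] solves_poissonD(2)[OF sol(2)] solves_poissonD(2)[OF sol(3)]
    have "AE x in lebesgue_on \<Omega>. ?v x = \<Phi> ?h x"
      using assms(1) hd solves_poisson_diff[OF sol(1,2) h] by (auto simp: solution_operator_def)
    \<comment> \<open>Functions equal almost everywhere share their weak derivatives, so the weak
      gradient of the potential of h - h' is the difference of the two gradients.\<close>
    from has_weak_partial_cong_AE[OF H1_D(2)[OF H1_diff[OF H(1,2)]] this H1_D(1)[OF H1_diff[OF H(1,2)]] H1_D(1)[OF H(3)]]
    have "has_weak_partial \<Omega> i (\<Phi> ?h) (weak_partial \<Omega> i ?v)" .
    from weak_partial_AE_eq[OF this] weak_partial_diff[OF H(1,2), of i]
    have "AE x in lebesgue_on \<Omega>. weak_partial \<Omega> i (\<Phi> h) x - weak_partial \<Omega> i (\<Phi> h') x = weak_partial \<Omega> i (\<Phi> ?h) x"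
      by eventually_elim simp
    then have "L2_inner \<Omega> (\<lambda>x. weak_partial \<Omega> i (\<Phi> h) x - weak_partial \<Omega> i (\<Phi> h') x) q = L2_inner \<Omega> (weak_partial \<Omega> i (\<Phi> ?h)) q"
      using H q by (intro L2_inner_cong_AE L2_diff) (auto intro: H1_D(3))
    then have "\<bar>L2_inner \<Omega> (weak_partial \<Omega> i (\<Phi> h)) q - L2_inner \<Omega> (weak_partial \<Omega> i (\<Phi> h')) q\<bar>
        = \<bar>L2_inner \<Omega> (weak_partial \<Omega> i (\<Phi> ?h)) q\<bar>"
      using H q by (simp add: L2_inner_diff_left H1_D)
    also have "\<dots> \<le> L2_norm \<Omega> (weak_partial \<Omega> i (\<Phi> ?h)) * L2_norm \<Omega> q"
      by (intro L2_inner_le_norm H1_D H q)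
    also have "\<dots> \<le> (\<bar>C\<bar> * L2_norm \<Omega> ?h) * L2_norm \<Omega> q"
    proof (intro mult_right_mono)
      have "L2_norm \<Omega> (weak_partial \<Omega> i (\<Phi> ?h)) \<le> H1_norm \<Omega> (\<Phi> ?h)"
        by (rule L2_norm_weak_partial_le_H1_norm)
      also have "\<dots> \<le> H2_norm \<Omega> (\<Phi> ?h)"
        unfolding H2_norm_def by (rule real_le_rsqrt) (simp add: sum_nonneg)
      also have "\<dots> \<le> C * L2_norm \<Omega> ?h" by (rule C[OF hd])
      also have "\<dots> \<le> \<bar>C\<bar> * L2_norm \<Omega> ?h" by (intro mult_right_mono) auto
      finally show "L2_norm \<Omega> (weak_partial \<Omega> i (\<Phi> ?h)) \<le> \<bar>C\<bar> * L2_norm \<Omega> ?h" .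
    qed auto
    finally show "\<bar>L2_inner \<Omega> (weak_partial \<Omega> i (\<Phi> h)) q - L2_inner \<Omega> (weak_partial \<Omega> i (\<Phi> h')) q\<bar>
        \<le> \<bar>C\<bar> * L2_norm \<Omega> ?h * L2_norm \<Omega> q" .
  qed auto
qed

text \<open>The pointwise one-sided Lipschitz bound is integrated over the domain; the Sobolev
  embedding enters through additivity of the integral.\<close>

lemma DF_one_sided_Lipschitz:
  assumes "CARD('n) \<le> 3" "\<gamma> > 0 \<or> (\<gamma> = 0 \<and> \<beta> > 0)"
  obtains K where "K \<ge> 0" "\<And>P Q i. P i \<in> H10 \<Omega> \<Longrightarrow> Q i \<in> H10 \<Omega> \<Longrightarrow>
    L2_inner \<Omega> (DF \<alpha> \<beta> \<gamma> P i) (\<lambda>x. P i x - Q i x) - L2_inner \<Omega> (DF \<alpha> \<beta> \<gamma> Q i) (\<lambda>x. P i x - Q i x)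
      \<ge> - K * (L2_norm \<Omega> (\<lambda>x. P i x - Q i x))\<^sup>2"
proof -
  obtain K where K: "K \<ge> 0" "\<And>p q. ((2 * \<alpha> + 4 * \<beta> * p\<^sup>2 + 6 * \<gamma> * p ^ 4) * p - (2 * \<alpha> + 4 * \<beta> * q\<^sup>2 + 6 * \<gamma> * q ^ 4) * q) * (p - q)
      \<ge> - K * (p - q)\<^sup>2"
    using quintic_one_sided_Lipschitz[OF assms(2)] by blast
  show ?thesis
  proof (rule that[OF K(1)])
    fix P Q :: "'n \<Rightarrow> 'n scalar_field" and i assume PQ: "P i \<in> H10 \<Omega>" "Q i \<in> H10 \<Omega>"
    let ?w = "\<lambda>x. P i x - Q i x"
    have w: "?w \<in> H10 \<Omega>" using PQ by (rule H10_diff)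
    have I: "integrable (lebesgue_on \<Omega>) (\<lambda>x. DF \<alpha> \<beta> \<gamma> P i x * ?w x)" "integrable (lebesgue_on \<Omega>) (\<lambda>x. DF \<alpha> \<beta> \<gamma> Q i x * ?w x)"
      unfolding DF_def using PQ w assms(1) by (auto intro!: H10_quintic_integrable)
    have "- K * (L2_norm \<Omega> ?w)\<^sup>2 = (LINT x|lebesgue_on \<Omega>. - K * (?w x)\<^sup>2)"
      unfolding L2_norm_square L2_inner_def by (simp add: power2_eq_square)
    also have "\<dots> \<le> (LINT x|lebesgue_on \<Omega>. DF \<alpha> \<beta> \<gamma> P i x * ?w x - DF \<alpha> \<beta> \<gamma> Q i x * ?w x)"
    proof (rule integral_mono)
      show "integrable (lebesgue_on \<Omega>) (\<lambda>x. - K * (?w x)\<^sup>2)"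
        using L2D(2)[OF H10_D(2)[OF w]] by (intro integrable_mult_right)
      show "- K * (?w x)\<^sup>2 \<le> DF \<alpha> \<beta> \<gamma> P i x * ?w x - DF \<alpha> \<beta> \<gamma> Q i x * ?w x" for x
        using K(2)[of "P i x" "Q i x"] by (simp add: DF_def left_diff_distrib)
    qed (use I in simp)
    also have "\<dots> = L2_inner \<Omega> (DF \<alpha> \<beta> \<gamma> P i) ?w - L2_inner \<Omega> (DF \<alpha> \<beta> \<gamma> Q i) ?w"
      unfolding L2_inner_def by (rule Bochner_Integration.integral_diff[OF I])
    finally show "- K * (L2_norm \<Omega> ?w)\<^sup>2 \<le> L2_inner \<Omega> (DF \<alpha> \<beta> \<gamma> P i) ?w - L2_inner \<Omega> (DF \<alpha> \<beta> \<gamma> Q i) ?w" .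
  qed
qed

lemma L2_norm_weak_div_diff_le:
  assumes "\<And>i. P i \<in> H1 \<Omega>" "\<And>i. Q i \<in> H1 \<Omega>"
  shows "L2_norm \<Omega> (\<lambda>x. weak_div \<Omega> P x - weak_div \<Omega> Q x)
    \<le> (\<Sum>j\<in>UNIV. L2_norm \<Omega> (weak_partial \<Omega> j (\<lambda>x. P j x - Q j x)))"
proof -
  have sum_le: "finite A \<Longrightarrow> (\<And>j. j \<in> A \<Longrightarrow> f j \<in> L2 \<Omega>) \<Longrightarrow> L2_norm \<Omega> (\<lambda>x. \<Sum>j\<in>A. f j x) \<le> (\<Sum>j\<in>A. L2_norm \<Omega> (f j))"
    for A and f :: "'n \<Rightarrow> 'n scalar_field"
  proof (induction A rule: finite_induct)
    case (insert j A)
    then have "L2_norm \<Omega> (\<lambda>x. f j x + (\<Sum>j\<in>A. f j x)) \<le> L2_norm \<Omega> (f j) + L2_norm \<Omega> (\<lambda>x. \<Sum>j\<in>A. f j x)"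
      by (intro L2_norm_add_le L2_sum) auto
    with insert show ?case by fastforce
  qed simp
  have "(\<lambda>x. weak_div \<Omega> P x - weak_div \<Omega> Q x) = (\<lambda>x. \<Sum>j\<in>UNIV. weak_partial \<Omega> j (P j) x - weak_partial \<Omega> j (Q j) x)"
    by (simp add: weak_div_def sum_subtractf)
  then have "L2_norm \<Omega> (\<lambda>x. weak_div \<Omega> P x - weak_div \<Omega> Q x)
      \<le> (\<Sum>j\<in>UNIV. L2_norm \<Omega> (\<lambda>x. weak_partial \<Omega> j (P j) x - weak_partial \<Omega> j (Q j) x))"
    using sum_le[of UNIV "\<lambda>j x. weak_partial \<Omega> j (P j) x - weak_partial \<Omega> j (Q j) x"] assms
    by (simp add: L2_diff H1_D)
  also have "\<dots> = (\<Sum>j\<in>UNIV. L2_norm \<Omega> (weak_partial \<Omega> j (\<lambda>x. P j x - Q j x)))"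
    using assms by (intro sum.cong refl L2_norm_cong_AE[symmetric] weak_partial_diff) (auto intro: L2_diff H1_D H1_diff)
  finally show ?thesis .
qed

text \<open>\<open>F\<close> and \<open>G\<close> stand for the time derivative functionals of two
  solutions, so this is the energy inequality at one instant. The potential term sees only the
  divergence of the difference, and Young's inequality trades it against the Dirichlet term.\<close>

lemma gradient_flow_dissipation:
  assumes "CARD('n) \<le> 3" "\<gamma> > 0 \<or> (\<gamma> = 0 \<and> \<beta> > 0)" "g > 0"
    and "solution_operator \<Omega> \<Gamma> \<epsilon> \<Phi>" "H2_regular \<Omega> \<Phi>"
  obtains C where "C \<ge> 0"
    "\<And>P Q r F G. P \<in> tuples (H10 \<Omega>) \<Longrightarrow> Q \<in> tuples (H10 \<Omega>) \<Longrightarrow> r \<in> L2 \<Omega> \<Longrightarrow>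
      (\<And>q. q \<in> tuples (H10 \<Omega>) \<Longrightarrow> F q + flow_form \<Omega> \<Phi> \<alpha> \<beta> \<gamma> g r P q = 0) \<Longrightarrow>
      (\<And>q. q \<in> tuples (H10 \<Omega>) \<Longrightarrow> G q + flow_form \<Omega> \<Phi> \<alpha> \<beta> \<gamma> g r Q q = 0) \<Longrightarrow>
      F (\<lambda>i x. P i x - Q i x) - G (\<lambda>i x. P i x - Q i x) \<le> C * (\<Sum>i\<in>UNIV. (L2_norm \<Omega> (\<lambda>x. P i x - Q i x))\<^sup>2)"
proof -
  obtain C where C: "C \<ge> 0"
    "\<And>h h' q i. h \<in> L2 \<Omega> \<Longrightarrow> h' \<in> L2 \<Omega> \<Longrightarrow> q \<in> L2 \<Omega> \<Longrightarrow>
      \<bar>L2_inner \<Omega> (weak_partial \<Omega> i (\<Phi> h)) q - L2_inner \<Omega> (weak_partial \<Omega> i (\<Phi> h')) q\<bar>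
        \<le> C * L2_norm \<Omega> (\<lambda>x. h x - h' x) * L2_norm \<Omega> q"
    by (rule solution_operator_gradient_Lipschitz[OF assms(4,5)]) (rule that)
  obtain K where K: "K \<ge> 0" "\<And>P Q i. P i \<in> H10 \<Omega> \<Longrightarrow> Q i \<in> H10 \<Omega> \<Longrightarrow>
    L2_inner \<Omega> (DF \<alpha> \<beta> \<gamma> P i) (\<lambda>x. P i x - Q i x) - L2_inner \<Omega> (DF \<alpha> \<beta> \<gamma> Q i) (\<lambda>x. P i x - Q i x)
      \<ge> - K * (L2_norm \<Omega> (\<lambda>x. P i x - Q i x))\<^sup>2"
    by (rule DF_one_sided_Lipschitz[OF assms(1,2), of \<alpha>]) (rule that)
  let ?n = "real CARD('n)"
  have n: "?n > 0" by simp
  show ?thesis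
  \<comment> \<open>In the notation below, with n the dimension: Young's inequality with weight g /
    n on the square of \<open>G'\<close>, together with G'^2 \<le> n D and s^2 \<le> n S, uses up
    exactly g D and leaves n^2 C^2 / (4 g) times S.\<close>
  proof (rule that[of "K + ?n\<^sup>2 * C\<^sup>2 / (4 * g)"])
    show "0 \<le> K + ?n\<^sup>2 * C\<^sup>2 / (4 * g)" using K(1) assms(3) by simp
    fix P Q r F G
    assume PQ: "P \<in> tuples (H10 \<Omega>)" "Q \<in> tuples (H10 \<Omega>)" and r: "r \<in> L2 \<Omega>"
      and F: "\<And>q. q \<in> tuples (H10 \<Omega>) \<Longrightarrow> F q + flow_form \<Omega> \<Phi> \<alpha> \<beta> \<gamma> g r P q = 0"
      and G: "\<And>q. q \<in> tuples (H10 \<Omega>) \<Longrightarrow> G q + flow_form \<Omega> \<Phi> \<alpha> \<beta> \<gamma> g r Q q = 0"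
    define w where "w i = (\<lambda>x. P i x - Q i x)" for i
    have H10: "P i \<in> H10 \<Omega>" "Q i \<in> H10 \<Omega>" "w i \<in> H10 \<Omega>" for i
      using PQ by (auto simp: tuples_def w_def intro!: H10_diff)
    have wt: "w \<in> tuples (H10 \<Omega>)" using H10 by (simp add: tuples_def)
    note H1 = H10_D(1)[OF H10(1)] H10_D(1)[OF H10(2)] H10_D(1)[OF H10(3)]
    define D where "D = (\<Sum>i\<in>UNIV. grad_inner \<Omega> (w i) (w i))"
    define S where "S = (\<Sum>i\<in>UNIV. (L2_norm \<Omega> (w i))\<^sup>2)"
    define s where "s = (\<Sum>i\<in>UNIV. L2_norm \<Omega> (w i))"
    define G' where "G' = (\<Sum>j\<in>UNIV. L2_norm \<Omega> (weak_partial \<Omega> j (w j)))"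
    let ?hP = "\<lambda>x. r x - weak_div \<Omega> P x" and ?hQ = "\<lambda>x. r x - weak_div \<Omega> Q x"
    have h: "?hP \<in> L2 \<Omega>" "?hQ \<in> L2 \<Omega>"
      using H1 r by (auto intro!: L2_diff weak_div_L2)
    have hd: "L2_norm \<Omega> (\<lambda>x. ?hP x - ?hQ x) \<le> G'"
    proof -
      have "(\<lambda>x. ?hP x - ?hQ x) = (\<lambda>x. (-1) * (weak_div \<Omega> P x - weak_div \<Omega> Q x))" by (simp add: fun_eq_iff)
      then have "L2_norm \<Omega> (\<lambda>x. ?hP x - ?hQ x) = L2_norm \<Omega> (\<lambda>x. weak_div \<Omega> P x - weak_div \<Omega> Q x)"
        by (simp only: L2_norm_scale)
      with L2_norm_weak_div_diff_le[of P Q] H1 show ?thesis by (simp add: G'_def w_def)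
    qed
    have eq: "F w - G w = - g * (\<Sum>i\<in>UNIV. grad_inner \<Omega> (P i) (w i) - grad_inner \<Omega> (Q i) (w i))
        - (\<Sum>i\<in>UNIV. L2_inner \<Omega> (DF \<alpha> \<beta> \<gamma> P i) (w i) - L2_inner \<Omega> (DF \<alpha> \<beta> \<gamma> Q i) (w i))
        - (\<Sum>i\<in>UNIV. L2_inner \<Omega> (weak_partial \<Omega> i (\<Phi> ?hP)) (w i) - L2_inner \<Omega> (weak_partial \<Omega> i (\<Phi> ?hQ)) (w i))"
      using F[OF wt] G[OF wt] by (simp add: flow_form_def sum_subtractf algebra_simps)
    have grad: "(\<Sum>i\<in>UNIV. grad_inner \<Omega> (P i) (w i) - grad_inner \<Omega> (Q i) (w i)) = D"
      unfolding D_def using grad_inner_diff_left[OF H1(1) H1(2) H1(3)] by (simp add: w_def)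
    have "- (\<Sum>i\<in>UNIV. L2_inner \<Omega> (DF \<alpha> \<beta> \<gamma> P i) (w i) - L2_inner \<Omega> (DF \<alpha> \<beta> \<gamma> Q i) (w i)) \<le> K * S"
    proof -
      have "(\<Sum>i\<in>UNIV. - K * (L2_norm \<Omega> (w i))\<^sup>2) \<le> (\<Sum>i\<in>UNIV. L2_inner \<Omega> (DF \<alpha> \<beta> \<gamma> P i) (w i) - L2_inner \<Omega> (DF \<alpha> \<beta> \<gamma> Q i) (w i))"
        unfolding w_def by (intro sum_mono K(2) H10)
      then show ?thesis by (simp add: S_def sum_distrib_left sum_negf)
    qed
    moreover have "- (\<Sum>i\<in>UNIV. L2_inner \<Omega> (weak_partial \<Omega> i (\<Phi> ?hP)) (w i) - L2_inner \<Omega> (weak_partial \<Omega> i (\<Phi> ?hQ)) (w i)) \<le> C * G' * s"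
    proof -
      have "- (L2_inner \<Omega> (weak_partial \<Omega> i (\<Phi> ?hP)) (w i) - L2_inner \<Omega> (weak_partial \<Omega> i (\<Phi> ?hQ)) (w i)) \<le> C * G' * L2_norm \<Omega> (w i)" for i
      proof -
        have "- (L2_inner \<Omega> (weak_partial \<Omega> i (\<Phi> ?hP)) (w i) - L2_inner \<Omega> (weak_partial \<Omega> i (\<Phi> ?hQ)) (w i))
            \<le> C * L2_norm \<Omega> (\<lambda>x. ?hP x - ?hQ x) * L2_norm \<Omega> (w i)"
          using C(2)[OF h H10_D(2)[OF H10(3)], of i] by (simp only: abs_le_iff)
        also have "\<dots> \<le> C * G' * L2_norm \<Omega> (w i)"
          using hd C(1) by (intro mult_right_mono mult_left_mono) auto
        finally show ?thesis .
      qed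
      then have "(\<Sum>i\<in>UNIV. - (L2_inner \<Omega> (weak_partial \<Omega> i (\<Phi> ?hP)) (w i) - L2_inner \<Omega> (weak_partial \<Omega> i (\<Phi> ?hQ)) (w i)))
          \<le> (\<Sum>i\<in>UNIV. C * G' * L2_norm \<Omega> (w i))" by (intro sum_mono)
      then show ?thesis by (simp only: sum_negf s_def sum_distrib_left)
    qed
    ultimately have main: "F w - G w \<le> - g * D + K * S + C * G' * s"
      using eq[unfolded grad] by linarith
    \<comment> \<open>Only the diagonal partials of the difference occur in \<open>G'\<close>; their
      squares form a part of the Dirichlet sum \<open>D\<close>.\<close>
    have G'2: "G'\<^sup>2 \<le> ?n * D"
    proof -
      have "G'\<^sup>2 \<le> (\<Sum>j\<in>UNIV. (L2_norm \<Omega> (weak_partial \<Omega> j (w j)))\<^sup>2) * ?n"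
        unfolding G'_def by (rule sum_squared_le_sum_of_squares)
      also have "(\<Sum>j\<in>UNIV. (L2_norm \<Omega> (weak_partial \<Omega> j (w j)))\<^sup>2) \<le> D"
        unfolding D_def grad_inner_def L2_norm_square
        by (intro sum_mono member_le_sum) (auto simp: L2_inner_self_nonneg)
      finally show ?thesis by (simp add: mult.commute mult_right_mono)
    qed
    have s2: "s\<^sup>2 \<le> ?n * S"
      unfolding s_def S_def by (subst mult.commute, rule sum_squared_le_sum_of_squares)
    have "C * G' * s \<le> (g / ?n) * G'\<^sup>2 + (?n * C\<^sup>2 / (4 * g)) * s\<^sup>2"
    proof -
      have "0 \<le> (g / ?n) * (G' - ?n * C / (2 * g) * s)\<^sup>2" using assms(3) by simp
      also have "\<dots> = (g / ?n) * G'\<^sup>2 + (?n * C\<^sup>2 / (4 * g)) * s\<^sup>2 - C * G' * s"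
        using assms(3) n by (simp add: power2_eq_square field_simps)
      finally show ?thesis by simp
    qed
    also have "\<dots> \<le> (g / ?n) * (?n * D) + (?n * C\<^sup>2 / (4 * g)) * (?n * S)"
      using assms(3) by (intro add_mono mult_left_mono G'2 s2) auto
    also have "\<dots> = g * D + (?n\<^sup>2 * C\<^sup>2 / (4 * g)) * S"
      using n by (simp add: power2_eq_square)
    finally have fin: "F w - G w \<le> (K + ?n\<^sup>2 * C\<^sup>2 / (4 * g)) * S"
      using main by (simp add: algebra_simps)
    then show "F (\<lambda>i x. P i x - Q i x) - G (\<lambda>i x. P i x - Q i x)
        \<le> (K + ?n\<^sup>2 * C\<^sup>2 / (4 * g)) * (\<Sum>i\<in>UNIV. (L2_norm \<Omega> (\<lambda>x. P i x - Q i x))\<^sup>2)"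
    proof -
      have "(\<lambda>i x. P i x - Q i x) = w" by (simp add: w_def fun_eq_iff)
      with fin show ?thesis by (simp add: S_def w_def)
    qed
  qed
qed

end

section \<open>Functions of time\<close>

text \<open>The normalised antiderivative of a bump. The derivative \<open>b\<close> is delivered
  along with the step because, having mass 1 on (0, \<delta>), it acts as an approximate point
  mass.\<close>

lemma smooth_step:
  assumes "\<delta> > 0"
  obtains B b :: "real \<Rightarrow> real" where "smooth B" "\<And>x. (B has_real_derivative b x) (at x)"
    "continuous_on UNIV b" "\<And>x. 0 \<le> b x" "\<And>x. x \<notin> {0<..<\<delta>} \<Longrightarrow> b x = 0"
    "\<And>x. x \<le> 0 \<Longrightarrow> B x = 0" "\<And>x. \<delta> \<le> x \<Longrightarrow> B x = 1" "\<And>x. 0 \<le> B x" "\<And>x. B x \<le> 1"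
proof -
  define p where "p = box_bump 1 0 \<delta>"
  have sp: "smooth p" unfolding p_def by (rule smooth_box_bump) simp
  have p: "0 \<le> p x" "p x = 0 \<longleftrightarrow> x \<notin> {0<..<\<delta>}" for x
    unfolding p_def by (rule box_bump_nonneg, simp) (simp add: box_bump_eq_0_iff box_real)
  have "\<exists>F. \<forall>x::real. -\<infinity> < ereal x \<longrightarrow> ereal x < \<infinity> \<longrightarrow> (F has_vector_derivative p x) (at x)"
    using smooth_continuous[OF sp]
    by (intro einterval_antiderivative) (auto simp: continuous_on_eq_continuous_at)
  then obtain F where F: "(F has_real_derivative p x) (at x)" for x
    by (auto simp: has_real_derivative_iff_has_vector_derivative)
  have mono: "F x \<le> F y" if "x \<le> y" for x y
    using DERIV_nonneg_imp_nondecreasing[OF that, of F] F p(1) by blast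
  have const: "F x = F y" if "x \<le> y" "y \<le> 0 \<or> \<delta> \<le> x" for x y
  proof (rule antisym[OF mono[OF that(1)]])
    have "p z = 0" if "x \<le> z" "z \<le> y" for z
      using that \<open>y \<le> 0 \<or> \<delta> \<le> x\<close> by (auto simp: p)
    then show "F y \<le> F x"
      by (intro DERIV_nonpos_imp_nonincreasing[OF that(1), of F]) (metis F order_refl)
  qed
  have "F 0 < F \<delta>"
  proof (rule DERIV_pos_imp_increasing_open[OF assms])
    show "\<exists>y. DERIV F x :> y \<and> 0 < y" if "0 < x" "x < \<delta>" for x
      using F[of x] p[of x] that by (intro exI[of _ "p x"]) (auto simp: less_le)
    show "continuous_on {0..\<delta>} F"
      using F DERIV_isCont by (blast intro: continuous_at_imp_continuous_on)
  qed
  define d where "d = F \<delta> - F 0"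
  have d: "d > 0" using \<open>F 0 < F \<delta>\<close> by (simp add: d_def)
  define B where "B x = (F x - F 0) / d" for x
  define b where "b x = p x / d" for x
  have D: "(B has_real_derivative b x) (at x)" for x
    unfolding B_def b_def using d by (auto intro!: derivative_eq_intros F)
  have sb: "smooth b"
    unfolding b_def using smooth_mult[OF smooth_const[of "1 / d"] sp] by simp
  have "partial 1 B x = b x" for x
    using partialI[OF D[of x, unfolded has_field_derivative_def], of 1] by simp
  then have "partial 1 B = b" by (rule ext)
  moreover have "B differentiable (at x)" for x
    using D[of x] by (auto simp: has_field_derivative_def differentiable_def)
  moreover have "continuous_on UNIV B"
    using D DERIV_isCont by (blast intro: continuous_at_imp_continuous_on)
  ultimately have "Ck k B" for k
    using sb by (cases k) (auto simp: smooth_def)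
  then have sB: "smooth B" by (simp add: smooth_def)
  have B0: "B x = 0" if "x \<le> 0" for x using const[of x 0] that by (simp add: B_def)
  have B1: "B x = 1" if "\<delta> \<le> x" for x using const[of \<delta> x] that d by (simp add: B_def d_def)
  have Bm: "B x \<le> B y" if "x \<le> y" for x y
    using mono[OF that] d by (simp add: B_def divide_right_mono)
  show ?thesis
  proof (rule that[OF sB D smooth_continuous[OF sb]])
    show "0 \<le> b x" for x using p d by (simp add: b_def)
    show "x \<notin> {0<..<\<delta>} \<Longrightarrow> b x = 0" for x using p by (simp add: b_def)
    show "0 \<le> B x" for x using Bm[of "min x 0" x] B0[of "min x 0"] by simp
    show "B x \<le> 1" for x using Bm[of x "max x \<delta>"] B1[of "max x \<delta>"] by simp
  qed (use B0 B1 in auto)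
qed

lemma integrable_lebesgue_on_subset:
  fixes f :: "'a::euclidean_space \<Rightarrow> real"
  assumes "integrable (lebesgue_on S) f" "A \<subseteq> S" "A \<in> sets lebesgue" "S \<in> sets lebesgue"
  shows "integrable (lebesgue_on A) f"
proof -
  have "set_integrable lebesgue S f"
    using assms by (simp add: set_integrable_def integrable_restrict_space)
  then have "set_integrable lebesgue A f"
    by (rule set_integrable_subset) (use assms in auto)
  then show ?thesis using assms by (simp add: set_integrable_def integrable_restrict_space)
qed

lemma continuous_integrable_time:
  fixes f :: "real \<Rightarrow> real"
  assumes "continuous_on {0..T} f"
  shows "integrable (lebesgue_on {0<..<T}) f"
  using continuous_imp_integrable_real[OF assms]
  by (rule integrable_lebesgue_on_subset) auto

lemma integrable_indicator_time:
  fixes f :: "real \<Rightarrow> real"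
  assumes "integrable (lebesgue_on {0<..<T}) f"
  shows "integrable (lebesgue_on {0<..<T}) (\<lambda>\<sigma>. indicator {s<..t} \<sigma> * f \<sigma>)"
proof -
  have "{s<..t} \<inter> {0<..<T} \<in> sets (lebesgue_on {0<..<T})"
    by (auto simp: sets_restrict_space)
  then have "integrable (lebesgue_on {0<..<T}) (\<lambda>\<sigma>. indicator ({s<..t} \<inter> {0<..<T}) \<sigma> *\<^sub>R f \<sigma>)"
    by (intro integrable_mult_indicator assms)
  then show ?thesis
    by (rule Bochner_Integration.integrable_cong[THEN iffD1, rotated 2]) (auto simp: indicator_def)
qed

text \<open>The weak derivative is tested with smooth approximations of the indicator of \<open>{s<..t}\<close>, built from
  two translated copies of a steep smooth step.\<close>

lemma weak_derivative_increment:
  fixes a b :: "real \<Rightarrow> real"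
  assumes cont: "continuous_on {0..T} a" and b: "integrable (lebesgue_on {0<..<T}) b"
    and test: "\<And>\<psi>. \<psi> \<in> test_functions {0<..<T} \<Longrightarrow>
      (LINT t|lebesgue_on {0<..<T}. deriv \<psi> t * a t) = - (LINT t|lebesgue_on {0<..<T}. \<psi> t * b t)"
    and st: "0 < s" "s < t" "t < T"
  shows "a t - a s = (LINT \<sigma>|lebesgue_on {0<..<T}. indicator {s<..t} \<sigma> * b \<sigma>)"
proof -
  let ?L = "lebesgue_on {0<..<T}"
  \<comment> \<open>Each step has width at most \<open>c\<close>: the rise at s is over before t,
    and the fall that starts at t is over before T.\<close>
  define c where "c = min (t - s) (T - t) / 2"
  have c: "c > 0" using st by (simp add: c_def)
  define d where "d m = c / real (Suc m)" for m
  have d: "d m > 0" "d m \<le> c" for m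
  proof -
    show "d m > 0" using c by (simp add: d_def)
    have "c / real (Suc m) \<le> c / 1" using c by (intro divide_left_mono) auto
    then show "d m \<le> c" by (simp add: d_def)
  qed
  have dlt: "d m < t - s" "d m < T - t" for m
    using d[of m] st by (auto simp: c_def min_def split: if_splits)
  have dlim: "d \<longlonglongrightarrow> 0"
  proof -
    have "(\<lambda>m. c * (1 / real (Suc m))) \<longlonglongrightarrow> c * 0"
      by (intro tendsto_intros LIMSEQ_Suc[OF lim_1_over_n])
    then show ?thesis by (simp add: d_def[abs_def])
  qed
  have "\<exists>B b. smooth B \<and> (\<forall>x. (B has_real_derivative b x) (at x)) \<and>
    continuous_on UNIV b \<and> (\<forall>x. 0 \<le> b x) \<and> (\<forall>x. x \<notin> {0<..<d m} \<longrightarrow> b x = 0) \<and>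
    (\<forall>x\<le>0. B x = 0) \<and> (\<forall>x\<ge>d m. B x = 1) \<and> (\<forall>x. 0 \<le> B x) \<and> (\<forall>x. B x \<le> (1::real))" for m
    by (rule smooth_step[OF d(1)[of m]]) blast
  then obtain B p where B: "\<And>m. smooth (B m)" "\<And>m x. (B m has_real_derivative p m x) (at x)"
    "\<And>m. continuous_on UNIV (p m)" "\<And>m x. 0 \<le> p m x" "\<And>m x. x \<notin> {0<..<d m} \<Longrightarrow> p m x = 0"
    "\<And>m x. x \<le> 0 \<Longrightarrow> B m x = 0" "\<And>m x. d m \<le> x \<Longrightarrow> B m x = 1" "\<And>m x. 0 \<le> B m x" "\<And>m x. B m x \<le> 1"
    by metis
  have pc: "continuous_on S (\<lambda>x. p m (x - \<tau>))" for S m \<tau>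
    by (rule continuous_on_compose2[OF B(3)]) (auto intro!: continuous_intros)
  \<comment> \<open>Rises from 0 to 1 right after s and falls back right after t, so its derivative
    is the difference of two approximate point masses.\<close>
  define \<psi> where "\<psi> m x = B m (x - s) - B m (x - t)" for m x
  have \<psi>_test: "\<psi> m \<in> test_functions {0<..<T}" for m
  proof (rule test_functionI[of _ "{s..t + d m}"])
    have "Ck k (\<lambda>x::real. B m (1 * (x \<bullet> 1) + (- \<tau>)))" for k \<tau>
      using B(1)[of m] by (intro Ck_compose_affine) (simp add: smooth_def)
    then have "smooth (\<lambda>x. B m (x - \<tau>))" for \<tau>
      by (simp add: smooth_def inner_real_def)
    from smooth_add[OF this[of s] smooth_mult[OF smooth_const[of "-1"] this[of t]]]
    show "smooth (\<psi> m)" by (simp add: \<psi>_def[abs_def])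
    show "{s..t + d m} \<subseteq> {0<..<T}" using st dlt[of m] by auto
    show "\<psi> m x = 0" if "x \<notin> {s..t + d m}" for x
      using that B(6)[of "x - s" m] B(6)[of "x - t" m] B(7)[of m "x - s"] B(7)[of m "x - t"] st
      by (auto simp: \<psi>_def not_le)
  qed simp
  have sh: "((\<lambda>x. B m (x - \<tau>)) has_real_derivative p m (x - \<tau>)) (at x)" for m \<tau> x
  proof -
    have "((\<lambda>x. x - \<tau>) has_real_derivative 1) (at x)" by (auto intro!: derivative_eq_intros)
    from DERIV_chain'[OF this B(2)[of m "x - \<tau>"]] show ?thesis by simp
  qed
  have \<psi>_deriv: "deriv (\<psi> m) x = p m (x - s) - p m (x - t)" for m x
  proof (rule DERIV_imp_deriv)
    show "(\<psi> m has_real_derivative p m (x - s) - p m (x - t)) (at x)"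
      unfolding \<psi>_def[abs_def] by (intro DERIV_diff sh)
  qed
  \<comment> \<open>The shifted \<open>p m\<close> has mass 1 and shrinking support just to the
    right of \<tau>; continuity of \<open>a\<close> at \<tau> gives the limit.\<close>
  have mean: "(\<lambda>m. LINT x|?L. p m (x - \<tau>) * a x) \<longlonglongrightarrow> a \<tau>" if \<tau>: "\<tau> = s \<or> \<tau> = t" for \<tau>
  proof (rule LIMSEQ_I)
    fix e :: real assume "e > 0"
    have \<tau>0: "0 < \<tau>" "\<tau> < T" "\<tau> + d m < T" for m using \<tau> st dlt[of m] by auto
    have "isCont a \<tau>"
      using cont \<tau>0 by (metis at_within_Icc_at atLeastAtMost_iff continuous_on_eq_continuous_within less_eq_real_def)
    then obtain h where h: "h > 0" "\<And>x. \<bar>x - \<tau>\<bar> < h \<Longrightarrow> \<bar>a x - a \<tau>\<bar> < e / 2"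
      unfolding continuous_at_eps_delta using \<open>e > 0\<close> by (metis dist_real_def half_gt_zero)
    obtain M where M: "\<And>m. m \<ge> M \<Longrightarrow> d m < h"
      using dlim h(1) d(1) by (force simp: LIMSEQ_iff)
    have "norm ((LINT x|?L. p m (x - \<tau>) * a x) - a \<tau>) < e" if "m \<ge> M" for m
    proof -
      have zero: "p m (x - \<tau>) = 0" if "x \<notin> {\<tau><..<\<tau> + d m}" for x
        using that by (intro B(5)) auto
      have i1: "integrable ?L (\<lambda>x. p m (x - \<tau>))" by (intro continuous_integrable_time pc)
      have i2: "integrable ?L (\<lambda>x. p m (x - \<tau>) * a x)"
        by (intro continuous_integrable_time continuous_on_mult pc cont)
      have "has_bochner_integral lborel (\<lambda>x. p m (x - \<tau>) * indicator {\<tau>..\<tau> + d m} x) (B m (\<tau> + d m - \<tau>) - B m (\<tau> - \<tau>))"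
      proof (rule has_bochner_integral_FTC_Icc_real)
        show "\<tau> \<le> \<tau> + d m" using d(1)[of m] by simp
        show "((\<lambda>x. B m (x - \<tau>)) has_real_derivative p m (x - \<tau>)) (at x)" for x
          by (rule sh)
        show "isCont (\<lambda>x. p m (x - \<tau>)) x" for x
          using pc[of UNIV m \<tau>] by (simp add: continuous_on_eq_continuous_at)
      qed
      moreover have "(\<lambda>x. p m (x - \<tau>) * indicator {\<tau>..\<tau> + d m} x) = (\<lambda>x. p m (x - \<tau>))"
      proof
        show "p m (x - \<tau>) * indicator {\<tau>..\<tau> + d m} x = p m (x - \<tau>)" for x
          using zero[of x] by (cases "x \<in> {\<tau><..<\<tau> + d m}") auto
      qed
      ultimately have "(LINT x|lborel. p m (x - \<tau>)) = 1"
        using B(6)[where x=0 and m=m] B(7)[where x="d m" and m=m] by (simp add: has_bochner_integral_iff)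
      moreover have "(LINT x|?L. p m (x - \<tau>)) = (LINT x|lborel. p m (x - \<tau>))"
      proof (rule integral_lebesgue_on_eq_lborel)
        show "(\<lambda>x. p m (x - \<tau>)) \<in> borel_measurable borel"
          by (intro borel_measurable_continuous_onI pc)
        show "p m (x - \<tau>) = 0" if "x \<notin> {0<..<T}" for x
          using that \<tau>0(1,2) \<tau>0(3)[of m] by (intro zero) auto
      qed simp
      ultimately have one: "(LINT x|?L. p m (x - \<tau>)) = 1" by simp
      have "(LINT x|?L. p m (x - \<tau>) * a x) - a \<tau> = (LINT x|?L. p m (x - \<tau>) * a x) - (LINT x|?L. p m (x - \<tau>) * a \<tau>)"
        by (simp add: one)
      also have "\<dots> = (LINT x|?L. p m (x - \<tau>) * a x - p m (x - \<tau>) * a \<tau>)"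
        using i1 i2 by simp
      also have "norm \<dots> \<le> (LINT x|?L. p m (x - \<tau>) * (e / 2))"
      proof (rule Bochner_Integration.integral_norm_bound_integral)
        show "norm (p m (x - \<tau>) * a x - p m (x - \<tau>) * a \<tau>) \<le> p m (x - \<tau>) * (e / 2)" for x
        proof (cases "x \<in> {\<tau><..<\<tau> + d m}")
          case True
          then have "\<bar>a x - a \<tau>\<bar> \<le> e / 2" using h(2)[of x] M[OF that] by fastforce
          then have "p m (x - \<tau>) * \<bar>a x - a \<tau>\<bar> \<le> p m (x - \<tau>) * (e / 2)"
            by (intro mult_left_mono B(4))
          then show ?thesis
            using B(4)[of m "x - \<tau>"] by (simp only: right_diff_distrib[symmetric] real_norm_def abs_mult abs_of_nonneg)
        qed (use zero in simp)
      qed (use i1 i2 in auto)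
      also have "\<dots> = e / 2" using one by simp
      finally show ?thesis using \<open>e > 0\<close> by simp
    qed
    then show "\<exists>M. \<forall>m\<ge>M. norm ((LINT x|?L. p m (x - \<tau>) * a x) - a \<tau>) < e" by blast
  qed
  have "(LINT x|?L. deriv (\<psi> m) x * a x) = (LINT x|?L. p m (x - s) * a x) - (LINT x|?L. p m (x - t) * a x)" for m
    unfolding \<psi>_deriv left_diff_distrib
    by (intro Bochner_Integration.integral_diff continuous_integrable_time continuous_on_mult pc cont)
  then have lim1: "(\<lambda>m. LINT x|?L. deriv (\<psi> m) x * a x) \<longlonglongrightarrow> a s - a t"
    using tendsto_diff[OF mean[of s] mean[of t]] by simp
  have eq: "(\<lambda>m. LINT x|?L. deriv (\<psi> m) x * a x) = (\<lambda>m. - (LINT x|?L. \<psi> m x * b x))"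
    using test[OF \<psi>_test] by simp
  have lim2: "(\<lambda>m. LINT x|?L. \<psi> m x * b x) \<longlonglongrightarrow> (LINT x|?L. indicator {s<..t} x * b x)"
  proof (rule integral_dominated_convergence[where w="\<lambda>x. \<bar>b x\<bar>"])
    show "(\<lambda>x. indicator {s<..t} x * b x) \<in> borel_measurable ?L"
      using integrable_indicator_time[OF b] by auto
    show "(\<lambda>x. \<psi> m x * b x) \<in> borel_measurable ?L" for m
      by (intro borel_measurable_times smooth_measurable_lebesgue[OF test_function_smooth[OF \<psi>_test]]
          borel_measurable_integrable[OF b])
    show "AE x in ?L. norm (\<psi> m x * b x) \<le> \<bar>b x\<bar>" for m
    proof (rule AE_I2)
      fix x
      have "\<bar>\<psi> m x\<bar> \<le> 1"
        using B(8)[of m "x - s"] B(8)[of m "x - t"] B(9)[of m "x - s"] B(9)[of m "x - t"] by (simp add: \<psi>_def)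
      then show "norm (\<psi> m x * b x) \<le> \<bar>b x\<bar>" by (simp add: abs_mult mult_left_le_one_le)
    qed
    \<comment> \<open>Each step is still 0 at its starting point, s or t, and eventually 1 at any
      later point, whence the half-open interval {s<..t} in the limit.\<close>
    show "AE x in ?L. (\<lambda>m. \<psi> m x * b x) \<longlonglongrightarrow> indicator {s<..t} x * b x"
    proof (rule AE_I2, rule tendsto_mult_right)
      fix x
      have ev: "\<forall>\<^sub>F m in sequentially. d m \<le> y" if "y > 0" for y
        using order_tendstoD(2)[OF dlim that] by eventually_elim simp
      have "\<forall>\<^sub>F m in sequentially. \<psi> m x = indicator {s<..t} x"
      proof (cases "x \<le> s")
        case True
        then show ?thesis using st B(6) by (simp add: \<psi>_def)
      next
        case False
        show ?thesis
        proof (cases "x \<le> t")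
          case True
          have "\<forall>\<^sub>F m in sequentially. d m \<le> x - s" using False by (intro ev) simp
          then show ?thesis
            by eventually_elim (use True False B(6,7) in \<open>simp add: \<psi>_def\<close>)
        next
          case False
          then have "\<forall>\<^sub>F m in sequentially. d m \<le> x - t" by (intro ev) simp
          then show ?thesis
            by eventually_elim (use False st B(7) in \<open>simp add: \<psi>_def\<close>)
        qed
      qed
      then show "(\<lambda>m. \<psi> m x) \<longlonglongrightarrow> indicator {s<..t} x"
        by (rule tendsto_eventually)
    qed
  qed (use b in simp)
  from LIMSEQ_unique[OF lim1[unfolded eq] tendsto_minus[OF lim2]] show ?thesis by simp
qed

section \<open>Riemann sums, Gronwall's lemma and the energy argument\<close>

text \<open>The mean over offsets c in (0, h) of the Riemann sum is the integral of \<open>f\<close>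
  over (0, K h), hence at most the full integral, so the sum cannot exceed the latter by \<eta> for
  almost every c. Almost every c also makes all K points c + k h good, since translates of a null
  set are null.\<close>

lemma averaging_offset:
  fixes f :: "real \<Rightarrow> real"
  assumes f: "integrable (lebesgue_on {0<..<T}) f" "\<And>t. 0 \<le> f t"
    and good: "AE t in lebesgue_on {0<..<T}. good t"
    and K: "K > 0" "h > 0" "real K * h \<le> T" and "\<eta> > 0"
  obtains c where "0 < c" "c < h" "\<And>k. k < K \<Longrightarrow> good (c + real k * h)"
    "h * (\<Sum>k<K. f (c + real k * h)) \<le> (LINT t|lebesgue_on {0<..<T}. f t) + \<eta>"
proof -
  let ?L = "lebesgue_on {0<..<T}"
  let ?I = "LINT t|?L. f t"
  define g where "g t = (if t \<in> {0<..<T} then f t else 0)" for t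
  have "integrable lebesgue (\<lambda>t. indicator {0<..<T} t *\<^sub>R f t)"
    using f(1) by (simp add: integrable_restrict_space)
  moreover have "(\<lambda>t. indicator {0<..<T} t *\<^sub>R f t) = g"
    by (auto simp: g_def indicator_def fun_eq_iff)
  ultimately have "g \<in> borel_measurable lebesgue" by auto
  \<comment> \<open>A Borel representative, because translation and affine substitution are carried
    out for \<open>lborel\<close>.\<close>
  then obtain f' where f': "f' \<in> borel_measurable lborel" "AE x in lborel. g x = f' x"
    using completion_ex_borel_measurable_real by blast
  define F where "F x = ennreal (f' x)" for x
  have [measurable]: "F \<in> borel_measurable borel" using f' unfolding F_def by simp
  have ok: "AE x in lborel. x \<in> {0<..<T} \<longrightarrow> good x \<and> f x = f' x"
  proof -
    have "AE x in lebesgue. x \<in> {0<..<T} \<longrightarrow> good x"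
      using good by (simp add: AE_restrict_space_iff)
    then have "AE x in lborel. x \<in> {0<..<T} \<longrightarrow> good x" by (simp add: AE_completion_iff)
    with f'(2) show ?thesis by eventually_elim (auto simp: g_def)
  qed
  have intF: "(\<integral>\<^sup>+x. F x * indicator {0<..<T} x \<partial>lborel) = ennreal ?I"
  proof -
    have "ennreal ?I = (\<integral>\<^sup>+x. ennreal (f x) \<partial>?L)"
      using f by (intro nn_integral_eq_integral[symmetric]) auto
    also have "\<dots> = (\<integral>\<^sup>+x. ennreal (f x) * indicator {0<..<T} x \<partial>lebesgue)"
      by (subst nn_integral_restrict_space) auto
    also have "\<dots> = (\<integral>\<^sup>+x. F x * indicator {0<..<T} x \<partial>lebesgue)"
    proof (rule nn_integral_cong_AE)
      have "AE x in lebesgue. x \<in> {0<..<T} \<longrightarrow> good x \<and> f x = f' x" by (rule AE_completion[OF ok])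
      then show "AE x in lebesgue. ennreal (f x) * indicator {0<..<T} x = F x * indicator {0<..<T} x"
        by eventually_elim (auto simp: F_def indicator_def)
    qed
    finally show ?thesis by (simp add: nn_integral_completion)
  qed
  have in_T: "c + real k * h \<in> {0<..<T}" if "0 < c" "c < h" "k < K" for c k
  proof -
    have "c + real k * h < h + real k * h" using that by simp
    also have "\<dots> = real (Suc k) * h" by (simp add: algebra_simps)
    also have "\<dots> \<le> real K * h" using that K by (intro mult_right_mono) auto
    finally have "c + real k * h < T" using K by simp
    moreover have "0 < c + real k * h" using that K by (simp add: add_pos_nonneg)
    ultimately show ?thesis by simp
  qed
  have shift: "AE c in lborel. c + real k * h \<in> {0<..<T} \<longrightarrow> good (c + real k * h) \<and> f (c + real k * h) = f' (c + real k * h)" for k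
  proof -
    obtain N where N: "{x \<in> space lborel. \<not> (x \<in> {0<..<T} \<longrightarrow> good x \<and> f x = f' x)} \<subseteq> N"
      "emeasure lborel N = 0" "N \<in> sets lborel"
      using AE_E[OF ok] .
    have "AE x in lborel. x \<notin> N" using N(2,3) by (intro AE_not_in null_setsI)
    then have "AE c in lborel. real k * h + 1 * c \<notin> N"
      using N(3) by (intro AE_borel_affine) auto
    then show ?thesis
      by (rule AE_mp) (use N(1) in \<open>auto simp: add.commute\<close>)
  qed
  have ok': "AE c in lborel. \<forall>k\<in>{..<K}. c + real k * h \<in> {0<..<T} \<longrightarrow> good (c + real k * h) \<and> f (c + real k * h) = f' (c + real k * h)"
    by (intro AE_ball_countable[THEN iffD2] ballI shift) auto
  have "\<exists>c. 0 < c \<and> c < h \<and> (\<forall>k<K. good (c + real k * h)) \<and> h * (\<Sum>k<K. f (c + real k * h)) \<le> ?I + \<eta>"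
  \<comment> \<open>If every offset failed, integrating the reverse inequality over c in (0, h)
    would give (I + \<eta>) h \<le> h I, where I is the integral of \<open>f\<close>.\<close>
  proof (rule ccontr)
    assume no: "\<not> ?thesis"
    have I0: "0 \<le> ?I" using f(2) by simp
    have "ennreal (?I + \<eta>) * ennreal h = (\<integral>\<^sup>+c. ennreal (?I + \<eta>) * indicator {0<..<h} c \<partial>lborel)"
      using K(2) by (simp add: nn_integral_cmult_indicator)
    also have "\<dots> \<le> (\<integral>\<^sup>+c. (ennreal h * (\<Sum>k<K. F (c + real k * h))) * indicator {0<..<h} c \<partial>lborel)"
    proof (rule nn_integral_mono_AE)
      show "AE c in lborel. ennreal (?I + \<eta>) * indicator {0<..<h} c \<le> (ennreal h * (\<Sum>k<K. F (c + real k * h))) * indicator {0<..<h} c"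
        using ok'
      proof eventually_elim
        case (elim c)
        show ?case
        proof (cases "c \<in> {0<..<h}")
          case True
          then have g: "good (c + real k * h)" "f (c + real k * h) = f' (c + real k * h)" if "k < K" for k
            using elim in_T[of c k] that by auto
          have "?I + \<eta> \<le> h * (\<Sum>k<K. f (c + real k * h))"
            using no True g(1) by force
          also have "\<dots> = h * (\<Sum>k<K. f' (c + real k * h))"
            using g(2) by simp
          finally have "ennreal (?I + \<eta>) \<le> ennreal (h * (\<Sum>k<K. f' (c + real k * h)))" by (rule ennreal_leI)
          also have "\<dots> = ennreal h * ennreal (\<Sum>k<K. f' (c + real k * h))"
            using K(2) by (intro ennreal_mult') simp
          also have "ennreal (\<Sum>k<K. f' (c + real k * h)) = (\<Sum>k<K. F (c + real k * h))"
            unfolding F_def using g(2) f(2) by (intro sum_ennreal[symmetric]) (metis lessThan_iff)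
          finally show ?thesis using True by simp
        qed simp
      qed
    qed
    also have "\<dots> = ennreal h * (\<integral>\<^sup>+c. (\<Sum>k<K. F (c + real k * h) * indicator {0<..<h} c) \<partial>lborel)"
      by (subst nn_integral_cmult[symmetric]) (auto simp: mult.assoc sum_distrib_right)
    also have "(\<integral>\<^sup>+c. (\<Sum>k<K. F (c + real k * h) * indicator {0<..<h} c) \<partial>lborel)
        = (\<Sum>k<K. \<integral>\<^sup>+c. F (c + real k * h) * indicator {0<..<h} c \<partial>lborel)"
      by (rule nn_integral_sum) measurable
    also have "\<dots> = (\<Sum>k<K. \<integral>\<^sup>+x. F x * indicator {real k * h<..<real k * h + h} x \<partial>lborel)"
    proof (rule sum.cong[OF refl])
      fix k
      have "(\<integral>\<^sup>+x. F x * indicator {real k * h<..<real k * h + h} x \<partial>lborel)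
          = (\<integral>\<^sup>+c. F (real k * h + 1 * c) * indicator {real k * h<..<real k * h + h} (real k * h + 1 * c) \<partial>lborel)"
        by (subst nn_integral_real_affine[of _ 1 "real k * h"]) auto
      also have "\<dots> = (\<integral>\<^sup>+c. F (c + real k * h) * indicator {0<..<h} c \<partial>lborel)"
        by (intro nn_integral_cong) (auto simp: indicator_def add.commute)
      finally show "(\<integral>\<^sup>+c. F (c + real k * h) * indicator {0<..<h} c \<partial>lborel)
          = (\<integral>\<^sup>+x. F x * indicator {real k * h<..<real k * h + h} x \<partial>lborel)" by simp
    qed
    also have "\<dots> = (\<integral>\<^sup>+x. (\<Sum>k<K. F x * indicator {real k * h<..<real k * h + h} x) \<partial>lborel)"
      by (rule nn_integral_sum[symmetric]) measurable
    \<comment> \<open>The K translated intervals are disjoint and lie in (0, T), so their integrals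
      add up to at most the whole.\<close>
    also have "\<dots> \<le> (\<integral>\<^sup>+x. F x * indicator {0<..<T} x \<partial>lborel)"
    proof (rule nn_integral_mono)
      fix x
      have disj: "disjoint_family_on (\<lambda>k. {real k * h<..<real k * h + h}) {..<K}"
      proof (unfold disjoint_family_on_def, intro ballI impI)
        have lt: "{real k * h<..<real k * h + h} \<inter> {real l * h<..<real l * h + h} = {}" if "k < l" for k l :: nat
        proof -
          have "real (Suc k) * h \<le> real l * h" using that K(2) by (intro mult_right_mono) auto
          then show ?thesis by (auto simp: algebra_simps)
        qed
        fix k l :: nat assume "k \<noteq> l"
        then show "{real k * h<..<real k * h + h} \<inter> {real l * h<..<real l * h + h} = {}"
          using lt[of k l] lt[of l k] by (cases k l rule: linorder_cases) auto
      qed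
      have sub: "(\<Union>k<K. {real k * h<..<real k * h + h}) \<subseteq> {0<..<T}"
        using in_T[of "x - real k * h" k for x k] by (fastforce simp: algebra_simps)
      then have "indicator (\<Union>k<K. {real k * h<..<real k * h + h}) x \<le> (indicator {0<..<T} x :: ennreal)"
        by (intro indicator_leI) (rule subsetD[OF sub])
      moreover have "(\<Sum>k<K. indicator {real k * h<..<real k * h + h} x) = (indicator (\<Union>k<K. {real k * h<..<real k * h + h}) x :: ennreal)"
        by (rule indicator_UN_disjoint[OF _ disj, symmetric]) simp
      ultimately show "(\<Sum>k<K. F x * indicator {real k * h<..<real k * h + h} x) \<le> F x * indicator {0<..<T} x"
        by (simp add: sum_distrib_left[symmetric] mult_left_mono)
    qed
    also note intF
    finally have "ennreal (?I + \<eta>) * ennreal h \<le> ennreal h * ennreal ?I" by (simp add: mult_left_mono)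
    moreover have "ennreal ((?I + \<eta>) * h) = ennreal (?I + \<eta>) * ennreal h"
      by (rule ennreal_mult) (use I0 K(2) \<open>\<eta> > 0\<close> in auto)
    moreover have "ennreal (h * ?I) = ennreal h * ennreal ?I"
      by (rule ennreal_mult) (use I0 K(2) in auto)
    ultimately have "ennreal ((?I + \<eta>) * h) \<le> ennreal (h * ?I)" by simp
    then have "(?I + \<eta>) * h \<le> h * ?I"
      by (subst (asm) ennreal_le_iff) (use I0 K(2) in auto)
    with K(2) \<open>\<eta> > 0\<close> show False by (simp add: algebra_simps mult_le_0_iff)
  qed
  then show ?thesis using that by blast
qed

text \<open>The product of exp (- C t) and the integral of E over (0, t) starts at 0 and is
  nonincreasing; thus that integral is at most 0, and the hypothesis passes this on to E
  itself.\<close>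

lemma Gronwall_zero:
  fixes E :: "real \<Rightarrow> real"
  assumes cont: "continuous_on {0..T} E" and "C \<ge> 0"
    and le: "\<And>t. 0 < t \<Longrightarrow> t < T \<Longrightarrow> E t \<le> C * (LINT \<sigma>|lebesgue_on {0<..<T}. indicator {0<..t} \<sigma> * E \<sigma>)"
    and t: "0 < t" "t < T"
  shows "E t \<le> 0"
proof -
  \<comment> \<open>Translates the indicator form used for all time integrals into the integral over
    {0..x} to which the differentiation rule applies.\<close>
  have F_eq: "(LINT \<sigma>|lebesgue_on {0<..<T}. indicator {0<..x} \<sigma> * E \<sigma>) = integral {0..x} E" if "0 < x" "x < T" for x
  proof -
    have c: "continuous_on {0..x} E" using cont by (rule continuous_on_subset) (use that in auto)
    have "(LINT \<sigma>|lebesgue_on {0<..<T}. indicator {0<..x} \<sigma> * E \<sigma>)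
        = (LINT \<sigma>|lebesgue. indicator {0<..<T} \<sigma> *\<^sub>R (indicator {0<..x} \<sigma> * E \<sigma>))"
      by (subst integral_restrict_space) auto
    also have "\<dots> = (LINT \<sigma>|lebesgue. indicator {0<..x} \<sigma> *\<^sub>R E \<sigma>)"
      using that by (intro Bochner_Integration.integral_cong) (auto simp: indicator_def)
    also have "\<dots> = (LINT \<sigma>|lebesgue_on {0<..x}. E \<sigma>)"
      by (subst integral_restrict_space) auto
    also have "\<dots> = integral {0<..x} E"
      by (intro lebesgue_integral_eq_integral integrable_lebesgue_on_subset[OF continuous_imp_integrable_real[OF c]]) auto
    also have "\<dots> = integral {0..x} E"
    proof (rule integral_subset_negligible)
      have "{0..x} - {0<..x} = {0}" using that by auto
      then show "negligible ({0..x} - {0<..x})" by simp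
    qed auto
    finally show ?thesis .
  qed
  define G where "G x = integral {0..x} E * exp (- (C * x))" for x
  have ct: "continuous_on {0..t} E" using cont by (rule continuous_on_subset) (use t in auto)
  have "G 0 \<ge> G t"
  proof (rule DERIV_nonpos_imp_decreasing_open[of 0 t G])
    show "0 \<le> t" using t by simp
    have "continuous_on {0..t} (\<lambda>x. integral {0..x} E)"
      by (intro indefinite_integral_continuous_1 integrable_continuous_real ct)
    then show "continuous_on {0..t} G"
      unfolding G_def[abs_def] by (intro continuous_intros)
    show "\<exists>y. DERIV G x :> y \<and> y \<le> 0" if x: "0 < x" "x < t" for x
    proof (intro exI conjI)
      have "((\<lambda>u. integral {0..u} E) has_real_derivative E x) (at x within {0..t})"
        by (rule integral_has_real_derivative[OF ct]) (use x in auto)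
      then have "((\<lambda>u. integral {0..u} E) has_real_derivative E x) (at x)"
        using x by (simp add: at_within_Icc_at)
      then show "DERIV G x :> (E x - C * integral {0..x} E) * exp (- (C * x))"
        unfolding G_def[abs_def] by (auto intro!: derivative_eq_intros simp: algebra_simps)
      show "(E x - C * integral {0..x} E) * exp (- (C * x)) \<le> 0"
        using le[of x] F_eq[of x] x t by (intro mult_nonpos_nonneg) auto
    qed
  qed
  then have "integral {0..t} E \<le> 0" by (simp add: G_def mult_le_0_iff)
  with le[OF t] F_eq[OF t] \<open>C \<ge> 0\<close> show ?thesis
    using mult_nonneg_nonpos[of C "integral {0..t} E"] by simp
qed

text \<open>The increment bound \<open>incr\<close> is available only at good times \<open>t\<close>. It is summed over a partition
  \<open>c + k h\<close>, whose offset \<open>c\<close> is chosen by averaging so that all partition points are good and the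
  Riemann sum of \<open>r\<^sup>2\<close> is controlled by its integral.\<close>

lemma energy_estimate_zero:
  fixes E n :: "real \<Rightarrow> real" and a :: "real \<Rightarrow> real \<Rightarrow> real"
  assumes T: "T > 0" and cont: "continuous_on {0..T} E" and E0: "E 0 = 0" and E_nonneg: "\<And>t. 0 \<le> E t"
    and C: "C \<ge> 0"
    and n: "n \<in> borel_measurable (lebesgue_on {0<..<T})" "integrable (lebesgue_on {0<..<T}) (\<lambda>t. (n t)\<^sup>2)"
    and good: "AE t in lebesgue_on {0<..<T}. good t"
    and incr: "\<And>s t. 0 < s \<Longrightarrow> s < t \<Longrightarrow> t < T \<Longrightarrow> good t \<Longrightarrow>
      integrable (lebesgue_on {0<..<T}) (a t) \<and> E t - E s \<le> (LINT \<sigma>|lebesgue_on {0<..<T}. indicator {s<..t} \<sigma> * a t \<sigma>)"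
    and bound: "\<And>\<eta>. \<eta> > 0 \<Longrightarrow> \<exists>r h0. h0 > 0 \<and> r \<in> borel_measurable (lebesgue_on {0<..<T}) \<and>
      integrable (lebesgue_on {0<..<T}) (\<lambda>t. (r t)\<^sup>2) \<and> (LINT t|lebesgue_on {0<..<T}. (r t)\<^sup>2) \<le> \<eta> \<and>
      (AE t in lebesgue_on {0<..<T}. AE \<sigma> in lebesgue_on {0<..<T}. \<bar>t - \<sigma>\<bar> < h0 \<longrightarrow> a t \<sigma> \<le> C * E \<sigma> + n \<sigma> * (r t + \<eta> + r \<sigma>))"
    and t: "0 < t" "t < T"
  shows "E t = 0"
proof -
  let ?L = "lebesgue_on {0<..<T}"
  define D where "D = (LINT t|?L. (n t)\<^sup>2)"
  have D0: "D \<ge> 0" by (simp add: D_def)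
  have intE: "integrable ?L E" by (rule continuous_integrable_time[OF cont])
  have const: "integrable ?L (\<lambda>t. x::real)" for x by (rule continuous_integrable_time) simp
  have len: "(LINT \<sigma>|?L. indicator {s<..u} \<sigma> * (x::real)) = (u - s) * x" if "0 < s" "s \<le> u" "u < T" for s u x
  proof -
    have "(LINT \<sigma>|?L. indicator {s<..u} \<sigma> * x) = (LINT \<sigma>|lebesgue. indicator {0<..<T} \<sigma> *\<^sub>R (indicator {s<..u} \<sigma> * x))"
      by (subst integral_restrict_space) auto
    also have "\<dots> = (LINT \<sigma>|lebesgue. indicator {s<..u} \<sigma> * x)"
      using that by (intro Bochner_Integration.integral_cong) (auto simp: indicator_def)
    also have "\<dots> = (u - s) * x" using that by (simp add: measure_completion)
    finally show ?thesis .
  qed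
  have main: "E t1 \<le> C * (LINT \<sigma>|?L. indicator {0<..t1} \<sigma> * E \<sigma>)" if t1: "0 < t1" "t1 < T" for t1
  proof (rule field_le_epsilon)
    fix e :: real assume "e > 0"
    \<comment> \<open>The error will be \<eta> D plus three times \<eta>: one from the approximation
      terms and one from each end of the partition.\<close>
    define \<eta> where "\<eta> = e / (3 + D)"
    have \<eta>: "\<eta> > 0" using \<open>e > 0\<close> D0 by (simp add: \<eta>_def)
    \<comment> \<open>The tolerance handed to \<open>bound\<close>. It is chosen after \<eta>, small
      enough that \<open>q * (\<theta>\<^sup>2 * T + 3 * \<theta>)\<close> is at most \<eta>
      although q grows as \<eta> shrinks.\<close>
    define \<theta> where "\<theta> = min 1 (4 * \<eta>\<^sup>2 / (3 * (T + 3)))"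
    have \<theta>: "\<theta> > 0" "\<theta> \<le> 1" using \<eta> T by (auto simp: \<theta>_def)
    \<comment> \<open>From Young's inequality n x \<le> \<eta> n^2 + x^2 / (4 \<eta>), where x is a
      sum of three terms and x^2 is at most 3 times the sum of their squares.\<close>
    define q where "q = 3 / (4 * \<eta>)"
    have q: "q > 0" using \<eta> by (simp add: q_def)
    have q\<theta>: "q * (\<theta>\<^sup>2 * T + 3 * \<theta>) \<le> \<eta>"
    proof -
      have "\<theta>\<^sup>2 \<le> \<theta>" using \<theta> by (simp add: power2_eq_square mult_left_le)
      then have "\<theta>\<^sup>2 * T + 3 * \<theta> \<le> \<theta> * (T + 3)" using T by (simp add: algebra_simps mult_right_mono)
      also have "\<dots> \<le> (4 * \<eta>\<^sup>2 / (3 * (T + 3))) * (T + 3)" using T by (intro mult_right_mono) (auto simp: \<theta>_def)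
      also have "\<dots> = 4 * \<eta>\<^sup>2 / 3" using T by (simp add: field_simps)
      finally have "q * (\<theta>\<^sup>2 * T + 3 * \<theta>) \<le> q * (4 * \<eta>\<^sup>2 / 3)" using q by (intro mult_left_mono) auto
      also have "\<dots> = \<eta>" using \<eta> by (simp add: q_def power2_eq_square)
      finally show ?thesis .
    qed
    obtain r h0 where r: "h0 > 0" "r \<in> borel_measurable ?L" "integrable ?L (\<lambda>t. (r t)\<^sup>2)" "(LINT t|?L. (r t)\<^sup>2) \<le> \<theta>"
      "AE t in ?L. AE \<sigma> in ?L. \<bar>t - \<sigma>\<bar> < h0 \<longrightarrow> a t \<sigma> \<le> C * E \<sigma> + n \<sigma> * (r t + \<theta> + r \<sigma>)"
      using bound[OF \<theta>(1)] by blast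
    have "uniformly_continuous_on {0..T} E"
      by (intro compact_uniformly_continuous cont) auto
    then obtain d where d: "d > 0" "\<And>x y. x \<in> {0..T} \<Longrightarrow> y \<in> {0..T} \<Longrightarrow> \<bar>x - y\<bar> < d \<Longrightarrow> \<bar>E x - E y\<bar> < \<eta>"
      unfolding uniformly_continuous_on_def dist_real_def using \<eta> by metis
    obtain K0 :: nat where K0: "t1 / min h0 d < real K0"
      using reals_Archimedean2 by blast
    \<comment> \<open>The mesh is fine enough for both the approximation (\<open>h0\<close>) and the
      uniform continuity of E (\<open>d\<close>). The form \<open>Suc K0\<close> lets a sum over the
      partition points be split at its first term.\<close>
    define K where "K = Suc K0"
    define h where "h = t1 / real K"
    have h: "h > 0" "h < h0" "h < d" "real K * h = t1"
    proof -
      show "h > 0" "real K * h = t1" using t1 by (auto simp: h_def K_def)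
      have "t1 < real K0 * min h0 d" using K0 r(1) d(1) by (simp add: divide_less_eq)
      also have "\<dots> < real K * min h0 d" using r(1) d(1) by (simp add: K_def algebra_simps)
      finally have "real K * h < real K * min h0 d" using \<open>real K * h = t1\<close> by simp
      then have "h < min h0 d" by (rule mult_left_less_imp_less) simp
      then show "h < h0" "h < d" by auto
    qed
    \<comment> \<open>The whole almost-every statement in \<sigma> is made part of being good, so
      that the choice of offset provides it at each partition point.\<close>
    have "AE t in ?L. good t \<and> (AE \<sigma> in ?L. \<bar>t - \<sigma>\<bar> < h0 \<longrightarrow> a t \<sigma> \<le> C * E \<sigma> + n \<sigma> * (r t + \<theta> + r \<sigma>))"
      using good r(5) by eventually_elim simp
    from averaging_offset[OF r(3) _ this, of K h \<theta>] obtain c where c: "0 < c" "c < h"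
      and gd: "\<And>k. k < K \<Longrightarrow> good (c + real k * h) \<and> (AE \<sigma> in ?L. \<bar>c + real k * h - \<sigma>\<bar> < h0 \<longrightarrow> a (c + real k * h) \<sigma> \<le> C * E \<sigma> + n \<sigma> * (r (c + real k * h) + \<theta> + r \<sigma>))"
      and sum_le: "h * (\<Sum>k<K. (r (c + real k * h))\<^sup>2) \<le> (LINT t|?L. (r t)\<^sup>2) + \<theta>"
      using h t1 \<theta> by (auto simp: K_def)
    define \<tau> where "\<tau> k = c + real k * h" for k
    have \<tau>_Suc: "\<tau> (Suc k) = \<tau> k + h" for k by (simp add: \<tau>_def algebra_simps)
    have \<tau>_pos: "0 < \<tau> k" for k using c h by (simp add: \<tau>_def add_pos_nonneg)
    have \<tau>_lt: "\<tau> k < t1" if "k < K" for k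
    proof -
      have "\<tau> k < real (Suc k) * h" using c by (simp add: \<tau>_def algebra_simps)
      also have "\<dots> \<le> real K * h" using that h by (intro mult_right_mono) auto
      finally show ?thesis using h by simp
    qed
    \<comment> \<open>Collects the terms that depend on \<sigma>; the value of \<open>r\<close> at
      the right end point is constant on the subinterval and is kept apart for the Riemann
      sum.\<close>
    define G where "G \<sigma> = C * E \<sigma> + \<eta> * (n \<sigma>)\<^sup>2 + q * (\<theta>\<^sup>2 + (r \<sigma>)\<^sup>2)" for \<sigma>
    have intG: "integrable ?L G"
      unfolding G_def[abs_def] using intE n(2) r(3) const by simp
    note ind = integrable_indicator_time
    have step: "E (\<tau> (Suc k)) - E (\<tau> k) \<le> (LINT \<sigma>|?L. indicator {\<tau> k<..\<tau> (Suc k)} \<sigma> * G \<sigma>) + q * h * (r (\<tau> (Suc k)))\<^sup>2"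
      if k: "Suc k < K" for k
    proof -
      let ?R = "r (\<tau> (Suc k))"
      have lt: "0 < \<tau> k" "\<tau> k < \<tau> (Suc k)" "\<tau> (Suc k) < T"
        using \<tau>_pos \<tau>_Suc h \<tau>_lt[OF k] t1 by auto
      have g: "good (\<tau> (Suc k))" "AE \<sigma> in ?L. \<bar>\<tau> (Suc k) - \<sigma>\<bar> < h0 \<longrightarrow> a (\<tau> (Suc k)) \<sigma> \<le> C * E \<sigma> + n \<sigma> * (?R + \<theta> + r \<sigma>)"
        using gd[OF k] by (auto simp: \<tau>_def)
      note i = incr[OF lt g(1)]
      have "E (\<tau> (Suc k)) - E (\<tau> k) \<le> (LINT \<sigma>|?L. indicator {\<tau> k<..\<tau> (Suc k)} \<sigma> * a (\<tau> (Suc k)) \<sigma>)"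
        using i by simp
      also have "\<dots> \<le> (LINT \<sigma>|?L. indicator {\<tau> k<..\<tau> (Suc k)} \<sigma> * (G \<sigma> + q * ?R\<^sup>2))"
      proof (rule integral_mono_AE)
        show "AE \<sigma> in ?L. indicator {\<tau> k<..\<tau> (Suc k)} \<sigma> * a (\<tau> (Suc k)) \<sigma> \<le> indicator {\<tau> k<..\<tau> (Suc k)} \<sigma> * (G \<sigma> + q * ?R\<^sup>2)"
          using g(2)
        proof eventually_elim
          case (elim \<sigma>)
          show ?case
          proof (cases "\<sigma> \<in> {\<tau> k<..\<tau> (Suc k)}")
            case True
            then have "\<bar>\<tau> (Suc k) - \<sigma>\<bar> < h0" using h \<tau>_Suc[of k] by auto
            with elim have "a (\<tau> (Suc k)) \<sigma> \<le> C * E \<sigma> + n \<sigma> * (?R + \<theta> + r \<sigma>)" by simp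
            also have "n \<sigma> * (?R + \<theta> + r \<sigma>) \<le> \<eta> * (n \<sigma>)\<^sup>2 + (?R + \<theta> + r \<sigma>)\<^sup>2 / (4 * \<eta>)"
            proof -
              have "0 \<le> \<eta> * (n \<sigma> - (?R + \<theta> + r \<sigma>) / (2 * \<eta>))\<^sup>2" using \<eta> by simp
              also have "\<dots> = \<eta> * (n \<sigma>)\<^sup>2 + (?R + \<theta> + r \<sigma>)\<^sup>2 / (4 * \<eta>) - n \<sigma> * (?R + \<theta> + r \<sigma>)"
                using \<eta> by (simp add: power2_diff power_divide power_mult_distrib field_simps) (simp add: power2_eq_square)
              finally show ?thesis by simp
            qed
            also have "(?R + \<theta> + r \<sigma>)\<^sup>2 / (4 * \<eta>) \<le> q * (?R\<^sup>2 + \<theta>\<^sup>2 + (r \<sigma>)\<^sup>2)"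
            proof -
              have "(x + y + z)\<^sup>2 \<le> 3 * (x\<^sup>2 + y\<^sup>2 + z\<^sup>2)" for x y z :: real
                using zero_le_power2[of "x - y"] zero_le_power2[of "y - z"] zero_le_power2[of "x - z"]
                by (simp add: power2_eq_square algebra_simps)
              then have "(?R + \<theta> + r \<sigma>)\<^sup>2 / (4 * \<eta>) \<le> 3 * (?R\<^sup>2 + \<theta>\<^sup>2 + (r \<sigma>)\<^sup>2) / (4 * \<eta>)"
                using \<eta> by (intro divide_right_mono) auto
              then show ?thesis by (simp add: q_def)
            qed
            finally have "a (\<tau> (Suc k)) \<sigma> \<le> G \<sigma> + q * ?R\<^sup>2"
              by (simp add: G_def algebra_simps)
            with True show ?thesis by simp
          qed simp
        qed
      qed (use i ind intG const in auto)
      also have "\<dots> = (LINT \<sigma>|?L. indicator {\<tau> k<..\<tau> (Suc k)} \<sigma> * G \<sigma>) + (LINT \<sigma>|?L. indicator {\<tau> k<..\<tau> (Suc k)} \<sigma> * (q * ?R\<^sup>2))"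
        unfolding distrib_left by (intro Bochner_Integration.integral_add ind intG const)
      also have "(LINT \<sigma>|?L. indicator {\<tau> k<..\<tau> (Suc k)} \<sigma> * (q * ?R\<^sup>2)) = q * h * ?R\<^sup>2"
        using len[of "\<tau> k" "\<tau> (Suc k)" "q * ?R\<^sup>2"] lt by (simp add: \<tau>_Suc)
      finally show ?thesis .
    qed
    \<comment> \<open>Telescoping runs only between partition points inside (0, t1); the remainders
      at both ends are left to uniform continuity of E.\<close>
    have tele: "E (\<tau> m) - E (\<tau> 0) \<le> (LINT \<sigma>|?L. indicator {\<tau> 0<..\<tau> m} \<sigma> * G \<sigma>) + q * h * (\<Sum>k<m. (r (\<tau> (Suc k)))\<^sup>2)"
      if "m < K" for m
      using that
    proof (induction m)
      case (Suc m)
      have "\<tau> 0 \<le> \<tau> m" "\<tau> m \<le> \<tau> (Suc m)" using h by (auto simp: \<tau>_def)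
      then have "indicator {\<tau> 0<..\<tau> (Suc m)} \<sigma> * G \<sigma> = indicator {\<tau> 0<..\<tau> m} \<sigma> * G \<sigma> + indicator {\<tau> m<..\<tau> (Suc m)} \<sigma> * G \<sigma>" for \<sigma>
        by (auto simp: indicator_def)
      then have "(LINT \<sigma>|?L. indicator {\<tau> 0<..\<tau> (Suc m)} \<sigma> * G \<sigma>)
          = (LINT \<sigma>|?L. indicator {\<tau> 0<..\<tau> m} \<sigma> * G \<sigma>) + (LINT \<sigma>|?L. indicator {\<tau> m<..\<tau> (Suc m)} \<sigma> * G \<sigma>)"
        using Bochner_Integration.integral_add[OF ind[OF intG] ind[OF intG]] by simp
      with Suc step[OF Suc.prems] show ?case by (simp add: algebra_simps)
    qed simp
    have K1: "K - 1 < K" "Suc (K - 1) = K" by (auto simp: K_def)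
    \<comment> \<open>The right end points are the points with index 1 to K - 1; including index 0
      only adds a nonnegative term.\<close>
    have "(\<Sum>k<K - 1. (r (\<tau> (Suc k)))\<^sup>2) \<le> (\<Sum>k<K. (r (\<tau> k))\<^sup>2)"
    proof -
      have "(\<Sum>k<K. (r (\<tau> k))\<^sup>2) = (r (\<tau> 0))\<^sup>2 + (\<Sum>k<K - 1. (r (\<tau> (Suc k)))\<^sup>2)"
        unfolding K_def by (subst sum.lessThan_Suc_shift) simp
      then show ?thesis by simp
    qed
    then have "h * (\<Sum>k<K - 1. (r (\<tau> (Suc k)))\<^sup>2) \<le> h * (\<Sum>k<K. (r (\<tau> k))\<^sup>2)"
      using h by (intro mult_left_mono) auto
    also have "\<dots> \<le> 2 * \<theta>" using sum_le r(4) by (simp add: \<tau>_def)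
    finally have s2: "q * h * (\<Sum>k<K - 1. (r (\<tau> (Suc k)))\<^sup>2) \<le> q * (2 * \<theta>)"
      using q by (simp add: mult.assoc)
    have "(LINT \<sigma>|?L. indicator {\<tau> 0<..\<tau> (K - 1)} \<sigma> * G \<sigma>)
        \<le> (LINT \<sigma>|?L. C * (indicator {0<..t1} \<sigma> * E \<sigma>) + (\<eta> * (n \<sigma>)\<^sup>2 + q * (\<theta>\<^sup>2 + (r \<sigma>)\<^sup>2)))"
    proof (rule integral_mono)
      show "integrable ?L (\<lambda>\<sigma>. C * (indicator {0<..t1} \<sigma> * E \<sigma>) + (\<eta> * (n \<sigma>)\<^sup>2 + q * (\<theta>\<^sup>2 + (r \<sigma>)\<^sup>2)))"
        using ind[OF intE] n(2) r(3) const by simp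
      show "indicator {\<tau> 0<..\<tau> (K - 1)} \<sigma> * G \<sigma> \<le> C * (indicator {0<..t1} \<sigma> * E \<sigma>) + (\<eta> * (n \<sigma>)\<^sup>2 + q * (\<theta>\<^sup>2 + (r \<sigma>)\<^sup>2))" for \<sigma>
      proof -
        have "0 \<le> \<eta> * (n \<sigma>)\<^sup>2 + q * (\<theta>\<^sup>2 + (r \<sigma>)\<^sup>2)" "0 \<le> C * E \<sigma>"
          using \<eta> q C E_nonneg by auto
        moreover have "\<sigma> \<in> {0<..t1}" if "\<sigma> \<in> {\<tau> 0<..\<tau> (K - 1)}"
          using that \<tau>_pos[of 0] \<tau>_lt[OF K1(1)] by auto
        ultimately show ?thesis by (auto simp: indicator_def G_def)
      qed
    qed (rule ind[OF intG])
    also have "\<dots> = C * (LINT \<sigma>|?L. indicator {0<..t1} \<sigma> * E \<sigma>) + (\<eta> * D + q * (T * \<theta>\<^sup>2 + (LINT \<sigma>|?L. (r \<sigma>)\<^sup>2)))"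
    proof -
      have "(LINT \<sigma>|?L. \<theta>\<^sup>2) = T * \<theta>\<^sup>2"
        using T by (simp add: measure_restrict_space measure_completion)
      then show ?thesis
        using ind[OF intE] n(2) r(3) const by (simp add: D_def)
    qed
    also have "\<dots> \<le> C * (LINT \<sigma>|?L. indicator {0<..t1} \<sigma> * E \<sigma>) + (\<eta> * D + q * (T * \<theta>\<^sup>2 + \<theta>))"
      using r(4) q by (intro add_left_mono mult_left_mono) auto
    \<comment> \<open>The summand 3 \<theta> consists of \<theta> for the integral of r^2 and 2
      \<theta> for its Riemann sum.\<close>
    finally have "E (\<tau> (K - 1)) - E (\<tau> 0) \<le> C * (LINT \<sigma>|?L. indicator {0<..t1} \<sigma> * E \<sigma>) + \<eta> * D + q * (\<theta>\<^sup>2 * T + 3 * \<theta>)"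
      using tele[OF K1(1)] s2 by (simp add: algebra_simps)
    then have "E (\<tau> (K - 1)) - E (\<tau> 0) \<le> C * (LINT \<sigma>|?L. indicator {0<..t1} \<sigma> * E \<sigma>) + \<eta> * D + \<eta>"
      using q\<theta> by linarith
    moreover have "E (\<tau> 0) \<le> \<eta>"
      using d(2)[of "\<tau> 0" 0] \<tau>_lt[of 0] K1(1) c h t1 E0 by (simp add: \<tau>_def)
    moreover have "E t1 \<le> E (\<tau> (K - 1)) + \<eta>"
    proof -
      have "\<tau> (K - 1) = c + (t1 - h)"
        using h(4) by (simp add: \<tau>_def K_def algebra_simps)
      then have "\<bar>t1 - \<tau> (K - 1)\<bar> < d" using c h by auto
      with d(2)[of t1 "\<tau> (K - 1)"] \<tau>_pos[of "K - 1"] \<tau>_lt[OF K1(1)] t1 show ?thesis by simp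
    qed
    moreover have "\<eta> * (3 + D) = e" using D0 by (simp add: \<eta>_def)
    ultimately show "E t1 \<le> C * (LINT \<sigma>|?L. indicator {0<..t1} \<sigma> * E \<sigma>) + e"
      by (simp add: algebra_simps)
  qed
  show ?thesis
    using Gronwall_zero[OF cont C main t] E_nonneg[of t] by simp
qed

section \<open>Measurability in time of real quantities attached to L2_time\<close>

text \<open>By completeness of Lebesgue measure \<open>g\<close> may be compared with the measurable
  function \<open>lim\<close> of the sequence, from which it differs on a null set only.\<close>

lemma borel_measurable_AE_LIMSEQ:
  fixes f :: "nat \<Rightarrow> real \<Rightarrow> real"
  assumes S: "S \<in> sets lebesgue" and f: "\<And>n. f n \<in> borel_measurable (lebesgue_on S)"
    and lim: "AE x in lebesgue_on S. (\<lambda>n. f n x) \<longlonglongrightarrow> g x"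
  shows "g \<in> borel_measurable (lebesgue_on S)"
proof -
  define G where "G x = lim (\<lambda>n. f n x)" for x
  have "G \<in> borel_measurable (lebesgue_on S)"
    unfolding G_def using f by (rule borel_measurable_lim_metric)
  then have "(\<lambda>x. if x \<in> S then G x else 0) \<in> borel_measurable lebesgue"
    using S by (simp add: borel_measurable_if)
  moreover have "AE x in lebesgue. (if x \<in> S then G x else 0) = (if x \<in> S then g x else 0)"
  proof -
    have "AE x in lebesgue. x \<in> S \<longrightarrow> (\<lambda>n. f n x) \<longlonglongrightarrow> g x"
      using lim S by (simp add: AE_restrict_space_iff)
    then show ?thesis
      by eventually_elim (auto simp: G_def limI)
  qed
  ultimately have "(\<lambda>x. if x \<in> S then g x else 0) \<in> borel_measurable lebesgue"
    by (rule borel_measurable_AE)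
  then show ?thesis using S by (simp add: borel_measurable_if)
qed

lemma L2_timeE:
  assumes "u \<in> L2_time T B N"
  obtains s where "\<And>n. simple_function (lebesgue_on {0<..<T}) (s n)" "\<And>n t. t \<in> {0<..<T} \<Longrightarrow> s n t \<in> B"
    "AE t in lebesgue_on {0<..<T}. u t \<in> B \<and> (\<lambda>n. N (s n t - u t)) \<longlonglongrightarrow> 0"
  using assms unfolding L2_time_def mem_Collect_eq by blast

text \<open>The carrier has no sigma-algebra, so measurability in time is established for real
  quantities that are sequentially continuous with respect to \<open>N\<close>, through the simple
  functions supplied by \<open>L2_time\<close>.\<close>

lemma L2_time_compose_measurable:
  fixes F :: "'b::minus \<Rightarrow> real"
  assumes u: "u \<in> L2_time T B N"
    and F: "\<And>f x. (\<And>n. f n \<in> B) \<Longrightarrow> x \<in> B \<Longrightarrow> (\<lambda>n. N (f n - x)) \<longlonglongrightarrow> 0 \<Longrightarrow> (\<lambda>n. F (f n)) \<longlonglongrightarrow> F x"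
  shows "(\<lambda>t. F (u t)) \<in> borel_measurable (lebesgue_on {0<..<T})"
proof -
  let ?L = "lebesgue_on {0<..<T}"
  obtain s where s: "\<And>n. simple_function ?L (s n)" "\<And>n t. t \<in> {0<..<T} \<Longrightarrow> s n t \<in> B"
    "AE t in ?L. u t \<in> B \<and> (\<lambda>n. N (s n t - u t)) \<longlonglongrightarrow> 0"
    using L2_timeE[OF u] by blast
  show ?thesis
  proof (rule borel_measurable_AE_LIMSEQ)
    show "(\<lambda>t. F (s n t)) \<in> borel_measurable ?L" for n
      by (rule borel_measurable_simple_function, rule simple_function_compose1, rule s)
    have "AE t in ?L. t \<in> {0<..<T}" by (rule AE_I2) simp
    with s(3) show "AE t in ?L. (\<lambda>n. F (s n t)) \<longlonglongrightarrow> F (u t)"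
    proof eventually_elim
      case (elim t)
      then show ?case by (intro F s(2)) auto
    qed
  qed simp
qed

lemma L2_time_AE_in: "u \<in> L2_time T B N \<Longrightarrow> AE t in lebesgue_on {0<..<T}. u t \<in> B"
  unfolding L2_time_def by (auto elim: AE_mp)

text \<open>The condition \<open>lip\<close> is the reverse triangle inequality, which makes the
  norm sequentially continuous. It is asked for on \<open>B\<close> alone, where the tuple norms of
  \<open>H1_norm\<close> and of the dual norm satisfy it.\<close>

lemma L2_time_square_integrable:
  fixes N :: "'b::minus \<Rightarrow> real"
  assumes u: "u \<in> L2_time T B N" and lip: "\<And>x y. x \<in> B \<Longrightarrow> y \<in> B \<Longrightarrow> \<bar>N x - N y\<bar> \<le> N (x - y)"
  shows "(\<lambda>t. N (u t)) \<in> borel_measurable (lebesgue_on {0<..<T})"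
    "integrable (lebesgue_on {0<..<T}) (\<lambda>t. (N (u t))\<^sup>2)"
proof -
  show m: "(\<lambda>t. N (u t)) \<in> borel_measurable (lebesgue_on {0<..<T})"
  proof (rule L2_time_compose_measurable[OF u])
    fix f x assume *: "\<And>n. f n \<in> B" "x \<in> B" "(\<lambda>n. N (f n - x)) \<longlonglongrightarrow> 0"
    have "(\<lambda>n. \<bar>N (f n) - N x\<bar>) \<longlonglongrightarrow> 0"
      by (rule tendsto_sandwich[OF _ _ tendsto_const *(3)]) (use lip * in auto)
    then show "(\<lambda>n. N (f n)) \<longlonglongrightarrow> N x"
      by (simp add: tendsto_rabs_zero_iff LIM_zero_iff)
  qed
  have "(\<integral>\<^sup>+t. ennreal ((N (u t))\<^sup>2) \<partial>lebesgue_on {0<..<T}) < \<infinity>"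
    using u unfolding L2_time_def by auto
  with m show "integrable (lebesgue_on {0<..<T}) (\<lambda>t. (N (u t))\<^sup>2)"
    by (intro integrableI_nonneg) auto
qed

lemma tuple_norm_nonneg: "0 \<le> tuple_norm N u"
  by (simp add: tuple_norm_eq_L2_set L2_set_nonneg)

lemma tuple_norm_Lipschitz:
  assumes "\<And>i. \<bar>M (u i) - M (v i)\<bar> \<le> M (u i - v i)"
  shows "\<bar>tuple_norm M u - tuple_norm M v\<bar> \<le> tuple_norm M (u - v)"
proof -
  have sq: "tuple_norm M w = L2_set (\<lambda>i. M (w i)) UNIV" for w by (rule tuple_norm_eq_L2_set)
  have nn: "0 \<le> M (u i - v i)" for i using assms[of i] by simp
  have swap: "L2_set (\<lambda>i. M (u i) - M (v i)) UNIV \<le> tuple_norm M (u - v)" "L2_set (\<lambda>i. M (v i) - M (u i)) UNIV \<le> tuple_norm M (u - v)"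
  proof -
    have "(M (u i) - M (v i))\<^sup>2 \<le> (M (u i - v i))\<^sup>2" "(M (v i) - M (u i))\<^sup>2 \<le> (M (u i - v i))\<^sup>2" for i
      using assms[of i] nn[of i] by (auto simp: abs_le_square_iff[symmetric])
    then show "L2_set (\<lambda>i. M (u i) - M (v i)) UNIV \<le> tuple_norm M (u - v)" "L2_set (\<lambda>i. M (v i) - M (u i)) UNIV \<le> tuple_norm M (u - v)"
      unfolding tuple_norm_def L2_set_def by (auto intro!: sum_mono)
  qed
  have "tuple_norm M u \<le> tuple_norm M v + L2_set (\<lambda>i. M (u i) - M (v i)) UNIV"
    using L2_set_triangle_ineq[of "\<lambda>i. M (v i)" "\<lambda>i. M (u i) - M (v i)" UNIV] by (simp add: sq)
  moreover have "tuple_norm M v \<le> tuple_norm M u + L2_set (\<lambda>i. M (v i) - M (u i)) UNIV"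
    using L2_set_triangle_ineq[of "\<lambda>i. M (u i)" "\<lambda>i. M (v i) - M (u i)" UNIV] by (simp add: sq)
  ultimately show ?thesis using swap by linarith
qed

text \<open>Continuous functions converging to the indicator almost everywhere are clipped to
  [0, 1], which supplies the majorant for dominated convergence.\<close>

lemma continuous_approx_indicator:
  fixes A :: "real set" and \<eta> :: real
  assumes "A \<in> sets lebesgue" "\<eta> > 0"
  obtains \<zeta> where "continuous_on UNIV \<zeta>" "(LINT t|lebesgue_on {0<..<T}. (indicator A t - \<zeta> t)\<^sup>2) \<le> \<eta>"
proof -
  let ?L = "lebesgue_on {0<..<T}"
  have "(indicator A :: real \<Rightarrow> real) \<in> borel_measurable lebesgue" using assms(1) by simp
  then have "(indicator A :: real \<Rightarrow> real) measurable_on UNIV"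
    by (simp add: lebesgue_measurable_imp_measurable_on)
  then obtain N and g :: "nat \<Rightarrow> real \<Rightarrow> real" where g: "negligible N" "\<And>n. continuous_on UNIV (g n)"
    "\<And>x. x \<notin> N \<Longrightarrow> (\<lambda>n. g n x) \<longlonglongrightarrow> indicator A x"
    by (auto simp: measurable_on_def)
  define f where "f n x = max 0 (min 1 (g n x))" for n x
  have fc: "continuous_on UNIV (f n)" for n
    unfolding f_def[abs_def] by (intro continuous_intros g(2))
  have lim: "(\<lambda>n. f n x) \<longlonglongrightarrow> indicator A x" if "x \<notin> N" for x
  proof -
    have "(\<lambda>n. f n x) \<longlonglongrightarrow> max 0 (min 1 (indicator A x))"
      unfolding f_def by (intro tendsto_intros g(3) that)
    then show ?thesis by (simp add: indicator_def split: if_splits)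
  qed
  have [measurable]: "(indicator A :: real \<Rightarrow> real) \<in> borel_measurable ?L"
    by (rule measurable_restrict_space1, rule borel_measurable_indicator, rule assms(1))
  have [measurable]: "f n \<in> borel_measurable ?L" for n
    by (rule continuous_imp_measurable_on_sets_lebesgue[OF continuous_on_subset[OF fc]]) auto
  have "(\<lambda>n. LINT t|?L. (indicator A t - f n t)\<^sup>2) \<longlonglongrightarrow> (LINT t|?L. 0)"
  proof (rule integral_dominated_convergence[where w="\<lambda>t. 1"])
    show "integrable ?L (\<lambda>t. 1::real)" by (rule continuous_integrable_time) simp
    have "AE x in lebesgue. x \<notin> N" using g(1) by (intro AE_not_in) (simp add: negligible_iff_null_sets)
    then have "AE x in lebesgue. x \<in> {0<..<T} \<longrightarrow> x \<notin> N" by eventually_elim simp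
    then have "AE x in ?L. x \<notin> N" by (simp add: AE_restrict_space_iff)
    then show "AE x in ?L. (\<lambda>n. (indicator A x - f n x)\<^sup>2) \<longlonglongrightarrow> 0"
    proof eventually_elim
      case (elim x)
      have "(\<lambda>n. (indicator A x - f n x)\<^sup>2) \<longlonglongrightarrow> (indicator A x - indicator A x)\<^sup>2"
        by (intro tendsto_intros lim elim)
      then show ?case by simp
    qed
    show "AE x in ?L. norm ((indicator A x - f n x)\<^sup>2) \<le> 1" for n
    proof (rule AE_I2)
      fix x
      have "\<bar>indicator A x - f n x\<bar> \<le> 1" by (auto simp: f_def indicator_def)
      then show "norm ((indicator A x - f n x)\<^sup>2) \<le> 1" by (simp add: abs_square_le_1)
    qed
  qed (measurable)
  then have "\<forall>\<^sub>F n in sequentially. (LINT t|?L. (indicator A t - f n t)\<^sup>2) < \<eta>"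
    using assms(2) by (intro order_tendstoD(2)) auto
  then obtain n where "(LINT t|?L. (indicator A t - f n t)\<^sup>2) < \<eta>"
    by (auto simp: eventually_sequentially)
  with that[OF fc[of n]] show ?thesis by simp
qed

context bounded_open_set
begin

abbreviation HB :: "('n \<Rightarrow> 'n scalar_field) set" where "HB \<equiv> tuples (H10 \<Omega>)"
abbreviation HN :: "('n \<Rightarrow> 'n scalar_field) \<Rightarrow> real" where "HN \<equiv> tuple_norm (H1_norm \<Omega>)"

lemma HB_lincomb: "u \<in> HB \<Longrightarrow> v \<in> HB \<Longrightarrow> (\<lambda>i x. a * u i x + b * v i x) \<in> HB"
  by (simp add: tuples_def H10_lincomb)

lemma HB_diff: "u \<in> HB \<Longrightarrow> v \<in> HB \<Longrightarrow> (\<lambda>i x. u i x - v i x) \<in> HB"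
  by (simp add: tuples_def H10_diff)

lemma HN_lincomb_le:
  assumes "u \<in> HB" "v \<in> HB"
  shows "HN (\<lambda>i x. a * u i x + b * v i x) \<le> \<bar>a\<bar> * HN u + \<bar>b\<bar> * HN v"
proof -
  have uv: "u i \<in> H1 \<Omega>" "v i \<in> H1 \<Omega>" for i using assms by (auto simp: tuples_def H10_D)
  have "HN (\<lambda>i x. a * u i x + b * v i x) \<le> L2_set (\<lambda>i. \<bar>a\<bar> * H1_norm \<Omega> (u i) + \<bar>b\<bar> * H1_norm \<Omega> (v i)) UNIV"
    unfolding tuple_norm_eq_L2_set by (intro L2_set_mono H1_norm_lincomb_le uv) auto
  also have "\<dots> \<le> L2_set (\<lambda>i. \<bar>a\<bar> * H1_norm \<Omega> (u i)) UNIV + L2_set (\<lambda>i. \<bar>b\<bar> * H1_norm \<Omega> (v i)) UNIV"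
    by (rule L2_set_triangle_ineq)
  also have "\<dots> = \<bar>a\<bar> * HN u + \<bar>b\<bar> * HN v"
    by (simp add: tuple_norm_eq_L2_set L2_set_right_distrib)
  finally show ?thesis .
qed

lemma tuple_diff_eq: "u - v = (\<lambda>i x. u i x - v i x)" for u v :: "'n \<Rightarrow> 'n scalar_field"
  by (simp add: fun_eq_iff)

lemma HN_triangle:
  assumes "u \<in> HB" "v \<in> HB" "w \<in> HB"
  shows "HN (u - w) \<le> HN (u - v) + HN (v - w)"
proof -
  have "u - v \<in> HB" "v - w \<in> HB" using assms by (auto simp: tuple_diff_eq intro: HB_diff)
  from HN_lincomb_le[OF this, of 1 1] show ?thesis by (simp add: tuple_diff_eq)
qed

lemma HN_Lipschitz:
  assumes "u \<in> HB" "v \<in> HB"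
  shows "\<bar>HN u - HN v\<bar> \<le> HN (u - v)"
proof -
  have d: "u - v \<in> HB" using assms by (auto simp: tuple_diff_eq intro: HB_diff)
  from HN_lincomb_le[OF this assms(2), of 1 1] have "HN u \<le> HN (u - v) + HN v"
    by (simp add: tuple_diff_eq)
  moreover from HN_lincomb_le[OF d assms(1), of "-1" 1] have "HN v \<le> HN (u - v) + HN u"
    by (simp add: tuple_diff_eq)
  ultimately show ?thesis by simp
qed

lemma zero_test_function: "(\<lambda>x. 0) \<in> test_functions \<Omega>"
  by (rule test_functionI[of _ "{}"]) (auto simp: smooth_const)

lemma zero_HB: "(\<lambda>i x. 0) \<in> HB"
  by (simp add: tuples_def test_function_H10 zero_test_function)

lemma HN_zero: "HN (\<lambda>i x. 0) = 0"
  using HN_lincomb_le[OF zero_HB zero_HB, of 0 0] tuple_norm_nonneg[of "H1_norm \<Omega>" "(\<lambda>i x. 0) :: 'n \<Rightarrow> 'n scalar_field"] by simp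

lemma HN_commute: "u \<in> HB \<Longrightarrow> v \<in> HB \<Longrightarrow> HN (u - v) = HN (v - u)"
  using HN_lincomb_le[of "u - v" "u - v" "-1" 0] HN_lincomb_le[of "v - u" "v - u" "-1" 0]
  by (simp add: tuple_diff_eq HB_diff)

subsection \<open>Approximation by continuous functions of time\<close>

text \<open>Membership in the closure of the continuous functions in the mean square of time with
  values in \<open>H10\<close>, phrased with a real majorant \<open>r\<close> of the error: errors
  can then be added and squared as real functions. Of the continuity of \<open>Z\<close> only a
  modulus at the scale \<eta> is recorded, which is all that the partition argument
  consumes.\<close>

definition continuously_approximable :: "real \<Rightarrow> (real \<Rightarrow> 'n \<Rightarrow> 'n scalar_field) \<Rightarrow> bool" where
  "continuously_approximable T u \<longleftrightarrow> (\<forall>\<eta>>0. \<exists>Z r h. (\<forall>t. Z t \<in> HB) \<and> h > 0 \<and>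
     (\<forall>t\<in>{0<..<T}. \<forall>\<sigma>\<in>{0<..<T}. \<bar>t - \<sigma>\<bar> < h \<longrightarrow> HN (Z t - Z \<sigma>) \<le> \<eta>) \<and>
     r \<in> borel_measurable (lebesgue_on {0<..<T}) \<and> integrable (lebesgue_on {0<..<T}) (\<lambda>t. (r t)\<^sup>2) \<and>
     (LINT t|lebesgue_on {0<..<T}. (r t)\<^sup>2) \<le> \<eta> \<and>
     (AE t in lebesgue_on {0<..<T}. u t \<in> HB \<and> HN (u t - Z t) \<le> r t))"

lemma continuously_approximableE:
  assumes "continuously_approximable T u" "\<eta> > 0"
  obtains Z r h where "\<And>t. Z t \<in> HB" "h > 0"
    "\<And>t \<sigma>. t \<in> {0<..<T} \<Longrightarrow> \<sigma> \<in> {0<..<T} \<Longrightarrow> \<bar>t - \<sigma>\<bar> < h \<Longrightarrow> HN (Z t - Z \<sigma>) \<le> \<eta>"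
    "r \<in> borel_measurable (lebesgue_on {0<..<T})" "integrable (lebesgue_on {0<..<T}) (\<lambda>t. (r t)\<^sup>2)"
    "(LINT t|lebesgue_on {0<..<T}. (r t)\<^sup>2) \<le> \<eta>"
    "AE t in lebesgue_on {0<..<T}. u t \<in> HB \<and> HN (u t - Z t) \<le> r t"
  using assms unfolding continuously_approximable_def by blast

lemma square_sum_integrable:
  fixes r s :: "real \<Rightarrow> real"
  assumes "r \<in> borel_measurable M" "s \<in> borel_measurable M"
    "integrable M (\<lambda>t. (r t)\<^sup>2)" "integrable M (\<lambda>t. (s t)\<^sup>2)"
  shows "integrable M (\<lambda>t. (r t + s t)\<^sup>2)" "(LINT t|M. (r t + s t)\<^sup>2) \<le> 2 * (LINT t|M. (r t)\<^sup>2) + 2 * (LINT t|M. (s t)\<^sup>2)"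
proof -
  have le: "(r t + s t)\<^sup>2 \<le> 2 * (r t)\<^sup>2 + 2 * (s t)\<^sup>2" for t
    using zero_le_power2[of "r t - s t"] by (simp add: power2_sum power2_diff)
  show i: "integrable M (\<lambda>t. (r t + s t)\<^sup>2)"
    by (rule Bochner_Integration.integrable_bound[of _ "\<lambda>t. 2 * (r t)\<^sup>2 + 2 * (s t)\<^sup>2"]) (use assms le in auto)
  have "(LINT t|M. (r t + s t)\<^sup>2) \<le> (LINT t|M. 2 * (r t)\<^sup>2 + 2 * (s t)\<^sup>2)"
    using assms le i by (intro integral_mono) auto
  with assms show "(LINT t|M. (r t + s t)\<^sup>2) \<le> 2 * (LINT t|M. (r t)\<^sup>2) + 2 * (LINT t|M. (s t)\<^sup>2)" by simp
qed

text \<open>Coefficients of absolute value at most 1 cover sums and differences and let the errors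
  simply add; as (r + s)^2 \<le> 2 r^2 + 2 s^2, the tolerance \<eta> / 4 suffices for each
  summand.\<close>

lemma continuously_approximable_lincomb:
  assumes "continuously_approximable T u" "continuously_approximable T v" "\<bar>a\<bar> \<le> 1" "\<bar>b\<bar> \<le> 1"
  shows "continuously_approximable T (\<lambda>t i x. a * u t i x + b * v t i x)"
  unfolding continuously_approximable_def
proof (intro allI impI)
  fix \<eta> :: real assume "\<eta> > 0"
  let ?L = "lebesgue_on {0<..<T}"
  have e: "\<eta> / 4 > 0" using \<open>\<eta> > 0\<close> by simp
  obtain Z r h where Z: "\<And>t. Z t \<in> HB" "h > 0"
    "\<And>t \<sigma>. t \<in> {0<..<T} \<Longrightarrow> \<sigma> \<in> {0<..<T} \<Longrightarrow> \<bar>t - \<sigma>\<bar> < h \<Longrightarrow> HN (Z t - Z \<sigma>) \<le> \<eta> / 4"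
    "r \<in> borel_measurable ?L" "integrable ?L (\<lambda>t. (r t)\<^sup>2)" "(LINT t|?L. (r t)\<^sup>2) \<le> \<eta> / 4"
    "AE t in ?L. u t \<in> HB \<and> HN (u t - Z t) \<le> r t"
    by (rule continuously_approximableE[OF assms(1) e]) (rule that)
  obtain Y s k where Y: "\<And>t. Y t \<in> HB" "k > 0"
    "\<And>t \<sigma>. t \<in> {0<..<T} \<Longrightarrow> \<sigma> \<in> {0<..<T} \<Longrightarrow> \<bar>t - \<sigma>\<bar> < k \<Longrightarrow> HN (Y t - Y \<sigma>) \<le> \<eta> / 4"
    "s \<in> borel_measurable ?L" "integrable ?L (\<lambda>t. (s t)\<^sup>2)" "(LINT t|?L. (s t)\<^sup>2) \<le> \<eta> / 4"
    "AE t in ?L. v t \<in> HB \<and> HN (v t - Y t) \<le> s t"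
    by (rule continuously_approximableE[OF assms(2) e]) (rule that)
  have diff: "HN ((\<lambda>i x. a * p i x + b * q i x) - (\<lambda>i x. a * p' i x + b * q' i x)) \<le> HN (p - p') + HN (q - q')"
    if "p \<in> HB" "p' \<in> HB" "q \<in> HB" "q' \<in> HB" for p p' q q'
  proof -
    have "HN ((\<lambda>i x. a * p i x + b * q i x) - (\<lambda>i x. a * p' i x + b * q' i x))
        = HN (\<lambda>i x. a * (p - p') i x + b * (q - q') i x)"
      by (rule arg_cong[of _ _ HN]) (simp add: fun_eq_iff algebra_simps)
    also have "\<dots> \<le> \<bar>a\<bar> * HN (p - p') + \<bar>b\<bar> * HN (q - q')"
      using that by (intro HN_lincomb_le) (auto simp: tuple_diff_eq HB_diff)
    also have "\<dots> \<le> HN (p - p') + HN (q - q')"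
      using assms(3,4) tuple_norm_nonneg by (intro add_mono mult_left_le_one_le) auto
    finally show ?thesis .
  qed
  note sq = square_sum_integrable[OF Z(4) Y(4) Z(5) Y(5)]
  show "\<exists>X q l. (\<forall>t. X t \<in> HB) \<and> l > 0 \<and>
     (\<forall>t\<in>{0<..<T}. \<forall>\<sigma>\<in>{0<..<T}. \<bar>t - \<sigma>\<bar> < l \<longrightarrow> HN (X t - X \<sigma>) \<le> \<eta>) \<and>
     q \<in> borel_measurable ?L \<and> integrable ?L (\<lambda>t. (q t)\<^sup>2) \<and> (LINT t|?L. (q t)\<^sup>2) \<le> \<eta> \<and>
     (AE t in ?L. (\<lambda>i x. a * u t i x + b * v t i x) \<in> HB \<and> HN ((\<lambda>i x. a * u t i x + b * v t i x) - X t) \<le> q t)"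
  proof (rule exI[of _ "\<lambda>t i x. a * Z t i x + b * Y t i x"], rule exI[of _ "\<lambda>t. r t + s t"],
      rule exI[of _ "min h k"], intro conjI allI ballI impI)
    show "(\<lambda>i x. a * Z t i x + b * Y t i x) \<in> HB" for t by (intro HB_lincomb Z Y)
    show "min h k > 0" using Z Y by simp
    show "HN ((\<lambda>i x. a * Z t i x + b * Y t i x) - (\<lambda>i x. a * Z \<sigma> i x + b * Y \<sigma> i x)) \<le> \<eta>"
      if "t \<in> {0<..<T}" "\<sigma> \<in> {0<..<T}" "\<bar>t - \<sigma>\<bar> < min h k" for t \<sigma>
      using diff[OF Z(1)[of t] Z(1)[of \<sigma>] Y(1)[of t] Y(1)[of \<sigma>]] Z(3)[OF that(1,2)] Y(3)[OF that(1,2)] that(3) \<open>\<eta> > 0\<close> by simp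
    show "(\<lambda>t. r t + s t) \<in> borel_measurable ?L" using Z(4) Y(4) by simp
    show "integrable ?L (\<lambda>t. (r t + s t)\<^sup>2)" by (rule sq)
    show "(LINT t|?L. (r t + s t)\<^sup>2) \<le> \<eta>" using sq(2) Z(6) Y(6) by simp
    show "AE t in ?L. (\<lambda>i x. a * u t i x + b * v t i x) \<in> HB \<and>
        HN ((\<lambda>i x. a * u t i x + b * v t i x) - (\<lambda>i x. a * Z t i x + b * Y t i x)) \<le> r t + s t"
      using Z(7) Y(7)
    proof eventually_elim
      case (elim t)
      then show ?case using diff[of "u t" "Z t" "v t" "Y t"] Z(1) Y(1) HB_lincomb by fastforce
    qed
  qed
qed

text \<open>Everything happens in the scalar factor, where the indicator gives way to a continuous
  function; \<open>b\<close> contributes only the factor \<open>HN b\<close>.\<close>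

lemma continuously_approximable_indicator:
  assumes "A \<in> sets lebesgue" "b \<in> HB"
  shows "continuously_approximable T (\<lambda>t i x. indicator A t * b i x)"
  unfolding continuously_approximable_def
proof (intro allI impI)
  fix \<eta> :: real assume "\<eta> > 0"
  let ?L = "lebesgue_on {0<..<T}"
  have nb: "0 \<le> HN b" by (rule tuple_norm_nonneg)
  \<comment> \<open>The summand 1 covers the case \<open>HN b = 0\<close>; after multiplication by
    the square of \<open>HN b\<close> the error is still at most \<eta>.\<close>
  have e: "\<eta> / (1 + (HN b)\<^sup>2) > 0" using \<open>\<eta> > 0\<close> by (simp add: add_pos_nonneg)
  obtain \<zeta> where \<zeta>: "continuous_on UNIV \<zeta>" "(LINT t|?L. (indicator A t - \<zeta> t)\<^sup>2) \<le> \<eta> / (1 + (HN b)\<^sup>2)"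
    using continuous_approx_indicator[OF assms(1) e, of T] .
  have "uniformly_continuous_on {0..T} \<zeta>"
    by (intro compact_uniformly_continuous continuous_on_subset[OF \<zeta>(1)]) auto
  then obtain h where h: "h > 0" "\<And>t \<sigma>. t \<in> {0..T} \<Longrightarrow> \<sigma> \<in> {0..T} \<Longrightarrow> \<bar>t - \<sigma>\<bar> < h \<Longrightarrow> \<bar>\<zeta> t - \<zeta> \<sigma>\<bar> < \<eta> / (1 + HN b)"
    unfolding uniformly_continuous_on_def dist_real_def using \<open>\<eta> > 0\<close> nb
    by (metis add_pos_nonneg divide_pos_pos zero_less_one)
  have sc: "HN ((\<lambda>i x. p * b i x) - (\<lambda>i x. q * b i x)) \<le> \<bar>p - q\<bar> * HN b" for p q
  proof -
    have "HN ((\<lambda>i x. p * b i x) - (\<lambda>i x. q * b i x)) = HN (\<lambda>i x. (p - q) * b i x + 0 * b i x)"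
      by (rule arg_cong[of _ _ HN]) (simp add: fun_eq_iff algebra_simps)
    also have "\<dots> \<le> \<bar>p - q\<bar> * HN b + \<bar>0\<bar> * HN b" by (rule HN_lincomb_le[OF assms(2,2)])
    finally show ?thesis by simp
  qed
  have cB: "(\<lambda>i x. p * b i x) \<in> HB" for p using HB_lincomb[OF assms(2,2), of p 0] by simp
  have [measurable]: "(indicator A :: real \<Rightarrow> real) \<in> borel_measurable ?L"
    by (rule measurable_restrict_space1, rule borel_measurable_indicator, rule assms(1))
  have [measurable]: "\<zeta> \<in> borel_measurable ?L"
    by (rule continuous_imp_measurable_on_sets_lebesgue[OF continuous_on_subset[OF \<zeta>(1)]]) auto
  have iz: "integrable ?L (\<lambda>t. (indicator A t - \<zeta> t)\<^sup>2)"
  proof (rule Bochner_Integration.integrable_bound[of _ "\<lambda>t. 2 * 1 + 2 * (\<zeta> t)\<^sup>2"])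
    show "integrable ?L (\<lambda>t. 2 * 1 + 2 * (\<zeta> t)\<^sup>2)"
      by (intro continuous_integrable_time continuous_intros continuous_on_subset[OF \<zeta>(1)]) auto
    have "(indicator A t - \<zeta> t)\<^sup>2 \<le> 2 * 1 + 2 * (\<zeta> t)\<^sup>2" for t
      using zero_le_power2[of "1 + \<zeta> t"] by (auto simp: indicator_def power2_sum power2_diff)
    then show "AE t in ?L. norm ((indicator A t - \<zeta> t)\<^sup>2) \<le> norm (2 * 1 + 2 * (\<zeta> t)\<^sup>2)"
      by (intro AE_I2) auto
  qed measurable
  show "\<exists>Z r h. (\<forall>t. Z t \<in> HB) \<and> h > 0 \<and>
     (\<forall>t\<in>{0<..<T}. \<forall>\<sigma>\<in>{0<..<T}. \<bar>t - \<sigma>\<bar> < h \<longrightarrow> HN (Z t - Z \<sigma>) \<le> \<eta>) \<and>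
     r \<in> borel_measurable ?L \<and> integrable ?L (\<lambda>t. (r t)\<^sup>2) \<and> (LINT t|?L. (r t)\<^sup>2) \<le> \<eta> \<and>
     (AE t in ?L. (\<lambda>i x. indicator A t * b i x) \<in> HB \<and> HN ((\<lambda>i x. indicator A t * b i x) - Z t) \<le> r t)"
  proof (rule exI[of _ "\<lambda>t i x. \<zeta> t * b i x"], rule exI[of _ "\<lambda>t. \<bar>indicator A t - \<zeta> t\<bar> * HN b"],
      rule exI[of _ h], intro conjI allI ballI impI)
    show "HN ((\<lambda>i x. \<zeta> t * b i x) - (\<lambda>i x. \<zeta> \<sigma> * b i x)) \<le> \<eta>"
      if "t \<in> {0<..<T}" "\<sigma> \<in> {0<..<T}" "\<bar>t - \<sigma>\<bar> < h" for t \<sigma>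
    proof -
      have "\<bar>\<zeta> t - \<zeta> \<sigma>\<bar> * HN b \<le> \<eta> / (1 + HN b) * HN b"
        using h(2)[of t \<sigma>] that nb by (intro mult_right_mono) auto
      also have "\<dots> \<le> \<eta>" using nb \<open>\<eta> > 0\<close> by (simp add: divide_le_eq)
      finally show ?thesis using sc[of "\<zeta> t" "\<zeta> \<sigma>"] by simp
    qed
    show "integrable ?L (\<lambda>t. (\<bar>indicator A t - \<zeta> t\<bar> * HN b)\<^sup>2)"
      using iz by (simp add: power_mult_distrib)
    have "(LINT t|?L. (\<bar>indicator A t - \<zeta> t\<bar> * HN b)\<^sup>2) = (LINT t|?L. (indicator A t - \<zeta> t)\<^sup>2) * (HN b)\<^sup>2"
      by (simp add: power_mult_distrib)
    also have "\<dots> \<le> \<eta> / (1 + (HN b)\<^sup>2) * (HN b)\<^sup>2" by (intro mult_right_mono \<zeta>(2)) auto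
    also have "\<dots> \<le> \<eta>" using \<open>\<eta> > 0\<close> by (simp add: divide_le_eq add_pos_nonneg)
    finally show "(LINT t|?L. (\<bar>indicator A t - \<zeta> t\<bar> * HN b)\<^sup>2) \<le> \<eta>" .
    show "AE t in ?L. (\<lambda>i x. indicator A t * b i x) \<in> HB \<and>
        HN ((\<lambda>i x. indicator A t * b i x) - (\<lambda>i x. \<zeta> t * b i x)) \<le> \<bar>indicator A t - \<zeta> t\<bar> * HN b"
      by (intro AE_I2 conjI cB sc)
  qed (use h cB in auto)
qed

lemma continuously_approximable_cong:
  assumes "continuously_approximable T u" "\<And>t. t \<in> {0<..<T} \<Longrightarrow> u t = v t"
  shows "continuously_approximable T v"
proof -
  have "(AE t in lebesgue_on {0<..<T}. u t \<in> HB \<and> HN (u t - Z t) \<le> r t) \<longleftrightarrow>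
      (AE t in lebesgue_on {0<..<T}. v t \<in> HB \<and> HN (v t - Z t) \<le> r t)" for Z r
    using assms(2) by (intro AE_cong) auto
  with assms(1) show ?thesis unfolding continuously_approximable_def by simp
qed

text \<open>Induction over the finite set of values: admitting one more value adds the indicator of
  its level set times that value.\<close>

lemma continuously_approximable_simple:
  assumes s: "simple_function (lebesgue_on {0<..<T}) s" "\<And>t. t \<in> {0<..<T} \<Longrightarrow> s t \<in> HB"
  shows "continuously_approximable T s"
proof -
  have step: "finite V \<Longrightarrow> V \<subseteq> HB \<Longrightarrow> continuously_approximable T (\<lambda>t i x. if s t \<in> V then s t i x else 0)" for V
  proof (induction V rule: finite_induct)
    case empty
    show ?case using continuously_approximable_indicator[of "{}" "\<lambda>i x. 0" T] zero_HB by simp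
  next
    case (insert v V)
    define A where "A = s -` {v} \<inter> {0<..<T}"
    have "A \<in> sets (lebesgue_on {0<..<T})"
      using simple_functionD(2)[OF s(1), of "{v}"] by (simp add: A_def)
    then have "A \<in> sets lebesgue" by (simp add: A_def sets_restrict_space_iff)
    from continuously_approximable_lincomb[OF insert.IH continuously_approximable_indicator[OF this, of v T], of 1 1] insert.prems
    have "continuously_approximable T (\<lambda>t i x. 1 * (if s t \<in> V then s t i x else 0) + 1 * (indicator A t * v i x))"
      by simp
    then show ?case
    proof (rule continuously_approximable_cong)
      fix t assume t: "t \<in> {0<..<T}"
      show "(\<lambda>i x. 1 * (if s t \<in> V then s t i x else 0) + 1 * (indicator A t * v i x))
          = (\<lambda>i x. if s t \<in> insert v V then s t i x else 0)"
        using t insert.hyps by (cases "s t = v") (auto simp: A_def)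
    qed
  qed
  have "continuously_approximable T (\<lambda>t i x. if s t \<in> s ` {0<..<T} then s t i x else 0)"
    using simple_functionD(1)[OF s(1)] s(2) by (intro step) auto
  then show ?thesis by (rule continuously_approximable_cong) auto
qed

text \<open>An approximant of an approximant: the two error majorants add.\<close>

lemma continuously_approximable_limit:
  assumes "\<And>\<delta>. \<delta> > 0 \<Longrightarrow> \<exists>s e. continuously_approximable T s \<and> e \<in> borel_measurable (lebesgue_on {0<..<T}) \<and>
      integrable (lebesgue_on {0<..<T}) (\<lambda>t. (e t)\<^sup>2) \<and> (LINT t|lebesgue_on {0<..<T}. (e t)\<^sup>2) \<le> \<delta> \<and>
      (AE t in lebesgue_on {0<..<T}. u t \<in> HB \<and> HN (u t - s t) \<le> e t)"
  shows "continuously_approximable T u"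
  unfolding continuously_approximable_def
proof (intro allI impI)
  fix \<eta> :: real assume "\<eta> > 0"
  then have e4: "\<eta> / 4 > 0" by simp
  let ?L = "lebesgue_on {0<..<T}"
  obtain s e where s: "continuously_approximable T s" and e: "e \<in> borel_measurable ?L" "integrable ?L (\<lambda>t. (e t)\<^sup>2)"
    "(LINT t|?L. (e t)\<^sup>2) \<le> \<eta> / 4" "AE t in ?L. u t \<in> HB \<and> HN (u t - s t) \<le> e t"
    using assms[OF e4] by auto
  obtain Z r h where Z: "\<And>t. Z t \<in> HB" "h > 0"
    "\<And>t \<sigma>. t \<in> {0<..<T} \<Longrightarrow> \<sigma> \<in> {0<..<T} \<Longrightarrow> \<bar>t - \<sigma>\<bar> < h \<Longrightarrow> HN (Z t - Z \<sigma>) \<le> \<eta> / 4"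
    "r \<in> borel_measurable ?L" "integrable ?L (\<lambda>t. (r t)\<^sup>2)" "(LINT t|?L. (r t)\<^sup>2) \<le> \<eta> / 4"
    "AE t in ?L. s t \<in> HB \<and> HN (s t - Z t) \<le> r t"
    by (rule continuously_approximableE[OF s e4]) (rule that)
  note sq = square_sum_integrable[OF e(1) Z(4) e(2) Z(5)]
  have "AE t in ?L. u t \<in> HB \<and> HN (u t - Z t) \<le> e t + r t"
    using e(4) Z(7)
  proof eventually_elim
    case (elim t)
    then show ?case using HN_triangle[of "u t" "s t" "Z t"] Z(1) by fastforce
  qed
  moreover have "\<forall>t\<in>{0<..<T}. \<forall>\<sigma>\<in>{0<..<T}. \<bar>t - \<sigma>\<bar> < h \<longrightarrow> HN (Z t - Z \<sigma>) \<le> \<eta>"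
    using Z(3) \<open>\<eta> > 0\<close> by fastforce
  moreover have "(LINT t|?L. (e t + r t)\<^sup>2) \<le> \<eta>" using sq(2) e(3) Z(6) by simp
  ultimately show "\<exists>Z r h. (\<forall>t. Z t \<in> HB) \<and> h > 0 \<and>
     (\<forall>t\<in>{0<..<T}. \<forall>\<sigma>\<in>{0<..<T}. \<bar>t - \<sigma>\<bar> < h \<longrightarrow> HN (Z t - Z \<sigma>) \<le> \<eta>) \<and>
     r \<in> borel_measurable ?L \<and> integrable ?L (\<lambda>t. (r t)\<^sup>2) \<and> (LINT t|?L. (r t)\<^sup>2) \<le> \<eta> \<and>
     (AE t in ?L. u t \<in> HB \<and> HN (u t - Z t) \<le> r t)"
    using Z(1,2) sq(1) e(1) Z(4) by (intro exI[of _ Z] exI[of _ "\<lambda>t. e t + r t"] exI[of _ h]) auto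
qed

text \<open>The simple functions in \<open>L2_time\<close> are only known to converge almost
  everywhere, with no bound on their size. Truncating them against \<open>HN (u t)\<close> gives a
  dominated sequence, hence convergence in the mean square.\<close>

lemma L2_time_continuously_approximable:
  assumes u: "u \<in> L2_time T HB HN"
  shows "continuously_approximable T u"
proof (rule continuously_approximable_limit)
  fix \<delta> :: real assume "\<delta> > 0"
  let ?L = "lebesgue_on {0<..<T}"
  obtain s where s: "\<And>n. simple_function ?L (s n)" "\<And>n t. t \<in> {0<..<T} \<Longrightarrow> s n t \<in> HB"
    "AE t in ?L. u t \<in> HB \<and> (\<lambda>n. HN (s n t - u t)) \<longlonglongrightarrow> 0"
    using L2_timeE[OF u] by blast
  have inT: "AE t in ?L. t \<in> {0<..<T}" by (rule AE_I2) simp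
  have Nu: "(\<lambda>t. HN (u t)) \<in> borel_measurable ?L" "integrable ?L (\<lambda>t. (HN (u t))\<^sup>2)"
    by (rule L2_time_square_integrable[OF u], rule HN_Lipschitz, assumption+)+
  define A where "A n = {t \<in> {0<..<T}. HN (s n t) \<le> 2 * HN (u t)}" for n
  \<comment> \<open>Replaced by 0 where the simple function is more than twice as large as
    \<open>u\<close>. The result is still simple because that set is measurable, and its error is at
    most 3 times \<open>HN (u t)\<close>.\<close>
  define s' where "s' n t = (if HN (s n t) \<le> 2 * HN (u t) then s n t else (\<lambda>i x. 0))" for n t
  have Ns [measurable]: "(\<lambda>t. HN (s n t)) \<in> borel_measurable ?L" for n
    by (rule borel_measurable_simple_function, rule simple_function_compose1[OF s(1)])
  note [measurable] = Nu(1)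
  have Am: "{t \<in> space ?L. HN (s n t) \<le> 2 * HN (u t)} \<in> sets ?L" for n
    by measurable
  have s'simple: "simple_function ?L (s' n)" for n
    unfolding s'_def[abs_def] using s(1)[of n] Am[of n]
    by (intro simple_function_If) simp_all
  have s'HB: "s' n t \<in> HB" if "t \<in> {0<..<T}" for n t
    using s(2)[OF that] zero_HB by (simp add: s'_def)
  \<comment> \<open>\<open>u\<close> itself need not be simple, so measurability of the distance
    comes as the limit over m of distances between simple functions.\<close>
  have dm: "(\<lambda>t. HN (u t - s' n t)) \<in> borel_measurable ?L" for n
  proof (rule borel_measurable_AE_LIMSEQ)
    show "(\<lambda>t. HN (s m t - s' n t)) \<in> borel_measurable ?L" for m
      by (rule borel_measurable_simple_function, rule simple_function_compose2[OF s(1) s'simple, of "\<lambda>a b. HN (a - b)"])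
    show "AE t in ?L. (\<lambda>m. HN (s m t - s' n t)) \<longlonglongrightarrow> HN (u t - s' n t)"
      using s(3) inT
    proof eventually_elim
      case (elim t)
      have le: "\<bar>HN (s m t - s' n t) - HN (u t - s' n t)\<bar> \<le> HN (s m t - u t)" for m
      proof -
        have B: "s m t \<in> HB" "s' n t \<in> HB" "u t \<in> HB" using elim s(2) s'HB by auto
        have "HN (s m t - s' n t) \<le> HN (s m t - u t) + HN (u t - s' n t)" by (intro HN_triangle B)
        moreover have "HN (u t - s' n t) \<le> HN (u t - s m t) + HN (s m t - s' n t)" by (intro HN_triangle B)
        ultimately show ?thesis using HN_commute[OF B(1,3)] by simp
      qed
      have "(\<lambda>m. \<bar>HN (s m t - s' n t) - HN (u t - s' n t)\<bar>) \<longlonglongrightarrow> 0"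
        by (rule tendsto_sandwich[OF _ _ tendsto_const conjunct2[OF elim(1)]]) (use le in auto)
      then show ?case by (simp add: tendsto_rabs_zero_iff LIM_zero_iff)
    qed
  qed simp
  have dom: "AE t in ?L. (HN (u t - s' n t))\<^sup>2 \<le> 9 * (HN (u t))\<^sup>2" for n
    using s(3) inT
  proof eventually_elim
    case (elim t)
    have B: "s n t \<in> HB" "u t \<in> HB" "s' n t \<in> HB" using elim s(2) s'HB by auto
    have "HN (s' n t) \<le> 2 * HN (u t)"
      using tuple_norm_nonneg[of "H1_norm \<Omega>" "u t"] by (simp add: s'_def HN_zero)
    moreover have "HN (u t - s' n t) \<le> HN (u t) + HN (s' n t)"
      using HN_lincomb_le[OF B(2,3), of 1 "-1"] by (simp add: tuple_diff_eq)
    ultimately have "HN (u t - s' n t) \<le> 3 * HN (u t)" by simp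
    then have "(HN (u t - s' n t))\<^sup>2 \<le> (3 * HN (u t))\<^sup>2" by (intro power_mono tuple_norm_nonneg)
    then show ?case by (simp add: power_mult_distrib)
  qed
  have lim: "AE t in ?L. (\<lambda>n. (HN (u t - s' n t))\<^sup>2) \<longlonglongrightarrow> 0"
    using s(3) inT
  proof eventually_elim
    case (elim t)
    have B: "s n t \<in> HB" "u t \<in> HB" for n using elim s(2) by auto
    have l0: "(\<lambda>n. HN (u t - s n t)) \<longlonglongrightarrow> 0"
      using elim HN_commute[OF B(2) B(1)] by simp
    \<comment> \<open>Where \<open>HN (u t) = 0\<close>, replacement by 0 causes no error; elsewhere
      the truncation is eventually inactive.\<close>
    have "\<bar>HN (u t - s' n t)\<bar> \<le> HN (u t - s n t)" if "HN (u t) = 0 \<or> HN (s n t) \<le> 2 * HN (u t)" for n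
    proof (cases "HN (s n t) \<le> 2 * HN (u t)")
      case True
      then show ?thesis by (simp add: s'_def tuple_norm_nonneg)
    next
      case False
      with that have "HN (u t) = 0" by simp
      moreover have "u t - (\<lambda>i x. 0) = u t" by (simp add: fun_eq_iff)
      ultimately show ?thesis using False by (simp add: s'_def tuple_norm_nonneg)
    qed
    moreover have "\<forall>\<^sub>F n in sequentially. HN (u t) = 0 \<or> HN (s n t) \<le> 2 * HN (u t)"
    proof (cases "HN (u t) = 0")
      case False
      then have "HN (u t) > 0" using tuple_norm_nonneg[of "H1_norm \<Omega>" "u t"] by simp
      from order_tendstoD(2)[OF l0 this] show ?thesis
      proof eventually_elim
        case (elim n)
        then show ?case using HN_Lipschitz[OF B(2) B(1)[of n]] by linarith
      qed
    qed simp
    ultimately have "\<forall>\<^sub>F n in sequentially. \<bar>HN (u t - s' n t)\<bar> \<le> HN (u t - s n t)"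
      by (auto elim: eventually_mono)
    then have "(\<lambda>n. \<bar>HN (u t - s' n t)\<bar>) \<longlonglongrightarrow> 0"
      by (intro tendsto_sandwich[OF _ _ tendsto_const l0]) auto
    then have "(\<lambda>n. HN (u t - s' n t)) \<longlonglongrightarrow> 0" by (simp add: tendsto_rabs_zero_iff)
    from tendsto_power[OF this, of 2] show ?case by simp
  qed
  have int: "integrable ?L (\<lambda>t. (HN (u t - s' n t))\<^sup>2)" for n
    by (rule Bochner_Integration.integrable_bound[of _ "\<lambda>t. 9 * (HN (u t))\<^sup>2"])
      (use Nu(2) dm dom in auto)
  have "(\<lambda>n. LINT t|?L. (HN (u t - s' n t))\<^sup>2) \<longlonglongrightarrow> (LINT t|?L. 0)"
    by (rule integral_dominated_convergence[where w="\<lambda>t. 9 * (HN (u t))\<^sup>2"])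
      (use Nu(2) dm dom lim in auto)
  then have "\<forall>\<^sub>F n in sequentially. (LINT t|?L. (HN (u t - s' n t))\<^sup>2) < \<delta>"
    using \<open>\<delta> > 0\<close> by (intro order_tendstoD(2)) auto
  then obtain n where n: "(LINT t|?L. (HN (u t - s' n t))\<^sup>2) < \<delta>"
    by (auto simp: eventually_sequentially)
  have "AE t in ?L. u t \<in> HB" using L2_time_AE_in[OF u] .
  then show "\<exists>s e. continuously_approximable T s \<and> e \<in> borel_measurable ?L \<and>
      integrable ?L (\<lambda>t. (e t)\<^sup>2) \<and> (LINT t|?L. (e t)\<^sup>2) \<le> \<delta> \<and>
      (AE t in ?L. u t \<in> HB \<and> HN (u t - s t) \<le> e t)"
    using continuously_approximable_simple[OF s'simple[of n] s'HB] dm[of n] int[of n] n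
    by (intro exI[of _ "s' n"] exI[of _ "\<lambda>t. HN (u t - s' n t)"]) auto
qed

end

section \<open>The dual space and the uniqueness argument\<close>

lemma H10_dual_add:
  "F \<in> H10_dual \<Omega> \<Longrightarrow> u \<in> H10 \<Omega> \<Longrightarrow> w \<in> H10 \<Omega> \<Longrightarrow> F (\<lambda>x. u x + w x) = F u + F w"
  unfolding H10_dual_def by simp

lemma H10_dual_scale: "F \<in> H10_dual \<Omega> \<Longrightarrow> u \<in> H10 \<Omega> \<Longrightarrow> F (\<lambda>x. c * u x) = c * F u"
  unfolding H10_dual_def by simp

lemma H10_dual_boundE:
  assumes "F \<in> H10_dual \<Omega>"
  obtains C where "\<And>u. u \<in> H10 \<Omega> \<Longrightarrow> \<bar>F u\<bar> \<le> C * H1_norm \<Omega> u"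
  using assms unfolding H10_dual_def by blast

context bounded_open_set
begin

text \<open>A supremum of reals is meaningful only for a bounded set, so every use of the dual norm
  rests on this bound.\<close>

lemma H10_dual_bdd_above:
  assumes "F \<in> H10_dual \<Omega>"
  shows "bdd_above ((\<lambda>u. \<bar>F u\<bar>) ` {u \<in> H10 \<Omega>. H1_norm \<Omega> u \<le> 1})"
proof -
  obtain C where C: "\<And>u. u \<in> H10 \<Omega> \<Longrightarrow> \<bar>F u\<bar> \<le> C * H1_norm \<Omega> u"
    using H10_dual_boundE[OF assms] by blast
  have "\<bar>F u\<bar> \<le> \<bar>C\<bar>" if "u \<in> H10 \<Omega>" "H1_norm \<Omega> u \<le> 1" for u
  proof -
    have "\<bar>F u\<bar> \<le> \<bar>C\<bar> * H1_norm \<Omega> u"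
      using C[OF that(1)] mult_right_mono[OF abs_ge_self[of C] H1_norm_nonneg[of \<Omega> u]] by linarith
    also have "\<dots> \<le> \<bar>C\<bar> * 1" using that by (intro mult_left_mono) auto
    finally show ?thesis by simp
  qed
  then show ?thesis by (intro bdd_aboveI2[where M="\<bar>C\<bar>"]) auto
qed

lemma H10_dual_le_norm:
  assumes F: "F \<in> H10_dual \<Omega>" and u: "u \<in> H10 \<Omega>"
  shows "\<bar>F u\<bar> \<le> H10_dual_norm \<Omega> F * H1_norm \<Omega> u"
proof (cases "H1_norm \<Omega> u = 0")
  \<comment> \<open>Normalising \<open>u\<close> is impossible here; the bound in the definition of
    \<open>H10_dual\<close> forces F u = 0.\<close>
  case True
  obtain C where "\<bar>F u\<bar> \<le> C * H1_norm \<Omega> u"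
    using H10_dual_boundE[OF F] u by blast
  with True show ?thesis by simp
next
  case False
  then have pos: "H1_norm \<Omega> u > 0" using H1_norm_nonneg[of \<Omega> u] by linarith
  let ?c = "1 / H1_norm \<Omega> u"
  have "H1_norm \<Omega> (\<lambda>x. ?c * u x) \<le> 1"
    using H1_norm_scale[OF H10_D(1)[OF u], of ?c] pos by simp
  then have "\<bar>F (\<lambda>x. ?c * u x)\<bar> \<le> H10_dual_norm \<Omega> F"
    unfolding H10_dual_norm_def
    by (intro cSUP_upper[OF _ H10_dual_bdd_above[OF F]] CollectI conjI H10_scale[OF u])
  moreover have "F (\<lambda>x. ?c * u x) = ?c * F u"
    by (rule H10_dual_scale[OF F u])
  ultimately have "\<bar>?c * F u\<bar> \<le> H10_dual_norm \<Omega> F" by (simp only:)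
  with pos show ?thesis by (simp add: abs_mult divide_le_eq)
qed

lemma H10_dual_diff:
  assumes F: "F \<in> H10_dual \<Omega>" and G: "G \<in> H10_dual \<Omega>"
  shows "F - G \<in> H10_dual \<Omega>"
proof -
  obtain C where C: "\<And>u. u \<in> H10 \<Omega> \<Longrightarrow> \<bar>F u\<bar> \<le> C * H1_norm \<Omega> u"
    using H10_dual_boundE[OF F] by blast
  obtain D where D: "\<And>u. u \<in> H10 \<Omega> \<Longrightarrow> \<bar>G u\<bar> \<le> D * H1_norm \<Omega> u"
    using H10_dual_boundE[OF G] by blast
  have "\<bar>(F - G) u\<bar> \<le> (C + D) * H1_norm \<Omega> u" if "u \<in> H10 \<Omega>" for u
    using C[OF that] D[OF that] by (simp add: algebra_simps)
  then show ?thesis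
    using F G unfolding H10_dual_def by (auto simp: right_diff_distrib intro!: exI[of _ "C + D"])
qed

lemma zero_H10_unit_ball: "(\<lambda>x. 0) \<in> {u \<in> H10 \<Omega>. H1_norm \<Omega> u \<le> 1}"
proof -
  have "(\<lambda>x. 0) \<in> H10 \<Omega>" by (rule test_function_H10[OF zero_test_function])
  with H1_norm_scale[OF H10_D(1)[OF this], of 0] show ?thesis by simp
qed

lemma H10_dual_norm_upper:
  "F \<in> H10_dual \<Omega> \<Longrightarrow> u \<in> {u \<in> H10 \<Omega>. H1_norm \<Omega> u \<le> 1} \<Longrightarrow> \<bar>F u\<bar> \<le> H10_dual_norm \<Omega> F"
  unfolding H10_dual_norm_def by (rule cSUP_upper[OF _ H10_dual_bdd_above])

lemma H10_dual_norm_nonneg: "F \<in> H10_dual \<Omega> \<Longrightarrow> 0 \<le> H10_dual_norm \<Omega> F"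
  using H10_dual_norm_upper[OF _ zero_H10_unit_ball] order_trans[OF abs_ge_zero] by blast

lemma H10_dual_norm_Lipschitz:
  assumes F: "F \<in> H10_dual \<Omega>" and G: "G \<in> H10_dual \<Omega>"
  shows "\<bar>H10_dual_norm \<Omega> F - H10_dual_norm \<Omega> G\<bar> \<le> H10_dual_norm \<Omega> (F - G)"
proof -
  let ?S = "{u \<in> H10 \<Omega>. H1_norm \<Omega> u \<le> 1}"
  have ne: "?S \<noteq> {}" using zero_H10_unit_ball by blast
  note upper = H10_dual_norm_upper
  note d = H10_dual_diff[OF F G]
  have "H10_dual_norm \<Omega> F \<le> H10_dual_norm \<Omega> G + H10_dual_norm \<Omega> (F - G)"
    unfolding H10_dual_norm_def[of \<Omega> F]
  proof (rule cSUP_least[OF ne])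
    fix u assume u: "u \<in> ?S"
    show "\<bar>F u\<bar> \<le> H10_dual_norm \<Omega> G + H10_dual_norm \<Omega> (F - G)"
      using upper[OF G u] upper[OF d u] by simp
  qed
  moreover have "H10_dual_norm \<Omega> G \<le> H10_dual_norm \<Omega> F + H10_dual_norm \<Omega> (F - G)"
    unfolding H10_dual_norm_def[of \<Omega> G]
  proof (rule cSUP_least[OF ne])
    fix u assume u: "u \<in> ?S"
    show "\<bar>G u\<bar> \<le> H10_dual_norm \<Omega> F + H10_dual_norm \<Omega> (F - G)"
      using upper[OF F u] upper[OF d u] by simp
  qed
  ultimately show ?thesis by linarith
qed

abbreviation DB :: "('n \<Rightarrow> 'n scalar_field \<Rightarrow> real) set" where "DB \<equiv> tuples (H10_dual \<Omega>)"
abbreviation DN :: "('n \<Rightarrow> 'n scalar_field \<Rightarrow> real) \<Rightarrow> real" where "DN \<equiv> tuple_norm (H10_dual_norm \<Omega>)"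

lemma DB_diff: "F \<in> DB \<Longrightarrow> G \<in> DB \<Longrightarrow> F - G \<in> DB"
  by (simp add: tuples_def H10_dual_diff)

lemma DN_Lipschitz: "F \<in> DB \<Longrightarrow> G \<in> DB \<Longrightarrow> \<bar>DN F - DN G\<bar> \<le> DN (F - G)"
  by (rule tuple_norm_Lipschitz) (simp add: tuples_def H10_dual_norm_Lipschitz)

lemma tuple_pairing_le:
  assumes "F \<in> DB" "q \<in> HB"
  shows "\<bar>tuple_pairing F q\<bar> \<le> DN F * HN q"
proof -
  have F: "F i \<in> H10_dual \<Omega>" and q: "q i \<in> H10 \<Omega>" for i using assms by (auto simp: tuples_def)
  have "\<bar>tuple_pairing F q\<bar> \<le> (\<Sum>i\<in>UNIV. \<bar>F i (q i)\<bar>)"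
    unfolding tuple_pairing_def by (rule sum_abs)
  also have "\<dots> \<le> (\<Sum>i\<in>UNIV. \<bar>H10_dual_norm \<Omega> (F i)\<bar> * \<bar>H1_norm \<Omega> (q i)\<bar>)"
    using H10_dual_le_norm[OF F q] H10_dual_norm_nonneg[OF F] by (intro sum_mono) simp
  also have "\<dots> \<le> DN F * HN q"
    unfolding tuple_norm_eq_L2_set by (rule L2_set_mult_ineq)
  finally show ?thesis .
qed

lemma tuple_pairing_diff_right:
  assumes "F \<in> DB" "p \<in> HB" "q \<in> HB"
  shows "tuple_pairing F p - tuple_pairing F q = tuple_pairing F (p - q)"
proof -
  have "F i (p i) - F i (q i) = F i ((p - q) i)" for i
  proof -
    have Fi: "F i \<in> H10_dual \<Omega>" and pi: "p i \<in> H10 \<Omega>" and qi: "q i \<in> H10 \<Omega>" using assms by (auto simp: tuples_def)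
    have "F i (\<lambda>x. p i x + (-1) * q i x) = F i (p i) + F i (\<lambda>x. (-1) * q i x)"
      by (rule H10_dual_add[OF Fi pi H10_scale[OF qi]])
    moreover have "F i (\<lambda>x. (-1) * q i x) = (-1) * F i (q i)"
      by (rule H10_dual_scale[OF Fi qi])
    ultimately show ?thesis by (simp add: fun_diff_def)
  qed
  then show ?thesis by (simp add: tuple_pairing_def sum_subtractf[symmetric])
qed

text \<open>Pairing with a fixed \<open>q\<close> is Lipschitz for the dual norm, which gives
  measurability; the product of norms is at most the sum of their squares, which gives
  integrability.\<close>

lemma dual_time_pairing_integrable:
  assumes v: "v \<in> L2_time T DB DN" and q: "q \<in> HB"
  shows "integrable (lebesgue_on {0<..<T}) (\<lambda>t. tuple_pairing (v t) q)"
proof (rule Bochner_Integration.integrable_bound)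
  let ?L = "lebesgue_on {0<..<T}"
  have Nv: "integrable ?L (\<lambda>t. (DN (v t))\<^sup>2)"
    by (rule L2_time_square_integrable[OF v], rule DN_Lipschitz, assumption+)
  show "integrable ?L (\<lambda>t. (DN (v t))\<^sup>2 + (HN q)\<^sup>2)"
    by (intro Bochner_Integration.integrable_add Nv continuous_integrable_time) simp
  show "(\<lambda>t. tuple_pairing (v t) q) \<in> borel_measurable ?L"
  proof (rule L2_time_compose_measurable[OF v])
    fix f x assume f: "\<And>n. f n \<in> DB" "x \<in> DB" "(\<lambda>n. DN (f n - x)) \<longlonglongrightarrow> 0"
    have "(\<lambda>n. DN (f n - x) * HN q) \<longlonglongrightarrow> 0 * HN q" by (intro tendsto_intros f(3))
    then have l: "(\<lambda>n. DN (f n - x) * HN q) \<longlonglongrightarrow> 0" by simp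
    have "\<bar>tuple_pairing (f n) q - tuple_pairing x q\<bar> \<le> DN (f n - x) * HN q" for n
    proof -
      have "tuple_pairing (f n) q - tuple_pairing x q = tuple_pairing (f n - x) q"
        by (simp add: tuple_pairing_def sum_subtractf)
      then show ?thesis using tuple_pairing_le[OF DB_diff[OF f(1) f(2)] q] by simp
    qed
    then have "(\<lambda>n. \<bar>tuple_pairing (f n) q - tuple_pairing x q\<bar>) \<longlonglongrightarrow> 0"
      by (intro tendsto_sandwich[OF _ _ tendsto_const l]) auto
    then show "(\<lambda>n. tuple_pairing (f n) q) \<longlonglongrightarrow> tuple_pairing x q"
      by (simp add: tendsto_rabs_zero_iff LIM_zero_iff)
  qed
  show "AE t in ?L. norm (tuple_pairing (v t) q) \<le> norm ((DN (v t))\<^sup>2 + (HN q)\<^sup>2)"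
    using L2_time_AE_in[OF v]
  proof eventually_elim
    case (elim t)
    have "\<bar>tuple_pairing (v t) q\<bar> \<le> DN (v t) * HN q" by (rule tuple_pairing_le[OF elim q])
    also have "\<dots> \<le> (DN (v t))\<^sup>2 + (HN q)\<^sup>2"
      using sum_squares_bound[of "DN (v t)" "HN q"] zero_le_power2[of "DN (v t)"] zero_le_power2[of "HN q"]
        mult_nonneg_nonneg[OF tuple_norm_nonneg[of "H10_dual_norm \<Omega>" "v t"] tuple_norm_nonneg[of "H1_norm \<Omega>" q]]
      by linarith
    finally show ?case by simp
  qed
qed

text \<open>The sum of the inner products of R(t) with q is continuous in t and agrees almost
  everywhere with the pairing of the embedded \<open>P\<close> with q, so its weak derivative is the
  pairing of P' with q and the scalar increment formula applies. The continuous representative gives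
  meaning to values at individual times.\<close>

lemma L2_time_rep_increment:
  assumes P: "P \<in> L2_time T HB HN"
    and R: "\<And>t. t \<in> {0..T} \<Longrightarrow> R t \<in> tuples (L2 \<Omega>)"
      "\<And>t. t \<in> {0..T} \<Longrightarrow> ((\<lambda>s. tuple_norm (L2_norm \<Omega>) (R s - R t)) \<longlongrightarrow> 0) (at t within {0..T})"
      "AE t in lebesgue_on {0<..<T}. \<forall>i. AE x in lebesgue_on \<Omega>. R t i x = P t i x"
    and P': "has_time_derivative T DB DN (H10_dual_functionals \<Omega>) (\<lambda>t. embed_dual \<Omega> (P t)) P'"
    and q: "q \<in> HB" and st: "0 < s" "s < t" "t < T"
  shows "(\<Sum>i\<in>UNIV. L2_inner \<Omega> (R t i) (q i)) - (\<Sum>i\<in>UNIV. L2_inner \<Omega> (R s i) (q i))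
    = (LINT \<sigma>|lebesgue_on {0<..<T}. indicator {s<..t} \<sigma> * tuple_pairing (P' \<sigma>) q)"
proof -
  let ?L = "lebesgue_on {0<..<T}"
  define a where "a t = (\<Sum>i\<in>UNIV. L2_inner \<Omega> (R t i) (q i))" for t
  have qL2: "q i \<in> L2 \<Omega>" for i using q by (auto simp: tuples_def dest: H10_D)
  have RL2: "R t i \<in> L2 \<Omega>" if "t \<in> {0..T}" for t i using R(1)[OF that] by (simp add: tuples_def)
  have cont: "continuous_on {0..T} a"
    unfolding continuous_on
  proof
    fix t assume t: "t \<in> {0..T}"
    let ?N = "\<lambda>s. tuple_norm (L2_norm \<Omega>) (R s - R t)" and ?Q = "tuple_norm (L2_norm \<Omega>) q"
    have "\<bar>a s - a t\<bar> \<le> ?N s * ?Q" if s: "s \<in> {0..T}" for s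
    proof -
      have "a s - a t = (\<Sum>i\<in>UNIV. L2_inner \<Omega> ((R s - R t) i) (q i))"
        using RL2[OF s] RL2[OF t] qL2
        by (simp add: a_def sum_subtractf[symmetric] fun_diff_def L2_inner_diff_left)
      also have "\<bar>\<dots>\<bar> \<le> (\<Sum>i\<in>UNIV. \<bar>L2_inner \<Omega> ((R s - R t) i) (q i)\<bar>)" by (rule sum_abs)
      also have "\<dots> \<le> (\<Sum>i\<in>UNIV. \<bar>L2_norm \<Omega> ((R s - R t) i)\<bar> * \<bar>L2_norm \<Omega> (q i)\<bar>)"
      proof (rule sum_mono)
        fix i
        have "(R s - R t) i \<in> L2 \<Omega>" using RL2[OF s] RL2[OF t] by (simp add: fun_diff_def L2_diff)
        from L2_inner_le_norm[OF this qL2]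
        show "\<bar>L2_inner \<Omega> ((R s - R t) i) (q i)\<bar> \<le> \<bar>L2_norm \<Omega> ((R s - R t) i)\<bar> * \<bar>L2_norm \<Omega> (q i)\<bar>" by simp
      qed
      also have "\<dots> \<le> ?N s * ?Q" unfolding tuple_norm_eq_L2_set by (rule L2_set_mult_ineq)
      finally show ?thesis .
    qed
    then have ev: "\<forall>\<^sub>F s in at t within {0..T}. \<bar>a s - a t\<bar> \<le> ?N s * ?Q"
      by (auto simp: eventually_at_filter)
    have "((\<lambda>s. ?N s * ?Q) \<longlongrightarrow> 0 * ?Q) (at t within {0..T})" by (intro tendsto_intros R(2) t)
    then have lim: "((\<lambda>s. ?N s * ?Q) \<longlongrightarrow> 0) (at t within {0..T})" by simp
    have "((\<lambda>s. \<bar>a s - a t\<bar>) \<longlongrightarrow> 0) (at t within {0..T})"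
      by (rule tendsto_sandwich[OF _ ev tendsto_const lim]) simp
    then show "(a \<longlongrightarrow> a t) (at t within {0..T})"
      by (simp add: tendsto_rabs_zero_iff LIM_zero_iff)
  qed
  have P'L2: "P' \<in> L2_time T DB DN" using P' by (simp add: has_time_derivative_def)
  have aAE: "AE t in ?L. tuple_pairing (embed_dual \<Omega> (P t)) q = a t"
  proof -
    have "AE t in ?L. t \<in> {0<..<T}" by (rule AE_I2) simp
    with R(3) L2_time_AE_in[OF P] show ?thesis
    proof eventually_elim
      case (elim t)
      have "L2_inner \<Omega> (P t i) (q i) = L2_inner \<Omega> (R t i) (q i)" for i
      proof (rule L2_inner_cong_AE)
        show "AE x in lebesgue_on \<Omega>. P t i x = R t i x" using elim(1)[rule_format, of i] by eventually_elim simp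
        show "P t i \<in> L2 \<Omega>" using elim(2) by (auto simp: tuples_def dest: H10_D)
        show "R t i \<in> L2 \<Omega>" using elim(3) by (intro RL2) auto
      qed (auto simp: qL2)
      then show ?case by (simp add: tuple_pairing_def embed_dual_def a_def)
    qed
  qed
  have "a t - a s = (LINT \<sigma>|?L. indicator {s<..t} \<sigma> * tuple_pairing (P' \<sigma>) q)"
  proof (rule weak_derivative_increment[OF cont dual_time_pairing_integrable[OF P'L2 q] _ st])
    fix \<psi> assume \<psi>: "\<psi> \<in> test_functions {0<..<T}"
    have "(\<lambda>F. tuple_pairing F q) \<in> H10_dual_functionals \<Omega>" using q by (auto simp: H10_dual_functionals_def)
    with P' \<psi> have eq: "(LINT t|?L. deriv \<psi> t * tuple_pairing (embed_dual \<Omega> (P t)) q) = - (LINT t|?L. \<psi> t * tuple_pairing (P' t) q)"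
      by (auto simp: has_time_derivative_def)
    have PL2: "(\<lambda>t. embed_dual \<Omega> (P t)) \<in> L2_time T DB DN" using P' by (simp add: has_time_derivative_def)
    have dm: "deriv \<psi> \<in> borel_measurable ?L"
    proof -
      have "deriv \<psi> = partial 1 \<psi>"
        using smooth_differentiable[OF test_function_smooth[OF \<psi>]] by (auto simp: partial_one_eq_deriv)
      then show ?thesis using smooth_partial[OF test_function_smooth[OF \<psi>], of 1] by (simp add: smooth_measurable_lebesgue)
    qed
    have "(LINT t|?L. deriv \<psi> t * a t) = (LINT t|?L. deriv \<psi> t * tuple_pairing (embed_dual \<Omega> (P t)) q)"
    proof (rule integral_cong_AE)
      show "(\<lambda>t. deriv \<psi> t * a t) \<in> borel_measurable ?L"
        by (intro borel_measurable_times dm borel_measurable_integrable[OF continuous_integrable_time[OF cont]])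
      show "(\<lambda>t. deriv \<psi> t * tuple_pairing (embed_dual \<Omega> (P t)) q) \<in> borel_measurable ?L"
        by (intro borel_measurable_times dm borel_measurable_integrable[OF dual_time_pairing_integrable[OF PL2 q]])
      show "AE t in ?L. deriv \<psi> t * a t = deriv \<psi> t * tuple_pairing (embed_dual \<Omega> (P t)) q"
        using aAE by eventually_elim simp
    qed
    with eq show "(LINT t|?L. deriv \<psi> t * a t) = - (LINT t|?L. \<psi> t * tuple_pairing (P' t) q)" by simp
  qed
  then show ?thesis by (simp add: a_def)
qed

end

section \<open>Energy of the difference of two solutions and uniqueness\<close>

context bounded_open_set
begin

lemma L2_tuple_norm_diff_le:
  assumes "u \<in> tuples (L2 \<Omega>)" "v \<in> tuples (L2 \<Omega>)"
  shows "tuple_norm (L2_norm \<Omega>) (u - v) \<le> tuple_norm (L2_norm \<Omega>) u + tuple_norm (L2_norm \<Omega>) v"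
proof -
  have "L2_norm \<Omega> ((u - v) i) \<le> L2_norm \<Omega> (u i) + L2_norm \<Omega> (v i)" for i
    using L2_norm_lincomb_le[of "u i" \<Omega> "v i" 1 "-1"] assms by (simp add: tuples_def fun_diff_def)
  then have "tuple_norm (L2_norm \<Omega>) (u - v) \<le> L2_set (\<lambda>i. L2_norm \<Omega> (u i) + L2_norm \<Omega> (v i)) UNIV"
    unfolding tuple_norm_eq_L2_set by (intro L2_set_mono) auto
  also have "\<dots> \<le> tuple_norm (L2_norm \<Omega>) u + tuple_norm (L2_norm \<Omega>) v"
    unfolding tuple_norm_eq_L2_set by (rule L2_set_triangle_ineq)
  finally show ?thesis .
qed

lemma L2_tuple_norm_Lipschitz:
  assumes "u \<in> tuples (L2 \<Omega>)" "v \<in> tuples (L2 \<Omega>)"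
  shows "\<bar>tuple_norm (L2_norm \<Omega>) u - tuple_norm (L2_norm \<Omega>) v\<bar> \<le> tuple_norm (L2_norm \<Omega>) (u - v)"
proof (rule tuple_norm_Lipschitz)
  fix i
  have uv: "u i \<in> L2 \<Omega>" "v i \<in> L2 \<Omega>" using assms by (auto simp: tuples_def)
  have d: "u i - v i \<in> L2 \<Omega>" using uv by (simp add: fun_diff_def L2_diff)
  have "L2_norm \<Omega> (u i) \<le> L2_norm \<Omega> (u i - v i) + L2_norm \<Omega> (v i)"
    using L2_norm_add_le[OF d uv(2)] by simp
  moreover have "L2_norm \<Omega> (v i) \<le> L2_norm \<Omega> (u i - v i) + L2_norm \<Omega> (u i)"
    using L2_norm_lincomb_le[OF d uv(1), of "-1" 1] by simp
  ultimately show "\<bar>L2_norm \<Omega> (u i) - L2_norm \<Omega> (v i)\<bar> \<le> L2_norm \<Omega> (u i - v i)" by linarith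
qed

lemma L2_tuple_distance_continuous:
  fixes R S :: "real \<Rightarrow> 'n \<Rightarrow> 'n scalar_field"
  assumes R: "\<And>t. t \<in> {0..T} \<Longrightarrow> R t \<in> tuples (L2 \<Omega>)"
      "\<And>t. t \<in> {0..T} \<Longrightarrow> ((\<lambda>s. tuple_norm (L2_norm \<Omega>) (R s - R t)) \<longlongrightarrow> 0) (at t within {0..T})"
    and S: "\<And>t. t \<in> {0..T} \<Longrightarrow> S t \<in> tuples (L2 \<Omega>)"
      "\<And>t. t \<in> {0..T} \<Longrightarrow> ((\<lambda>s. tuple_norm (L2_norm \<Omega>) (S s - S t)) \<longlongrightarrow> 0) (at t within {0..T})"
  shows "continuous_on {0..T} (\<lambda>t. tuple_norm (L2_norm \<Omega>) (R t - S t))"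
  unfolding continuous_on
proof
  let ?n = "tuple_norm (L2_norm \<Omega>) :: ('n \<Rightarrow> 'n scalar_field) \<Rightarrow> real"
  fix t assume t: "t \<in> {0..T}"
  have diff: "u - v \<in> tuples (L2 \<Omega>)" if "u \<in> tuples (L2 \<Omega>)" "v \<in> tuples (L2 \<Omega>)" for u v :: "'n \<Rightarrow> 'n scalar_field"
    using that by (simp add: tuples_def fun_diff_def L2_diff)
  have "\<bar>?n (R s - S s) - ?n (R t - S t)\<bar> \<le> ?n (R s - R t) + ?n (S s - S t)" if s: "s \<in> {0..T}" for s
  proof -
    have "\<bar>?n (R s - S s) - ?n (R t - S t)\<bar> \<le> ?n ((R s - S s) - (R t - S t))"
      using R(1) S(1) s t by (intro L2_tuple_norm_Lipschitz diff)
    also have "(R s - S s) - (R t - S t) = (R s - R t) - (S s - S t)" by (simp add: fun_eq_iff)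
    also have "?n \<dots> \<le> ?n (R s - R t) + ?n (S s - S t)"
      using R(1) S(1) s t by (intro L2_tuple_norm_diff_le diff)
    finally show ?thesis .
  qed
  then have ev: "\<forall>\<^sub>F s in at t within {0..T}. \<bar>?n (R s - S s) - ?n (R t - S t)\<bar> \<le> ?n (R s - R t) + ?n (S s - S t)"
    by (auto simp: eventually_at_filter)
  have lim: "((\<lambda>s. ?n (R s - R t) + ?n (S s - S t)) \<longlongrightarrow> 0) (at t within {0..T})"
    using tendsto_add[OF R(2)[OF t] S(2)[OF t]] by simp
  have "((\<lambda>s. \<bar>?n (R s - S s) - ?n (R t - S t)\<bar>) \<longlongrightarrow> 0) (at t within {0..T})"
    by (rule tendsto_sandwich[OF _ ev tendsto_const lim]) simp
  then show "((\<lambda>s. ?n (R s - S s)) \<longlongrightarrow> ?n (R t - S t)) (at t within {0..T})"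
    by (simp add: tendsto_rabs_zero_iff LIM_zero_iff)
qed

text \<open>The expansion of the squared norm of u - v, which is nonnegative. It replaces the chain
  rule for the squared norm by an inequality in the direction that is needed.\<close>

lemma L2_norm_square_diff_le:
  assumes "u \<in> L2 \<Omega>" "v \<in> L2 \<Omega>"
  shows "(L2_norm \<Omega> u)\<^sup>2 - (L2_norm \<Omega> v)\<^sup>2 \<le> 2 * (L2_inner \<Omega> u u - L2_inner \<Omega> v u)"
proof -
  have "0 \<le> L2_inner \<Omega> (\<lambda>x. u x - v x) (\<lambda>x. u x - v x)" by (rule L2_inner_self_nonneg)
  also have "\<dots> = L2_inner \<Omega> u u - 2 * L2_inner \<Omega> v u + L2_inner \<Omega> v v"
    using assms L2_diff[OF assms] by (simp add: L2_inner_diff_left L2_inner_diff_right L2_inner_commute[of \<Omega> u v])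
  finally show ?thesis by (simp add: L2_norm_square)
qed

lemma weak_gradient_flowE:
  assumes "weak_gradient_flow \<Omega> \<Phi> T \<rho>\<^sub>v \<alpha> \<beta> \<gamma> g \<rho> P0 P"
  obtains P' R where "P \<in> L2_time T HB HN"
    "\<And>t. t \<in> {0..T} \<Longrightarrow> R t \<in> tuples (L2 \<Omega>)"
    "\<And>t. t \<in> {0..T} \<Longrightarrow> ((\<lambda>s. tuple_norm (L2_norm \<Omega>) (R s - R t)) \<longlongrightarrow> 0) (at t within {0..T})"
    "AE t in lebesgue_on {0<..<T}. \<forall>i. AE x in lebesgue_on \<Omega>. R t i x = P t i x"
    "\<And>i. AE x in lebesgue_on \<Omega>. R 0 i x = P0 i x"
    "has_time_derivative T DB DN (H10_dual_functionals \<Omega>) (\<lambda>t. embed_dual \<Omega> (P t)) P'"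
    "AE t in lebesgue_on {0<..<T}. \<forall>q\<in>HB. \<rho>\<^sub>v * tuple_pairing (P' t) q + flow_form \<Omega> \<Phi> \<alpha> \<beta> \<gamma> g (\<rho> t) (P t) q = 0"
proof -
  obtain P' where P': "has_time_derivative T DB DN (H10_dual_functionals \<Omega>) (\<lambda>t. embed_dual \<Omega> (P t)) P'"
    "AE t in lebesgue_on {0<..<T}. \<forall>q\<in>HB. \<rho>\<^sub>v * tuple_pairing (P' t) q + flow_form \<Omega> \<Phi> \<alpha> \<beta> \<gamma> g (\<rho> t) (P t) q = 0"
    using assms unfolding weak_gradient_flow_def Let_def flow_form_def add.assoc by blast
  obtain R where R: "\<forall>t\<in>{0..T}. R t \<in> tuples (L2 \<Omega>)"
    "\<forall>t\<in>{0..T}. ((\<lambda>s. tuple_norm (L2_norm \<Omega>) (R s - R t)) \<longlongrightarrow> 0) (at t within {0..T})"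
    "AE t in lebesgue_on {0<..<T}. \<forall>i. AE x in lebesgue_on \<Omega>. R t i x = P t i x"
    "\<forall>i. AE x in lebesgue_on \<Omega>. R 0 i x = P0 i x"
    using assms unfolding weak_gradient_flow_def has_initial_value_def by blast
  have P: "P \<in> L2_time T HB HN" using assms by (simp add: weak_gradient_flow_def)
  show ?thesis
    by (rule that[OF P bspec[OF R(1)] bspec[OF R(2)] R(3) spec[OF R(4)] P'])
qed

text \<open>Both solutions enter the abstract energy argument: the increments of the energy come
  from the time derivatives, the bound on them from the dissipation estimate at the times where both
  weak equations hold.\<close>

theorem weak_gradient_flow_unique:
  assumes dim: "CARD('n) \<le> 3" and pos: "\<rho>\<^sub>v > 0" "T > 0" "g > 0"
    and coeff: "\<gamma> > 0 \<or> (\<gamma> = 0 \<and> \<beta> > 0)"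
    and \<Phi>: "solution_operator \<Omega> \<Gamma> \<epsilon> \<Phi>" "H2_regular \<Omega> \<Phi>"
    and \<rho>: "\<rho> \<in> L2_time T (L2 \<Omega>) (L2_norm \<Omega>)"
    and wP: "weak_gradient_flow \<Omega> \<Phi> T \<rho>\<^sub>v \<alpha> \<beta> \<gamma> g \<rho> P0 P"
    and wQ: "weak_gradient_flow \<Omega> \<Phi> T \<rho>\<^sub>v \<alpha> \<beta> \<gamma> g \<rho> P0 Q"
  shows "AE t in lebesgue_on {0<..<T}. \<forall>i. AE x in lebesgue_on \<Omega>. P t i x = Q t i x"
proof (rule gradient_flow_dissipation[OF dim coeff pos(3) \<Phi>, of \<alpha>])
  fix C assume C: "C \<ge> 0"
    "\<And>P Q r F G. P \<in> tuples (H10 \<Omega>) \<Longrightarrow> Q \<in> tuples (H10 \<Omega>) \<Longrightarrow> r \<in> L2 \<Omega> \<Longrightarrow>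
      (\<And>q. q \<in> tuples (H10 \<Omega>) \<Longrightarrow> F q + flow_form \<Omega> \<Phi> \<alpha> \<beta> \<gamma> g r P q = 0) \<Longrightarrow>
      (\<And>q. q \<in> tuples (H10 \<Omega>) \<Longrightarrow> G q + flow_form \<Omega> \<Phi> \<alpha> \<beta> \<gamma> g r Q q = 0) \<Longrightarrow>
      F (\<lambda>i x. P i x - Q i x) - G (\<lambda>i x. P i x - Q i x) \<le> C * (\<Sum>i\<in>UNIV. (L2_norm \<Omega> (\<lambda>x. P i x - Q i x))\<^sup>2)"
  let ?L = "lebesgue_on {0<..<T}"
  let ?n = "tuple_norm (L2_norm \<Omega>) :: ('n \<Rightarrow> 'n scalar_field) \<Rightarrow> real"
  obtain P' R where P: "P \<in> L2_time T HB HN"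
    and R: "\<And>t. t \<in> {0..T} \<Longrightarrow> R t \<in> tuples (L2 \<Omega>)"
      "\<And>t. t \<in> {0..T} \<Longrightarrow> ((\<lambda>s. ?n (R s - R t)) \<longlongrightarrow> 0) (at t within {0..T})"
      "AE t in ?L. \<forall>i. AE x in lebesgue_on \<Omega>. R t i x = P t i x"
      "\<And>i. AE x in lebesgue_on \<Omega>. R 0 i x = P0 i x"
    and P': "has_time_derivative T DB DN (H10_dual_functionals \<Omega>) (\<lambda>t. embed_dual \<Omega> (P t)) P'"
    and eqP: "AE t in ?L. \<forall>q\<in>HB. \<rho>\<^sub>v * tuple_pairing (P' t) q + flow_form \<Omega> \<Phi> \<alpha> \<beta> \<gamma> g (\<rho> t) (P t) q = 0"
    by (rule weak_gradient_flowE[OF wP]) (rule that)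
  obtain Q' S where Q: "Q \<in> L2_time T HB HN"
    and S: "\<And>t. t \<in> {0..T} \<Longrightarrow> S t \<in> tuples (L2 \<Omega>)"
      "\<And>t. t \<in> {0..T} \<Longrightarrow> ((\<lambda>s. ?n (S s - S t)) \<longlongrightarrow> 0) (at t within {0..T})"
      "AE t in ?L. \<forall>i. AE x in lebesgue_on \<Omega>. S t i x = Q t i x"
      "\<And>i. AE x in lebesgue_on \<Omega>. S 0 i x = P0 i x"
    and Q': "has_time_derivative T DB DN (H10_dual_functionals \<Omega>) (\<lambda>t. embed_dual \<Omega> (Q t)) Q'"
    and eqQ: "AE t in ?L. \<forall>q\<in>HB. \<rho>\<^sub>v * tuple_pairing (Q' t) q + flow_form \<Omega> \<Phi> \<alpha> \<beta> \<gamma> g (\<rho> t) (Q t) q = 0"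
    by (rule weak_gradient_flowE[OF wQ]) (rule that)
  have P'L2: "P' \<in> L2_time T DB DN" and Q'L2: "Q' \<in> L2_time T DB DN"
    using P' Q' by (auto simp: has_time_derivative_def)
  define W where "W t = P t - Q t" for t
  have W_eq: "W t = (\<lambda>i x. P t i x - Q t i x)" for t by (simp add: W_def fun_eq_iff)
  \<comment> \<open>Formed from the continuous representatives, so that E is continuous on {0..T}
    and vanishes at 0; at good times it is the squared norm of W.\<close>
  define E where "E t = (?n (R t - S t))\<^sup>2" for t
  have E_sum: "E t = (\<Sum>i\<in>UNIV. (L2_norm \<Omega> (R t i - S t i))\<^sup>2)" for t
    by (simp add: E_def tuple_norm_def sum_nonneg)
  \<comment> \<open>The cost of changing the test function:
    \<open>a t \<sigma> - a \<sigma> \<sigma>\<close> is at most \<open>n \<sigma>\<close> times the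
    \<open>H10\<close> distance between W(t) and W(\<sigma>).\<close>
  define n where "n t = 2 * (DN (P' t) + DN (Q' t))" for t
  \<comment> \<open>Twice the pairing of W'(\<sigma>) with W(t); its diagonal values are what the
    dissipation estimate controls.\<close>
  define a where "a t \<sigma> = 2 * (tuple_pairing (P' \<sigma>) (W t) - tuple_pairing (Q' \<sigma>) (W t))" for t \<sigma>
  define good where "good t \<longleftrightarrow> t \<in> {0<..<T} \<and> P t \<in> HB \<and> Q t \<in> HB \<and>
    (\<forall>i. AE x in lebesgue_on \<Omega>. R t i x = P t i x) \<and> (\<forall>i. AE x in lebesgue_on \<Omega>. S t i x = Q t i x)" for t
  have RL: "R t i \<in> L2 \<Omega>" "S t i \<in> L2 \<Omega>" "R t i - S t i \<in> L2 \<Omega>" if "t \<in> {0..T}" for t i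
    using R(1)[OF that] S(1)[OF that] by (auto simp: tuples_def fun_diff_def L2_diff)
  have inT: "AE t in ?L. t \<in> {0<..<T}" by (rule AE_I2) simp
  have good: "AE t in ?L. good t"
    using inT R(3) S(3) L2_time_AE_in[OF P] L2_time_AE_in[OF Q]
    by eventually_elim (simp add: good_def)
  have W_HB: "W t \<in> HB" if "good t" for t
    using that by (auto simp: good_def W_eq intro: HB_diff)
  have W_AE: "AE x in lebesgue_on \<Omega>. (R t i - S t i) x = W t i x" if "good t" for t i
  proof -
    have "AE x in lebesgue_on \<Omega>. R t i x = P t i x" "AE x in lebesgue_on \<Omega>. S t i x = Q t i x"
      using that by (auto simp: good_def)
    then show ?thesis by eventually_elim (simp add: W_def)
  qed
  have W_L2: "W t i \<in> L2 \<Omega>" if "good t" for t i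
    using W_HB[OF that] by (auto simp: tuples_def dest: H10_D)
  have E_W: "E t = (\<Sum>i\<in>UNIV. (L2_norm \<Omega> (W t i))\<^sup>2)" if "good t" for t
  proof -
    have "t \<in> {0..T}" using that by (auto simp: good_def)
    then have "L2_norm \<Omega> (R t i - S t i) = L2_norm \<Omega> (W t i)" for i
      by (intro L2_norm_cong_AE W_AE[OF that] RL W_L2[OF that])
    then show ?thesis by (simp add: E_sum)
  qed
  have E_zero: "E t = 0" if t: "0 < t" "t < T" for t
  \<comment> \<open>The factor 2 comes from the squared norm, and division by
    \<open>\<rho>\<^sub>v\<close> removes the viscosity in front of the time derivative.\<close>
  proof (rule energy_estimate_zero[where E=E and n=n and a=a and good=good and C="2 * C / \<rho>\<^sub>v", OF pos(2) _ _ _ _ _ _ good _ _ t])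
    show "continuous_on {0..T} E"
      unfolding E_def using L2_tuple_distance_continuous[OF R(1,2) S(1,2)] by (intro continuous_intros) auto
    show "E 0 = 0"
    proof -
      have "L2_norm \<Omega> (R 0 i - S 0 i) = L2_norm \<Omega> (\<lambda>x. 0)" for i
      proof (rule L2_norm_cong_AE)
        show "AE x in lebesgue_on \<Omega>. (R 0 i - S 0 i) x = 0"
          using R(4)[of i] S(4)[of i] by eventually_elim simp
      qed (use RL pos L2_zero in auto)
      then show ?thesis by (simp add: E_sum)
    qed
    show "0 \<le> E t" for t by (simp add: E_def)
    show "0 \<le> 2 * C / \<rho>\<^sub>v" using C(1) pos by simp
    have Np: "(\<lambda>t. DN (P' t)) \<in> borel_measurable ?L" "integrable ?L (\<lambda>t. (DN (P' t))\<^sup>2)"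
      by (rule L2_time_square_integrable[OF P'L2], rule DN_Lipschitz, assumption+)+
    have Nq: "(\<lambda>t. DN (Q' t)) \<in> borel_measurable ?L" "integrable ?L (\<lambda>t. (DN (Q' t))\<^sup>2)"
      by (rule L2_time_square_integrable[OF Q'L2], rule DN_Lipschitz, assumption+)+
    show "n \<in> borel_measurable ?L" unfolding n_def using Np(1) Nq(1) by simp
    show "integrable ?L (\<lambda>t. (n t)\<^sup>2)"
      unfolding n_def power_mult_distrib
      using square_sum_integrable(1)[OF Np(1) Nq(1) Np(2) Nq(2)] by simp
    show "integrable ?L (a t) \<and> E t - E s \<le> (LINT \<sigma>|?L. indicator {s<..t} \<sigma> * a t \<sigma>)"
      if st: "0 < s" "s < t" "t < T" and gt: "good t" for s t
    proof
      note iP = dual_time_pairing_integrable[OF P'L2 W_HB[OF gt]]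
      note iQ = dual_time_pairing_integrable[OF Q'L2 W_HB[OF gt]]
      show "integrable ?L (a t)" unfolding a_def[abs_def] using iP iQ by simp
      have tT: "t \<in> {0..T}" and sT: "s \<in> {0..T}" using st by auto
      \<comment> \<open>Both increments are tested with W(t), which lies in \<open>H10\<close>
        because t is good. The time s is any earlier one and occurs only through the continuous
        representatives.\<close>
      have "E t - E s \<le> (\<Sum>i\<in>UNIV. 2 * ((L2_inner \<Omega> (R t i) (W t i) - L2_inner \<Omega> (S t i) (W t i)) - (L2_inner \<Omega> (R s i) (W t i) - L2_inner \<Omega> (S s i) (W t i))))"
        unfolding E_sum sum_subtractf[symmetric]
      proof (rule sum_mono)
        fix i
        have c: "L2_inner \<Omega> (R \<tau> i - S \<tau> i) (R t i - S t i) = L2_inner \<Omega> (R \<tau> i) (W t i) - L2_inner \<Omega> (S \<tau> i) (W t i)"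
          if "\<tau> \<in> {0..T}" for \<tau>
        proof -
          have "L2_inner \<Omega> (R \<tau> i - S \<tau> i) (R t i - S t i) = L2_inner \<Omega> (R \<tau> i - S \<tau> i) (W t i)"
            by (intro L2_inner_cong_AE W_AE[OF gt] RL that tT W_L2[OF gt]) simp
          also have "\<dots> = L2_inner \<Omega> (R \<tau> i) (W t i) - L2_inner \<Omega> (S \<tau> i) (W t i)"
            using RL[OF that] W_L2[OF gt] by (simp add: fun_diff_def L2_inner_diff_left)
          finally show ?thesis .
        qed
        show "(L2_norm \<Omega> (R t i - S t i))\<^sup>2 - (L2_norm \<Omega> (R s i - S s i))\<^sup>2
          \<le> 2 * ((L2_inner \<Omega> (R t i) (W t i) - L2_inner \<Omega> (S t i) (W t i)) - (L2_inner \<Omega> (R s i) (W t i) - L2_inner \<Omega> (S s i) (W t i)))"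
          using L2_norm_square_diff_le[OF RL(3)[OF tT] RL(3)[OF sT], of i i] unfolding c[OF tT] c[OF sT] .
      qed
      also have "\<dots> = 2 * (((\<Sum>i\<in>UNIV. L2_inner \<Omega> (R t i) (W t i)) - (\<Sum>i\<in>UNIV. L2_inner \<Omega> (R s i) (W t i)))
          - ((\<Sum>i\<in>UNIV. L2_inner \<Omega> (S t i) (W t i)) - (\<Sum>i\<in>UNIV. L2_inner \<Omega> (S s i) (W t i))))"
        by (simp add: sum_distrib_left[symmetric] sum_subtractf)
      also have "\<dots> = 2 * ((LINT \<sigma>|?L. indicator {s<..t} \<sigma> * tuple_pairing (P' \<sigma>) (W t)) - (LINT \<sigma>|?L. indicator {s<..t} \<sigma> * tuple_pairing (Q' \<sigma>) (W t)))"
        using L2_time_rep_increment[OF P R(1-3) P' W_HB[OF gt] st] L2_time_rep_increment[OF Q S(1-3) Q' W_HB[OF gt] st] by simp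
      also have "\<dots> = (LINT \<sigma>|?L. indicator {s<..t} \<sigma> * a t \<sigma>)"
      proof -
        have "indicator {s<..t} \<sigma> * a t \<sigma> = 2 * (indicator {s<..t} \<sigma> * tuple_pairing (P' \<sigma>) (W t) - indicator {s<..t} \<sigma> * tuple_pairing (Q' \<sigma>) (W t))" for \<sigma>
          by (simp add: a_def algebra_simps)
        then show ?thesis
          using integrable_indicator_time[OF iP] integrable_indicator_time[OF iQ] by simp
      qed
      finally show "E t - E s \<le> (LINT \<sigma>|?L. indicator {s<..t} \<sigma> * a t \<sigma>)" .
    qed
    show "\<exists>r h0. h0 > 0 \<and> r \<in> borel_measurable ?L \<and> integrable ?L (\<lambda>t. (r t)\<^sup>2) \<and> (LINT t|?L. (r t)\<^sup>2) \<le> \<eta> \<and>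
      (AE t in ?L. AE \<sigma> in ?L. \<bar>t - \<sigma>\<bar> < h0 \<longrightarrow> a t \<sigma> \<le> 2 * C / \<rho>\<^sub>v * E \<sigma> + n \<sigma> * (r t + \<eta> + r \<sigma>))"
      if \<eta>: "\<eta> > 0" for \<eta>
    proof -
      have appW: "continuously_approximable T W"
      proof (rule continuously_approximable_cong)
        show "continuously_approximable T (\<lambda>t i x. 1 * P t i x + (-1) * Q t i x)"
          by (intro continuously_approximable_lincomb L2_time_continuously_approximable P Q) auto
      qed (simp add: W_eq)
      obtain Z r h where Z: "\<And>t. Z t \<in> HB" "h > 0"
        "\<And>t \<sigma>. t \<in> {0<..<T} \<Longrightarrow> \<sigma> \<in> {0<..<T} \<Longrightarrow> \<bar>t - \<sigma>\<bar> < h \<Longrightarrow> HN (Z t - Z \<sigma>) \<le> \<eta>"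
        "r \<in> borel_measurable ?L" "integrable ?L (\<lambda>t. (r t)\<^sup>2)" "(LINT t|?L. (r t)\<^sup>2) \<le> \<eta>"
        "AE t in ?L. W t \<in> HB \<and> HN (W t - Z t) \<le> r t"
        by (rule continuously_approximableE[OF appW \<eta>]) (rule that)
      \<comment> \<open>The null set for t concerns only goodness and the approximation; the weak
        equations are used at \<sigma> alone, where the derivatives live.\<close>
      have "AE t in ?L. AE \<sigma> in ?L. \<bar>t - \<sigma>\<bar> < h \<longrightarrow> a t \<sigma> \<le> 2 * C / \<rho>\<^sub>v * E \<sigma> + n \<sigma> * (r t + \<eta> + r \<sigma>)"
        using good Z(7)
      proof eventually_elim
        case (elim t)
        note t = elim
        show ?case
          using good Z(7) eqP eqQ L2_time_AE_in[OF P'L2] L2_time_AE_in[OF Q'L2] L2_time_AE_in[OF \<rho>]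
        proof eventually_elim
          case (elim \<sigma>)
          show ?case
          proof
            assume close: "\<bar>t - \<sigma>\<bar> < h"
            have PQ\<sigma>: "P \<sigma> \<in> HB" "Q \<sigma> \<in> HB" using elim(1) by (auto simp: good_def)
            have "\<rho>\<^sub>v * tuple_pairing (P' \<sigma>) (W \<sigma>) - \<rho>\<^sub>v * tuple_pairing (Q' \<sigma>) (W \<sigma>) \<le> C * E \<sigma>"
              using C(2)[OF PQ\<sigma> elim(7), of "\<lambda>q. \<rho>\<^sub>v * tuple_pairing (P' \<sigma>) q" "\<lambda>q. \<rho>\<^sub>v * tuple_pairing (Q' \<sigma>) q"] elim(3,4)
              by (simp add: E_W[OF elim(1)] W_eq)
            then have "a \<sigma> \<sigma> \<le> 2 * C / \<rho>\<^sub>v * E \<sigma>"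
              using pos(1) by (simp add: a_def field_simps)
            moreover have "a t \<sigma> - a \<sigma> \<sigma> \<le> n \<sigma> * (r t + \<eta> + r \<sigma>)"
            proof -
              have WH: "W t \<in> HB" "W \<sigma> \<in> HB" using W_HB t(1) elim(1) by auto
              have WD: "W t - W \<sigma> \<in> HB" using WH by (simp add: tuple_diff_eq HB_diff)
              \<comment> \<open>A detour over the approximation: from W(t) to Z(t), to Z(\<sigma>),
                to W(\<sigma>).\<close>
              have tri: "HN (W t - W \<sigma>) \<le> r t + \<eta> + r \<sigma>"
              proof -
                have "HN (W t - W \<sigma>) \<le> HN (W t - Z t) + HN (Z t - W \<sigma>)" by (intro HN_triangle WH Z)
                moreover have "HN (Z t - W \<sigma>) \<le> HN (Z t - Z \<sigma>) + HN (Z \<sigma> - W \<sigma>)" by (intro HN_triangle WH Z)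
                moreover have "HN (Z \<sigma> - W \<sigma>) = HN (W \<sigma> - Z \<sigma>)" by (intro HN_commute WH Z)
                moreover have "HN (Z t - Z \<sigma>) \<le> \<eta>"
                  using t(1) elim(1) close by (intro Z(3)) (auto simp: good_def)
                ultimately show ?thesis using t(2) elim(2) by linarith
              qed
              have "a t \<sigma> - a \<sigma> \<sigma> = 2 * (tuple_pairing (P' \<sigma>) (W t - W \<sigma>) - tuple_pairing (Q' \<sigma>) (W t - W \<sigma>))"
                using tuple_pairing_diff_right[OF elim(5) WH] tuple_pairing_diff_right[OF elim(6) WH] by (simp add: a_def)
              also have "\<dots> \<le> 2 * (DN (P' \<sigma>) * HN (W t - W \<sigma>) + DN (Q' \<sigma>) * HN (W t - W \<sigma>))"
              proof (rule mult_left_mono)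
                show "tuple_pairing (P' \<sigma>) (W t - W \<sigma>) - tuple_pairing (Q' \<sigma>) (W t - W \<sigma>)
                    \<le> DN (P' \<sigma>) * HN (W t - W \<sigma>) + DN (Q' \<sigma>) * HN (W t - W \<sigma>)"
                  using add_mono[OF abs_le_D1[OF tuple_pairing_le[OF elim(5) WD]] abs_le_D2[OF tuple_pairing_le[OF elim(6) WD]]]
                  by (simp only: diff_conv_add_uminus)
              qed simp
              also have "\<dots> = n \<sigma> * HN (W t - W \<sigma>)" by (simp add: n_def algebra_simps)
              also have "\<dots> \<le> n \<sigma> * (r t + \<eta> + r \<sigma>)"
                using tri by (intro mult_left_mono) (simp_all add: n_def tuple_norm_nonneg)
              finally show ?thesis .
            qed
            ultimately show "a t \<sigma> \<le> 2 * C / \<rho>\<^sub>v * E \<sigma> + n \<sigma> * (r t + \<eta> + r \<sigma>)" by linarith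
          qed
        qed
      qed
      with Z(2,4-6) show ?thesis by blast
    qed
  qed
  show ?thesis
    using good
  proof eventually_elim
    case (elim t)
    then have t: "0 < t" "t < T" by (auto simp: good_def)
    show ?case
    proof
      fix i
      have "(\<Sum>i\<in>UNIV. (L2_norm \<Omega> (W t i))\<^sup>2) = 0" using E_zero[OF t] E_W[OF elim] by simp
      then have "L2_norm \<Omega> (W t i) = 0" by (simp add: sum_nonneg_eq_0_iff)
      from L2_norm_eq_0[OF W_L2[OF elim] this] show "AE x in lebesgue_on \<Omega>. P t i x = Q t i x"
        by (simp add: W_eq)
    qed
  qed
qed

end

theorem theorem3p4:
  fixes \<Omega> \<Gamma>\<^sub>D \<Gamma>\<^sub>N :: "(real ^ 'n::finite) set"
    and \<Phi> :: "'n scalar_field \<Rightarrow> 'n scalar_field"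
    and \<epsilon> \<alpha> \<beta> \<gamma> g \<rho>\<^sub>v T :: real
    and \<rho> :: "real \<Rightarrow> 'n scalar_field"
    and P0 :: "'n \<Rightarrow> 'n scalar_field"
  assumes "CARD('n) \<le> 3"
    and "bounded_lipschitz_domain \<Omega>"
    and "frontier \<Omega> = \<Gamma>\<^sub>D \<union> \<Gamma>\<^sub>N" and "\<Gamma>\<^sub>D \<inter> \<Gamma>\<^sub>N = {}"
    and "\<Gamma>\<^sub>D \<in> sets (surface_measure \<Omega>)" and "emeasure (surface_measure \<Omega>) \<Gamma>\<^sub>D > 0"
    and "\<epsilon> > 0" and "\<rho>\<^sub>v > 0" and "T > 0"
    and "(\<gamma> > 0 \<and> g > 0) \<or> (\<gamma> = 0 \<and> \<beta> > 0 \<and> g > 0)"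
    and "solution_operator \<Omega> \<Gamma>\<^sub>D \<epsilon> \<Phi>"
    and "H2_regular \<Omega> \<Phi>"
    and "\<forall>i. P0 i \<in> H10 \<Omega> \<and> essentially_bounded \<Omega> (P0 i) \<and> laplacian_in_L2 \<Omega> (P0 i)"
    and "\<rho> \<in> H1_time T (L2 \<Omega>) (L2_norm \<Omega>) (L2_functionals \<Omega>)"
  shows "\<forall>P Q. weak_gradient_flow \<Omega> \<Phi> T \<rho>\<^sub>v \<alpha> \<beta> \<gamma> g \<rho> P0 P \<longrightarrow>
               weak_gradient_flow \<Omega> \<Phi> T \<rho>\<^sub>v \<alpha> \<beta> \<gamma> g \<rho> P0 Q \<longrightarrow>
               (AE t in lebesgue_on {0<..<T}. \<forall>i. AE x in lebesgue_on \<Omega>. P t i x = Q t i x)"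
proof (intro allI impI)
  fix P Q
  assume wP: "weak_gradient_flow \<Omega> \<Phi> T \<rho>\<^sub>v \<alpha> \<beta> \<gamma> g \<rho> P0 P"
    and wQ: "weak_gradient_flow \<Omega> \<Phi> T \<rho>\<^sub>v \<alpha> \<beta> \<gamma> g \<rho> P0 Q"
  interpret bounded_open_set \<Omega>
    by standard (use assms(2) in \<open>auto simp: bounded_lipschitz_domain_def\<close>)
  have \<rho>: "\<rho> \<in> L2_time T (L2 \<Omega>) (L2_norm \<Omega>)"
    using assms(14) by (auto simp: H1_time_def has_time_derivative_def)
  show "AE t in lebesgue_on {0<..<T}. \<forall>i. AE x in lebesgue_on \<Omega>. P t i x = Q t i x"
    by (rule weak_gradient_flow_unique[OF assms(1,8,9) _ _ assms(11,12) \<rho> wP wQ]) (use assms(10) in auto)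
qed

end
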